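(* Consider the $n$-server queueing systems under the NBRW-Po$d$ scheme described in the context, where the graph sequence $\{G^{(n)}\}_n$ is a $k$-regular $\theta$-expander sequence (for some constant $\theta<k$) such that, for some constant $\alpha>0$, the girth of $G^{(n)}$ is greater than $2\lceil \alpha\log_{k-1} n\rceil+1$ for all sufficiently large $n$. Let $\hat{\mathbf{X}}^{(n)}=(\hat X_i^{(n)})_{i\ge 0}$ be the stationary queue-length proportion vector of the $n$-server system. Then $$\lim_{n\to\infty}\mathrm{E}\big[\|\hat{\mathbf{X}}^{(n)}-\hat{\mathbf{x}}\|_1\big]=0,$$ where $\hat{\mathbf{x}}$ is the unique fixed point, among $\mathbf{x}\in[0,1]^{\mathbb{Z}_+}$ with $\|\mathbf{x}\|_1<\infty$, of the system of differential equations $$\frac{\mathrm{d}x_i}{\mathrm{d}t}=\lambda\,(x_{i-1}^d-x_i^d)-(x_i-x_{i+1})\quad (i\ge 1),\qquad x_0(t)\equiv 1 .$$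
   Context: Model. Fix constants $0<\lambda<1$ and integers $d\ge 2$, $k\ge 3$. For each $n$ (in an infinite set of positive integers for which the graphs below are given) there are $n$ servers, identified with the vertices $[n]$ of a $k$-regular graph $G^{(n)}$; each server has its own queue. Jobs arrive according to a Poisson process of rate $\lambda n$. Service times are i.i.d. exponential with mean $1$; each server works whenever its queue is nonempty. $\mathbf{Q}^{(n)}(t)\in\mathbb{Z}_+^n$ is the vector of queue lengths at time $t$; $\mathbb{Z}_+=\{0,1,2,\dots\}$. NBRW-Po$d$ scheme. There are $d$ independent non-backtracking random walkers on $G^{(n)}$, independent of the arrivals and services. The state of a walker is a directed edge $(u,v)$ of $G^{(n)}$ (it is at $v$, having come from $u$); in one step it moves to $(v,w)$ with $w$ uniformly distributed over the $k-1$ neighbors of $v$ other than $u$. When a job arrives, it joins the shortest queue among the $d$ queues at the current positions of the walkers, and then each walker takes one step. Ties are broken arbitrarily, by a rule depending only on the current state and possibly independent randomness. $\overline{\mathbf{W}}^{(n)}(t)$ is the vector of the $d$ directed edges describing the walkers at time $t$. Expander sequence. For a $k$-regular graph $G^{(n)}$ on $n$ vertices let $k=\mu_1\ge\mu_2\ge\dots\ge\mu_n$ be the eigenvalues of its adjacency matrix and $\mu^{(n)}=\max\{\mu_2,|\mu_n|\}$. The sequence is a $\theta$-expander sequence if $\limsup_{n\to\infty}\mu^{(n)}\le\theta$ where $\theta<k$ is a constant. (The constant $\theta$ is unrelated to $\lambda$.) Stationary quantities. For all sufficiently large $n$, $G^{(n)}$ is connected and aperiodic and the Markov process $(\mathbf{Q}^{(n)}(t),\overline{\mathbf{W}}^{(n)}(t))$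 is irreducible and positive recurrent; $\hat{\mathbf{Q}}^{(n)}$ denotes a random vector distributed as the queue-length component under its stationary distribution, and $\hat X_i^{(n)}=\frac1n\#\{j\in[n]:\hat Q^{(n)}_j\ge i\}$, $i\in\mathbb{Z}_+$. $\|\mathbf{x}\|_1=\sum_{i\ge 0}|x_i|$. *)

theory Defs
  imports
    "HOL-Probability.Probability"
    "HOL-Computational_Algebra.Computational_Algebra"
    "Jordan_Normal_Form.Char_Poly"
    "Graph_Theory.Graph_Theory"
begin

text \<open>
  A simple undirected graph is a \<^locale>\<open>pair_graph\<close>: every undirected edge is represented by its
  two orientations, so \<^term>\<open>parcs G\<close> is exactly the set of directed edges on which the walkers live.
\<close>

definition regular_graph_on :: "nat \<Rightarrow> nat \<Rightarrow> nat pair_pre_digraph \<Rightarrow> bool" where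
  "regular_graph_on n k G \<longleftrightarrow>
     pair_graph G \<and> pverts G = {..<n} \<and> (\<forall>v \<in> pverts G. out_degree (with_proj G) v = k)"

text \<open>
  In the symmetric digraph representing a simple graph, \<^const>\<open>pre_digraph.cycle\<close> also admits the
  back-and-forth walk along a single edge; these are the only cycles with fewer than three arcs,
  and they are excluded. The girth of a forest is infinite.
\<close>

definition girth :: "nat pair_pre_digraph \<Rightarrow> enat" where
  "girth G = (INF p \<in> {p. pre_digraph.cycle (with_proj G) p \<and> length p \<ge> 3}. enat (length p))"

definition adjacency_matrix :: "nat \<Rightarrow> nat pair_pre_digraph \<Rightarrow> real mat" where
  "adjacency_matrix n G = mat n n (\<lambda>(i, j). if (i, j) \<in> parcs G then 1 else 0)"

text \<open>
  The eigenvalues in non-increasing order, repeated according to multiplicity. All eigenvalues of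
  an adjacency matrix are real, so for a graph on \<open>n\<close> vertices this list has length \<open>n\<close>.
\<close>

definition adjacency_spectrum :: "nat \<Rightarrow> nat pair_pre_digraph \<Rightarrow> real list" where
  "adjacency_spectrum n G =
     rev (sorted_list_of_multiset (proots (char_poly (adjacency_matrix n G))))"

text \<open>List positions start at 0, so \<open>\<mu>\<^sub>2\<close> is at position 1 and \<open>\<mu>\<^sub>n\<close> at position \<open>n - 1\<close>.\<close>

definition second_eigenvalue :: "nat \<Rightarrow> nat pair_pre_digraph \<Rightarrow> real" where
  "second_eigenvalue n G =
     max (adjacency_spectrum n G ! 1) \<bar>adjacency_spectrum n G ! (n - 1)\<bar>"

text \<open>Graph sizes range over a set \<open>N\<close>; limits are taken as \<open>n \<rightarrow> \<infinity>\<close> within \<open>N\<close>.\<close>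

definition at_top_in :: "nat set \<Rightarrow> nat filter" where
  "at_top_in N = inf at_top (principal N)"

definition expander_sequence ::
    "nat set \<Rightarrow> nat \<Rightarrow> real \<Rightarrow> (nat \<Rightarrow> nat pair_pre_digraph) \<Rightarrow> bool" where
  "expander_sequence N k \<theta> G \<longleftrightarrow>
     \<theta> < real k \<and> (\<forall>n \<in> N. regular_graph_on n k (G n)) \<and>
     Limsup (at_top_in N) (\<lambda>n. ereal (second_eigenvalue n (G n))) \<le> ereal \<theta>"

text \<open>
  \<open>P t s\<close> is the law at time \<open>t\<close> of the process started in \<open>s\<close>. The last conjunct says that
  \<open>P\<close> has the transition rates \<open>g\<close>, i.e.\ \<open>P h s s' = [s = s'] + g s s' h + o(h)\<close> as \<open>h \<rightarrow> 0+\<close>,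
  where \<open>g s s\<close> is minus the total rate of leaving \<open>s\<close>.
\<close>

definition transition_function ::
    "'s set \<Rightarrow> ('s \<Rightarrow> 's \<Rightarrow> real) \<Rightarrow> (real \<Rightarrow> 's \<Rightarrow> 's pmf) \<Rightarrow> bool" where
  "transition_function S g P \<longleftrightarrow>
     (\<forall>s \<in> S. P 0 s = return_pmf s) \<and>
     (\<forall>t \<ge> 0. \<forall>s \<in> S. set_pmf (P t s) \<subseteq> S) \<and>
     (\<forall>t \<ge> 0. \<forall>u \<ge> 0. \<forall>s \<in> S. P (t + u) s = bind_pmf (P t s) (P u)) \<and>
     (\<forall>s \<in> S. \<forall>s' \<in> S.
        ((\<lambda>h. (pmf (P h s) s' - of_bool (s' = s)) / h) \<longlongrightarrow> g s s') (at_right 0))"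

definition stationary_distribution ::
    "'s set \<Rightarrow> (real \<Rightarrow> 's \<Rightarrow> 's pmf) \<Rightarrow> 's pmf \<Rightarrow> bool" where
  "stationary_distribution S P p \<longleftrightarrow>
     set_pmf p \<subseteq> S \<and> (\<forall>t \<ge> 0. bind_pmf p (P t) = p)"

text \<open>
  A state consists of the queue lengths of the servers \<open>0, \<dots>, n - 1\<close> and of the directed edges
  occupied by the walkers \<open>0, \<dots>, d - 1\<close>. A walker on \<open>(u, v)\<close> is at \<open>v\<close>, having come from \<open>u\<close>.
\<close>

type_synonym state = "(nat \<Rightarrow> nat) \<times> (nat \<Rightarrow> nat \<times> nat)"

definition states :: "nat \<Rightarrow> nat \<Rightarrow> nat pair_pre_digraph \<Rightarrow> state set" where
  "states n d G = ({..<n} \<rightarrow>\<^sub>E UNIV) \<times> ({..<d} \<rightarrow>\<^sub>E parcs G)"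

definition nbrw_step :: "nat pair_pre_digraph \<Rightarrow> nat \<times> nat \<Rightarrow> (nat \<times> nat) pmf" where
  "nbrw_step G e = (case e of (u, v) \<Rightarrow>
     map_pmf (\<lambda>w. (v, w)) (pmf_of_set ({w. (v, w) \<in> parcs G} - {u})))"

definition walkers_step ::
    "nat \<Rightarrow> nat pair_pre_digraph \<Rightarrow> (nat \<Rightarrow> nat \<times> nat) \<Rightarrow> (nat \<Rightarrow> nat \<times> nat) pmf" where
  "walkers_step d G w = Pi_pmf {..<d} undefined (\<lambda>i. nbrw_step G (w i))"

definition shortest_queues :: "nat \<Rightarrow> state \<Rightarrow> nat set" where
  "shortest_queues d s = (case s of (q, w) \<Rightarrow>
     {v \<in> (\<lambda>i. snd (w i)) ` {..<d}. \<forall>i < d. q v \<le> q (snd (w i))})"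

text \<open>
  A tie-breaking rule assigns to every state the law of the server chosen for a job that arrives
  in this state; the randomness is drawn afresh and independently at every arrival.
\<close>

definition tie_breaking_rule ::
    "nat \<Rightarrow> nat \<Rightarrow> nat pair_pre_digraph \<Rightarrow> (state \<Rightarrow> nat pmf) \<Rightarrow> bool" where
  "tie_breaking_rule n d G \<tau> \<longleftrightarrow> (\<forall>s \<in> states n d G. set_pmf (\<tau> s) \<subseteq> shortest_queues d s)"

definition arrival ::
    "nat \<Rightarrow> nat pair_pre_digraph \<Rightarrow> (state \<Rightarrow> nat pmf) \<Rightarrow> state \<Rightarrow> state pmf" where
  "arrival d G \<tau> s = (case s of (q, w) \<Rightarrow>
     map_pmf (\<lambda>(j, w'). (q(j := Suc (q j)), w')) (pair_pmf (\<tau> s) (walkers_step d G w)))"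

definition departure :: "nat \<Rightarrow> state \<Rightarrow> state" where
  "departure j s = (case s of (q, w) \<Rightarrow> (q(j := q j - 1), w))"

definition busy_servers :: "nat \<Rightarrow> state \<Rightarrow> nat set" where
  "busy_servers n s = {j \<in> {..<n}. fst s j > 0}"

text \<open>
  Arrivals occur at rate \<open>\<lambda> n\<close>, and every busy server completes a job at rate 1. Both kinds of
  events change the state, so the total rate of leaving \<open>s\<close> is \<open>\<lambda> n\<close> plus the number of busy
  servers.
\<close>

definition nbrw_pod_generator ::
    "real \<Rightarrow> nat \<Rightarrow> nat \<Rightarrow> nat pair_pre_digraph \<Rightarrow> (state \<Rightarrow> nat pmf) \<Rightarrow> state \<Rightarrow> state \<Rightarrow> real" where
  "nbrw_pod_generator lam d n G \<tau> s s' =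
     lam * real n * pmf (arrival d G \<tau> s) s'
     + (\<Sum>j \<in> busy_servers n s. of_bool (s' = departure j s))
     - of_bool (s' = s) * (lam * real n + real (card (busy_servers n s)))"

definition queue_proportion :: "nat \<Rightarrow> (nat \<Rightarrow> nat) \<Rightarrow> nat \<Rightarrow> real" where
  "queue_proportion n q i = real (card {j \<in> {..<n}. q j \<ge> i}) / real n"

definition l1_norm :: "(nat \<Rightarrow> real) \<Rightarrow> ennreal" where
  "l1_norm x = (\<Sum>i. ennreal \<bar>x i\<bar>)"

definition drift :: "real \<Rightarrow> nat \<Rightarrow> (nat \<Rightarrow> real) \<Rightarrow> nat \<Rightarrow> real" where
  "drift lam d x i = lam * (x (i - 1) ^ d - x i ^ d) - (x i - x (i + 1))"

definition fixed_point :: "real \<Rightarrow> nat \<Rightarrow> (nat \<Rightarrow> real) \<Rightarrow> bool" where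
  "fixed_point lam d x \<longleftrightarrow> x 0 = 1 \<and> (\<forall>i \<ge> 1. drift lam d x i = 0)"

end

theory Submission
  imports Defs "Jordan_Normal_Form.Schur_Decomposition" "HOL-Real_Asymp.Real_Asymp"
begin

text \<open>
  The stationary law is studied directly, through balance equations. Write \<open>q\<close> for the queue
  lengths, \<open>w\<close> for the walkers, \<open>X\<^sub>i\<close> for the proportion of queues of length at least \<open>i\<close>, and \<open>A\<^sub>i\<close> for
  the indicator that all \<open>d\<close> walkers stand at queues of length at least \<open>i\<close>. The rates are bounded for fixed \<open>n\<close>, so a stationary law of the
  continuous-time process is invariant under the uniformized jump chain, and in stationarity the
  expected rate of change of every bounded function of the state vanishes (\<open>balance\<close>). For a
  smooth function of finitely many \<open>X\<^sub>i\<close> with partial derivatives \<open>g\<^sub>i\<close> this says, up to \<open>O(1/n)\<close>, that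
  the expectation of \<open>\<Sum>\<^sub>i g\<^sub>i(X) (\<lambda>(A\<^sub>i\<^sub>-\<^sub>1 - A\<^sub>i) - (X\<^sub>i - X\<^sub>i\<^sub>+\<^sub>1))\<close> is zero (\<open>rate_balance\<close>).

  The heart of the matter is to replace \<open>A\<^sub>i\<close> by \<open>X\<^sub>i\<^sup>d\<close> in this equation (\<open>decorrelation\<close>). Freeze the
  queues and let \<open>u(q, w)\<close> be the sum over \<open>r < m\<close> of the probability that, after \<open>r\<close> further steps,
  all walkers stand at queues of length at least \<open>i\<close>. A step of the walkers turns the sum into a
  telescoping one, so balance for \<open>F(q) u(q, w)\<close> compares \<open>A\<^sub>i\<close> with the same probability \<open>m\<close> steps
  later (\<open>corrector\<close>). If \<open>m\<close> is of order \<open>log n\<close> the walkers of an expander have mixed by then and that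
  probability is close to \<open>X\<^sub>i\<^sup>d\<close>. The price is the effect of changed queue lengths on \<open>u\<close>, and changing one
  queue alters \<open>u\<close> by at most the expected number of visits to that server within \<open>m\<close> steps. A departing
  job leaves a server that has nothing to do with the walkers, and costs \<open>O(m/n)\<close>. An arriving job joins
  a server at which a walker is standing: another walker comes there with probability \<open>O(1/n)\<close> per step
  by mixing, but the walker itself comes back only along a closed non-backtracking walk. Large girth
  excludes these up to length \<open>\<alpha> log n\<close> and makes the neighbourhoods trees, so that later visits have
  probability at most \<open>n\<^sup>-\<^sup>\<alpha>\<close> per step. In all, the price tends to zero.

  Hence the expectation of \<open>\<Sum>\<^sub>i g\<^sub>i(X) b\<^sub>i(X)\<close> tends to zero, where \<open>b\<close> is the drift of the
  differential equation. The differential equation is cooperative and moves mass only between neighbouring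
  coordinates, so the distance in \<open>l\<^sub>1\<close> to the fixed point does not increase along it; moreover it decreases at rate at least \<open>\<bar>x\<^sub>1 - x'\<^sub>1\<bar>\<close>, because the
  coordinate \<open>0\<close> is kept at \<open>1\<close> (\<open>drift_contraction\<close>). A smoothed \<open>l\<^sub>1\<close> distance as a test function
  therefore shows that \<open>X\<^sub>1\<close> concentrates at its limit \<open>x'\<^sub>1\<close>, and the test functions
  \<open>(x\<^sub>i - x'\<^sub>i)(x\<^sub>i\<^sub>+\<^sub>1 - x'\<^sub>i\<^sub>+\<^sub>1)\<close> carry the concentration from one coordinate to the next
  (\<open>mean_deviation_next\<close>). The tails are uniformly small: balance gives \<open>E X\<^sub>i\<^sub>+\<^sub>1 = \<lambda> E A\<^sub>i\<close>, and \<open>E A\<^sub>i\<close> is at most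
  the probability that one single walker sees a queue of length at least \<open>i\<close>, which is close to
  \<open>E X\<^sub>i\<close>; so \<open>E X\<^sub>i\<close> decays geometrically (\<open>tail_sum\<close>).

  It remains to see that the walkers of an expander mix in a logarithmic number of steps. The number of
  non-backtracking walks of given length between two places is given by Chebyshev-like polynomials
  of the adjacency matrix, and the squared Frobenius distance of such a matrix from its mean is a
  trace, hence a sum over the nontrivial eigenvalues (\<open>nbrw_mixing\<close>).
\<close>

section \<open>Chebyshev polynomials of a symmetric matrix\<close>

text \<open>
  These are the rescaled Chebyshev polynomials of the second kind, \<open>c\<^sup>r\<^sup>/\<^sup>2 U\<^sub>r(x / (2 \<surd>c))\<close>. For
  \<open>c = k - 1\<close>, differences of these polynomials in the adjacency matrix count the non-backtracking walks
  of a \<open>k\<close>-regular graph.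
\<close>

fun chebyshev :: "real \<Rightarrow> real \<Rightarrow> nat \<Rightarrow> real" where
  "chebyshev c x 0 = 1"
| "chebyshev c x (Suc 0) = x"
| "chebyshev c x (Suc (Suc r)) = x * chebyshev c x (Suc r) - c * chebyshev c x r"

text \<open>
  A non-real root has modulus \<open>\<surd>c\<close>. For a real root \<open>a\<close>, the function \<open>a + c / a\<close> is increasing
  beyond \<open>\<surd>c\<close>, so \<open>a > R\<close> would force \<open>\<bar>x\<bar> > R + c / R\<close>.
\<close>

lemma chebyshev_root_bound:
  fixes z :: complex and x c R :: real
  assumes "z\<^sup>2 - of_real x * z + of_real c = 0" "0 < R" "c \<le> R\<^sup>2" "\<bar>x\<bar> \<le> R + c / R"
  shows "norm z \<le> R"
proof -
  define a b where "a = Re z" and "b = Im z"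
  have re: "a\<^sup>2 - b\<^sup>2 - x * a + c = 0" and im: "2 * a * b - x * b = 0"
    using arg_cong[OF assms(1), of Re] arg_cong[OF assms(1), of Im]
    by (simp_all add: a_def b_def power2_eq_square)
  have nz: "(norm z)\<^sup>2 = a\<^sup>2 + b\<^sup>2" by (simp add: cmod_power2 a_def b_def)
  show ?thesis
  proof (cases "b = 0")
    case False
    then have "x = 2 * a" using im by (simp add: left_diff_distrib[symmetric])
    then have "(norm z)\<^sup>2 = c" using re nz by (simp add: power2_eq_square)
    then show ?thesis using assms by (metis power2_le_imp_le less_imp_le)
  next
    case True
    have "\<bar>a\<bar>\<^sup>2 + c = x * a" using re True by simp
    also have "\<dots> \<le> \<bar>x\<bar> * \<bar>a\<bar>" by (metis abs_ge_self abs_mult)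
    also have "\<dots> \<le> (R + c / R) * \<bar>a\<bar>" using assms by (intro mult_right_mono) auto
    finally have 1: "(\<bar>a\<bar> - R) * (\<bar>a\<bar> - c / R) \<le> 0"
      using assms by (simp add: field_simps power2_eq_square)
    have "c / R \<le> R" using assms by (simp add: field_simps power2_eq_square)
    have "\<bar>a\<bar> \<le> R"
    proof (rule ccontr)
      assume "\<not> ?thesis"
      then have "(\<bar>a\<bar> - R) * (\<bar>a\<bar> - c / R) > 0" using \<open>c / R \<le> R\<close> by simp
      then show False using 1 by simp
    qed
    moreover have "(norm z)\<^sup>2 = \<bar>a\<bar>\<^sup>2" using True nz by simp
    ultimately show ?thesis by (metis norm_ge_zero abs_ge_zero power2_eq_iff_nonneg)
  qed
qed

text \<open>
  With \<open>z\<^sub>1, z\<^sub>2\<close> the roots of \<open>z\<^sup>2 - x z + c\<close>, the polynomial equals \<open>\<Sum>\<^sub>j z\<^sub>1\<^sup>j z\<^sub>2\<^sup>r\<^sup>-\<^sup>j\<close>, a sum of \<open>r + 1\<close>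
  terms of modulus at most \<open>R\<^sup>r\<close>. For the eigenvalue \<open>k\<close> the larger root is \<open>k - 1\<close>; eigenvalues
  bounded away from \<open>k\<close> in modulus allow \<open>R < k - 1\<close>, which is where the spectral gap enters.
\<close>

lemma chebyshev_bound:
  fixes x c R :: real
  assumes "0 < R" "c \<le> R\<^sup>2" "\<bar>x\<bar> \<le> R + c / R"
  shows "\<bar>chebyshev c x r\<bar> \<le> (real r + 1) * R ^ r"
proof -
  define z1 where "z1 = (of_real x + csqrt (of_real (x\<^sup>2 - 4 * c))) / 2"
  define z2 where "z2 = of_real x - z1"
  have prod: "z1 * z2 = of_real c"
  proof -
    have "z1 * z2 = ((of_real x)\<^sup>2 - (csqrt (of_real (x\<^sup>2 - 4 * c)))\<^sup>2) / 4"
      unfolding z2_def z1_def by (simp add: field_simps power2_eq_square)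
    then show ?thesis by simp
  qed
  have n1: "norm z1 \<le> R"
  proof (rule chebyshev_root_bound[OF _ assms])
    show "z1\<^sup>2 - of_real x * z1 + of_real c = 0"
      unfolding prod[symmetric] z2_def by (simp add: algebra_simps power2_eq_square)
  qed
  have n2: "norm z2 \<le> R"
  proof (rule chebyshev_root_bound[OF _ assms])
    show "z2\<^sup>2 - of_real x * z2 + of_real c = 0"
      unfolding prod[symmetric] z2_def by (simp add: algebra_simps power2_eq_square)
  qed
  have rec: "of_real (chebyshev c x (Suc r)) - z2 * of_real (chebyshev c x r) = z1 ^ Suc r" for r
  proof (induction r)
    case 0 show ?case by (simp add: z2_def)
  next
    case (Suc r)
    have "of_real (chebyshev c x (Suc (Suc r))) - z2 * of_real (chebyshev c x (Suc r))
        = (of_real x - z2) * of_real (chebyshev c x (Suc r)) - of_real c * of_real (chebyshev c x r)"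
      by (simp add: algebra_simps)
    also have "\<dots> = z1 * (of_real (chebyshev c x (Suc r)) - z2 * of_real (chebyshev c x r))"
      unfolding prod[symmetric] by (simp add: z2_def algebra_simps)
    also have "\<dots> = z1 ^ Suc (Suc r)" using Suc by simp
    finally show ?case .
  qed
  show ?thesis
  proof (induction r)
    case 0 show ?case by simp
  next
    case (Suc r)
    have "\<bar>chebyshev c x (Suc r)\<bar> = norm (z1 ^ Suc r + z2 * of_real (chebyshev c x r))"
      unfolding rec[symmetric] by simp
    also have "\<dots> \<le> norm z1 ^ Suc r + norm z2 * \<bar>chebyshev c x r\<bar>"
      by (rule order_trans[OF norm_triangle_ineq]) (simp add: norm_mult norm_power)
    also have "\<dots> \<le> R ^ Suc r + R * ((real r + 1) * R ^ r)"
      using n1 n2 Suc assms(1) by (intro add_mono mult_mono power_mono) auto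
    also have "\<dots> = (real (Suc r) + 1) * R ^ Suc r" by (simp add: algebra_simps)
    finally show ?case .
  qed
qed

fun chebyshev_mat :: "real \<Rightarrow> real mat \<Rightarrow> nat \<Rightarrow> real mat" where
  "chebyshev_mat c A 0 = 1\<^sub>m (dim_row A)"
| "chebyshev_mat c A (Suc 0) = A"
| "chebyshev_mat c A (Suc (Suc r)) = A * chebyshev_mat c A (Suc r) - c \<cdot>\<^sub>m chebyshev_mat c A r"

lemma mult_carrier_square [simp]:
  "X \<in> carrier_mat n n \<Longrightarrow> Y \<in> carrier_mat n n \<Longrightarrow> X * Y \<in> carrier_mat n n"
  by (rule mult_carrier_mat)

lemma chebyshev_mat_carrier [simp]: "A \<in> carrier_mat n n \<Longrightarrow> chebyshev_mat c A r \<in> carrier_mat n n"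
  by (induction c A r rule: chebyshev_mat.induct) auto

lemma chebyshev_mat_entry:
  assumes "A \<in> carrier_mat n n" "i < n" "j < n"
  shows "chebyshev_mat c A (Suc (Suc r)) $$ (i, j)
      = (A * chebyshev_mat c A (Suc r)) $$ (i, j) - c * chebyshev_mat c A r $$ (i, j)"
  using assms carrier_matD[OF chebyshev_mat_carrier[OF assms(1), of c r]] by (simp del: index_mult_mat(1))

lemma chebyshev_mat_commute:
  assumes "A \<in> carrier_mat n n"
  shows "A * chebyshev_mat c A r = chebyshev_mat c A r * A"
  using assms
proof (induction c A r rule: chebyshev_mat.induct)
  case (3 c A r)
  have X: "chebyshev_mat c A (Suc r) \<in> carrier_mat n n" "chebyshev_mat c A r \<in> carrier_mat n n"
      using 3 by simp_all
  have "A * chebyshev_mat c A (Suc (Suc r))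
      = A * (A * chebyshev_mat c A (Suc r)) - c \<cdot>\<^sub>m (A * chebyshev_mat c A r)"
    using X 3(3) by (simp add: mult_minus_distrib_mat[of _ n n _ n] mult_smult_distrib[of _ n n _ n])
  also have "A * (A * chebyshev_mat c A (Suc r)) = A * chebyshev_mat c A (Suc r) * A"
    using X 3(3) 3(1)[OF 3(3)] by (metis assoc_mult_mat)
  also have "c \<cdot>\<^sub>m (A * chebyshev_mat c A r) = (c \<cdot>\<^sub>m chebyshev_mat c A r) * A"
    using X 3 by (simp add: mult_smult_assoc_mat[of _ n n _ n])
  also have "A * chebyshev_mat c A (Suc r) * A - (c \<cdot>\<^sub>m chebyshev_mat c A r) * A
      = chebyshev_mat c A (Suc (Suc r)) * A"
    using X 3(3) by (simp add: minus_mult_distrib_mat[of _ n n _ _ n])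
  finally show ?case .
qed auto

lemma chebyshev_mat_symmetric:
  assumes "A \<in> carrier_mat n n" "transpose_mat A = A"
  shows "transpose_mat (chebyshev_mat c A r) = chebyshev_mat c A r"
  using assms
proof (induction c A r rule: chebyshev_mat.induct)
  case (3 c A r)
  have X: "chebyshev_mat c A (Suc r) \<in> carrier_mat n n" "chebyshev_mat c A r \<in> carrier_mat n n"
      using 3 by simp_all
  have "transpose_mat (chebyshev_mat c A (Suc (Suc r)))
      = transpose_mat (A * chebyshev_mat c A (Suc r)) - transpose_mat (c \<cdot>\<^sub>m chebyshev_mat c A r)"
    using X 3(3) by (simp add: transpose_minus[of _ n n])
  also have "transpose_mat (A * chebyshev_mat c A (Suc r)) = chebyshev_mat c A (Suc r) * A"
    using X 3 by (simp add: transpose_mult[of _ n n _ n])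
  also have "\<dots> = A * chebyshev_mat c A (Suc r)" using chebyshev_mat_commute[OF 3(3)] by simp
  also have "transpose_mat (c \<cdot>\<^sub>m chebyshev_mat c A r) = c \<cdot>\<^sub>m transpose_mat (chebyshev_mat c A r)"
    by (intro eq_matI) auto
  finally show ?case using 3 by simp
qed auto

lemma chebyshev_mat_similar:
  assumes "A \<in> carrier_mat n n" "B \<in> carrier_mat n n" "P \<in> carrier_mat n n" "Q \<in> carrier_mat n n"
    "P * Q = 1\<^sub>m n" "Q * P = 1\<^sub>m n" "A = P * B * Q"
  shows "chebyshev_mat c A r = P * chebyshev_mat c B r * Q"
proof -
  show ?thesis
  proof (induction r rule: induct_nat_012)
    case 0 show ?case using assms by auto
  next
    case 1 show ?case using assms by auto
  next
    case (ge2 r)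
    let ?X = "chebyshev_mat c B (Suc r)" and ?Y = "chebyshev_mat c B r"
    have X: "?X \<in> carrier_mat n n" "?Y \<in> carrier_mat n n" using assms by simp_all
    have "A * (P * ?X * Q) = P * (B * ?X) * Q"
    proof -
      have "A * (P * ?X * Q) = P * B * (Q * P) * ?X * Q"
        using assms(2-4,7) X by (simp add: assoc_mult_mat[of _ n n _ n _ n])
      also have "\<dots> = P * B * ?X * Q" using assms X by simp
      also have "\<dots> = P * (B * ?X) * Q"
        using assms X by (simp add: assoc_mult_mat[of _ n n _ n _ n])
      finally show ?thesis .
    qed
    moreover have "c \<cdot>\<^sub>m (P * ?Y * Q) = P * (c \<cdot>\<^sub>m ?Y) * Q"
      using assms X by (simp add: mult_smult_distrib[of _ n n _ n] mult_smult_assoc_mat[of _ n n _ n])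
    moreover have "P * (B * ?X) * Q - P * (c \<cdot>\<^sub>m ?Y) * Q = P * (B * ?X - c \<cdot>\<^sub>m ?Y) * Q"
      using assms X by (simp add: mult_minus_distrib_mat[of _ n n _ n] minus_mult_distrib_mat[of _ n n _ _ n])
    ultimately show ?case using ge2 by simp
  qed
qed

definition mat_trace :: "real mat \<Rightarrow> real" where "mat_trace M = (\<Sum>i<dim_row M. M $$ (i, i))"

lemma mat_mult_entry:
  assumes "X \<in> carrier_mat n n" "Y \<in> carrier_mat n n" "i < n" "j < n"
  shows "(X * Y) $$ (i, j) = (\<Sum>l<n. X $$ (i, l) * Y $$ (l, j))"
  using assms by (auto simp: scalar_prod_def lessThan_atLeast0 intro!: sum.cong)

lemma mat_trace_commute:
  assumes "X \<in> carrier_mat n n" "Y \<in> carrier_mat n n"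
  shows "mat_trace (X * Y) = mat_trace (Y * X)"
proof -
  have "mat_trace (X * Y) = (\<Sum>i<n. \<Sum>l<n. X $$ (i, l) * Y $$ (l, i))"
    using assms unfolding mat_trace_def
        by (auto simp: mat_mult_entry[OF assms] simp del: index_mult_mat(1) intro!: sum.cong)
  also have "\<dots> = (\<Sum>l<n. \<Sum>i<n. Y $$ (l, i) * X $$ (i, l))"
    by (subst sum.swap) (simp add: mult.commute)
  also have "\<dots> = mat_trace (Y * X)"
    using assms unfolding mat_trace_def
        by (auto simp: mat_mult_entry[OF assms(2,1)] simp del: index_mult_mat(1) intro!: sum.cong)
  finally show ?thesis .
qed

lemma upper_triangular_mult:
  assumes "X \<in> carrier_mat n n" "Y \<in> carrier_mat n n" "upper_triangular X" "upper_triangular (Y :: real mat)"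
  shows "upper_triangular (X * Y)" and "i < n \<Longrightarrow> (X * Y) $$ (i, i) = X $$ (i, i) * Y $$ (i, i)"
proof -
  have z: "X $$ (i, l) * Y $$ (l, j) = 0" if "i < n" "l < n" "j < i \<or> j = i \<and> l \<noteq> i" for i l j
  proof (cases "l < i")
    case True then show ?thesis using assms that by (auto simp: upper_triangular_def)
  next
    case False then have "j < l" using that by auto
    then show ?thesis using assms that by (auto simp: upper_triangular_def)
  qed
  show "upper_triangular (X * Y)"
  proof (rule upper_triangularI)
    fix i j assume a: "j < i" "i < dim_row (X * Y)"
    then have "i < n" "j < n" using assms by auto
    then show "(X * Y) $$ (i, j) = 0"
      using z a by (subst mat_mult_entry[OF assms(1,2)]) (auto intro!: sum.neutral)
  qed
  assume i: "i < n"
  then have "(X * Y) $$ (i, i) = (\<Sum>l<n. X $$ (i, l) * Y $$ (l, i))"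
    by (subst mat_mult_entry[OF assms(1,2)]) auto
  also have "\<dots> = (\<Sum>l<n. if l = i then X $$ (i, i) * Y $$ (i, i) else 0)"
    using z i by (intro sum.cong) auto
  also have "\<dots> = X $$ (i, i) * Y $$ (i, i)" using i by simp
  finally show "(X * Y) $$ (i, i) = X $$ (i, i) * Y $$ (i, i)" .
qed

lemma chebyshev_mat_upper_triangular:
  assumes "B \<in> carrier_mat n n" "upper_triangular B"
  shows "upper_triangular (chebyshev_mat c B r) \<and> (\<forall>i<n. chebyshev_mat c B r $$ (i, i)
      = chebyshev c (B $$ (i, i)) r)"
proof (induction r rule: induct_nat_012)
  case (ge2 r)
  have X: "chebyshev_mat c B (Suc r) \<in> carrier_mat n n" "chebyshev_mat c B r \<in> carrier_mat n n"
      using assms by simp_all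
  note u = upper_triangular_mult[OF assms(1) X(1) assms(2) conjunct1[OF ge2(2)]]
  have "upper_triangular (chebyshev_mat c B (Suc (Suc r)))"
  proof (rule upper_triangularI)
    fix i j assume a: "j < i" "i < dim_row (chebyshev_mat c B (Suc (Suc r)))"
    then have "i < n" "j < n" using X by auto
    then have "(B * chebyshev_mat c B (Suc r)) $$ (i, j) = 0" "chebyshev_mat c B r $$ (i, j) = 0"
      using u(1) ge2(1) a(1) carrier_matD(1)[OF X(2)] carrier_matD(1)[OF assms(1)] \<open>i < n\<close>
      by (auto simp del: index_mult_mat(1) intro!: upper_triangularD)
    then show "chebyshev_mat c B (Suc (Suc r)) $$ (i, j) = 0"
      by (simp add: chebyshev_mat_entry[OF assms(1) \<open>i < n\<close> \<open>j < n\<close>] del: chebyshev_mat.simps index_mult_mat(1))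
  qed
  moreover have "chebyshev_mat c B (Suc (Suc r)) $$ (i, i) = chebyshev c (B $$ (i, i)) (Suc (Suc r))"
      if "i < n" for i
    using u(2) ge2 that X by (auto simp del: index_mult_mat(1))
  ultimately show ?case by blast
qed (use assms in auto)

text \<open>
  Triangularization suffices: the diagonal of a polynomial in a triangular matrix consists of the
  values of the polynomial at the diagonal entries, and the trace is invariant under similarity.
\<close>

lemma mat_trace_chebyshev_square:
  assumes A: "A \<in> carrier_mat n n" and cp: "char_poly A = (\<Prod>e\<leftarrow>es. [:- e, 1:])"
  shows "mat_trace (chebyshev_mat c A r * chebyshev_mat c A r) = (\<Sum>e\<leftarrow>es. (chebyshev c e r)\<^sup>2)"
proof -
  obtain B P Q where sd: "schur_decomposition A es = (B, P, Q)" by (metis prod_cases3)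
  from schur_decomposition[OF A cp sd]
  have s: "similar_mat_wit A B P Q" and ut: "upper_triangular B" and d: "diag_mat B = es" by auto
  have w: "B \<in> carrier_mat n n" "P \<in> carrier_mat n n" "Q \<in> carrier_mat n n"
    "P * Q = 1\<^sub>m n" "Q * P = 1\<^sub>m n" "A = P * B * Q"
    using s A by (auto simp: similar_mat_wit_def Let_def)
  let ?X = "chebyshev_mat c A r" and ?Y = "chebyshev_mat c B r"
  have Y: "?Y \<in> carrier_mat n n" using w by simp
  have X: "?X = P * ?Y * Q" using chebyshev_mat_similar[OF A w] .
  have "?X * ?X = P * ?Y * (Q * P) * ?Y * Q"
    unfolding X using w(1-3) Y by (simp add: assoc_mult_mat[of _ n n _ n _ n])
  also have "\<dots> = P * (?Y * ?Y * Q)"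
    unfolding w(5) using w(1-3) Y by (simp add: assoc_mult_mat[of _ n n _ n _ n] left_mult_one_mat[of _ n n])
  finally have "mat_trace (?X * ?X) = mat_trace (P * (?Y * ?Y * Q))" by simp
  also have "\<dots> = mat_trace (?Y * ?Y * Q * P)" by (rule mat_trace_commute[of _ n]) (use w Y in auto)
  also have "?Y * ?Y * Q * P = ?Y * ?Y"
    using w(1-3,5) Y by (simp add: assoc_mult_mat[of _ n n _ n _ n] right_mult_one_mat[of _ n n])
  also have "mat_trace (?Y * ?Y) = (\<Sum>i<n. (chebyshev c (B $$ (i, i)) r)\<^sup>2)"
  proof -
    have u: "upper_triangular ?Y" "\<forall>i<n. ?Y $$ (i, i) = chebyshev c (B $$ (i, i)) r"
      using chebyshev_mat_upper_triangular[OF w(1) ut] by auto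
    show ?thesis unfolding mat_trace_def using Y upper_triangular_mult(2)[OF Y Y u(1) u(1)] u(2)
      by (auto simp del: index_mult_mat(1) simp: power2_eq_square intro!: sum.cong)
  qed
  also have "\<dots> = (\<Sum>e\<leftarrow>es. (chebyshev c e r)\<^sup>2)"
    unfolding d[symmetric] diag_mat_def using w(1)
        by (simp add: interv_sum_list_conv_sum_set_nat o_def lessThan_atLeast0)
  finally show ?thesis .
qed

text \<open>
  The quadratic form of the conjugated eigenvector and the eigenvector is \<open>a\<close> times a positive number,
  and by symmetry it equals its own conjugate.
\<close>

lemma symmetric_eigenvalue_real:
  assumes A: "A \<in> carrier_mat n n" and sym: "transpose_mat A = (A :: real mat)"
    and ev: "eigenvalue (map_mat complex_of_real A) a"
  shows "a \<in> \<real>"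
proof -
  let ?C = "map_mat complex_of_real A"
  obtain v where v: "v \<in> carrier_vec n" "v \<noteq> 0\<^sub>v n" "?C *\<^sub>v v = a \<cdot>\<^sub>v v"
    using ev A unfolding eigenvalue_def eigenvector_def by auto
  have row: "(\<Sum>j<n. of_real (A $$ (i, j)) * v $ j) = a * v $ i" if "i < n" for i
  proof -
    have "(?C *\<^sub>v v) $ i = (\<Sum>j<n. of_real (A $$ (i, j)) * v $ j)"
      using that A v(1) by (auto simp: scalar_prod_def lessThan_atLeast0 intro!: sum.cong)
    then show ?thesis using v that by simp
  qed
  have symA: "A $$ (i, j) = A $$ (j, i)" if "i < n" "j < n" for i j
    using that A sym by (metis carrier_matD index_transpose_mat(1))
  define S where "S = (\<Sum>i<n. cnj (v $ i) * v $ i)"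
  have q: "a * S = (\<Sum>i<n. \<Sum>j<n. cnj (v $ i) * of_real (A $$ (i, j)) * v $ j)"
    unfolding S_def sum_distrib_left
  proof (intro sum.cong refl)
    fix i assume "i \<in> {..<n}"
    then have "a * (cnj (v $ i) * v $ i) = cnj (v $ i) * (\<Sum>j<n. of_real (A $$ (i, j)) * v $ j)"
      using row[of i] by simp
    then show "a * (cnj (v $ i) * v $ i) = (\<Sum>j<n. cnj (v $ i) * of_real (A $$ (i, j)) * v $ j)"
      by (simp add: sum_distrib_left mult.assoc)
  qed
  have "cnj (a * S) = (\<Sum>i<n. \<Sum>j<n. v $ i * of_real (A $$ (i, j)) * cnj (v $ j))"
    unfolding q by simp
  also have "\<dots> = (\<Sum>j<n. \<Sum>i<n. v $ i * of_real (A $$ (i, j)) * cnj (v $ j))"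
    by (rule sum.swap)
  also have "\<dots> = a * S" unfolding q using symA by (auto intro!: sum.cong simp: mult_ac)
  finally have 1: "cnj a * cnj S = a * S" by simp
  have Sr: "S = of_real (\<Sum>i<n. (norm (v $ i))\<^sup>2)"
    unfolding S_def of_real_sum complex_norm_square by (simp add: mult.commute)
  obtain i where "i < n" "v $ i \<noteq> 0" using v(1,2) by (metis eq_vecI index_zero_vec carrier_vecD)
  then have "(\<Sum>i<n. (norm (v $ i))\<^sup>2) > 0"
    by (intro sum_pos2[of _ i]) auto
  then have "S \<noteq> 0" unfolding Sr by (simp only: of_real_eq_0_iff)
  moreover have "cnj S = S" unfolding Sr by simp
  ultimately have "cnj a = a" using 1 by simp
  then show ?thesis by (simp add: Reals_cnj_iff)
qed

text \<open>
  This makes the list of real roots with multiplicity, by which the spectrum is defined, complete;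
  without it the last entry of the list need not be at position \<open>n - 1\<close>.
\<close>

lemma symmetric_char_poly_splits:
  assumes A: "A \<in> carrier_mat n n" and sym: "transpose_mat A = (A :: real mat)"
  shows "\<exists>es. char_poly A = (\<Prod>e\<leftarrow>es. [:- e, 1:])"
proof -
  let ?C = "map_mat complex_of_real A"
  have C: "?C \<in> carrier_mat n n" using A by simp
  obtain as where as: "char_poly ?C = (\<Prod>a\<leftarrow>as. [:- a, 1:])" using char_poly_factorized[OF C] by auto
  have "a \<in> \<real>" if "a \<in> set as" for a
  proof (rule symmetric_eigenvalue_real[OF A sym])
    have "poly (char_poly ?C) a = 0" unfolding as using that by (auto simp: poly_prod_list prod_list_zero_iff)
    then show "eigenvalue ?C a" using eigenvalue_root_char_poly[OF C] by simp
  qed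
  then have as': "as = map complex_of_real (map Re as)"
    by (simp add: map_idI)
  interpret h: map_poly_inj_idom_hom complex_of_real ..
  have "map_poly complex_of_real (char_poly A) = char_poly ?C"
    by (rule of_real_hom.char_poly_hom[OF A, symmetric])
  also have "\<dots> = (\<Prod>a\<leftarrow>map Re as. [:- complex_of_real a, 1:])"
    unfolding as by (subst as') (simp only: map_map o_def)
  also have "\<dots> = map_poly complex_of_real (\<Prod>a\<leftarrow>map Re as. [:- a, 1:])"
    by (simp add: h.hom_prod_list o_def)
  finally have "char_poly A = (\<Prod>a\<leftarrow>map Re as. [:- a, 1:])" by (rule h.injectivity)
  then show ?thesis by blast
qed


section \<open>The spectrum of a regular graph\<close>

lemma regular_graph_facts:
  assumes "regular_graph_on n k G"
  shows "parcs G \<subseteq> {..<n} \<times> {..<n}" and "(u, v) \<in> parcs G \<longleftrightarrow> (v, u) \<in> parcs G"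
    and "(v, v) \<notin> parcs G" and "v < n \<Longrightarrow> card {w. (v, w) \<in> parcs G} = k"
proof -
  interpret pair_graph G using assms by (simp add: regular_graph_on_def)
  have V: "pverts G = {..<n}" using assms by (simp add: regular_graph_on_def)
  show "parcs G \<subseteq> {..<n} \<times> {..<n}" using in_arcsD1 in_arcsD2 V by auto
  show "(u, v) \<in> parcs G \<longleftrightarrow> (v, u) \<in> parcs G" using arcs_symmetric by blast
  show "(v, v) \<notin> parcs G" using no_loops' by blast
  assume "v < n"
  then have "out_degree (with_proj G) v = k" using assms by (auto simp: regular_graph_on_def)
  moreover have "out_arcs (with_proj G) v = Pair v ` {w. (v, w) \<in> parcs G}"
    by (auto simp: out_arcs_def)
  ultimately show "card {w. (v, w) \<in> parcs G} = k"
    by (simp add: out_degree_def card_image inj_on_def)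
qed

lemma adjacency_matrix_carrier [simp]: "adjacency_matrix n G \<in> carrier_mat n n"
  by (simp add: adjacency_matrix_def)

lemma adjacency_matrix_symmetric:
  assumes "regular_graph_on n k G"
  shows "transpose_mat (adjacency_matrix n G) = adjacency_matrix n G"
  using regular_graph_facts(2)[OF assms] by (intro eq_matI) (auto simp: adjacency_matrix_def)

lemma adjacency_row:
  fixes f :: "nat \<Rightarrow> real"
  assumes "regular_graph_on n k G" "v < n"
  shows "(\<Sum>w<n. adjacency_matrix n G $$ (v, w) * f w) = (\<Sum>w | (v, w) \<in> parcs G. f w)"
proof -
  have "(\<Sum>w<n. adjacency_matrix n G $$ (v, w) * f w) = (\<Sum>w<n. if (v, w) \<in> parcs G then f w else 0)"
    using assms by (intro sum.cong) (auto simp: adjacency_matrix_def)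
  also have "\<dots> = (\<Sum>w\<in>{w\<in>{..<n}. (v, w) \<in> parcs G}. f w)" by (rule sum.inter_filter[symmetric]) simp
  also have "{w\<in>{..<n}. (v, w) \<in> parcs G} = {w. (v, w) \<in> parcs G}"
    using regular_graph_facts(1)[OF assms(1)] by auto
  finally show ?thesis .
qed

text \<open>
  Compare the eigenvector equation at a coordinate where the eigenvector is largest in modulus.
\<close>

lemma adjacency_eigenvalue_bound:
  assumes reg: "regular_graph_on n k G" and ev: "eigenvalue (adjacency_matrix n G) e"
  shows "\<bar>e\<bar> \<le> real k"
proof -
  let ?A = "adjacency_matrix n G"
  obtain v where v: "v \<in> carrier_vec n" "v \<noteq> 0\<^sub>v n" "?A *\<^sub>v v = e \<cdot>\<^sub>v v"
    using ev unfolding eigenvalue_def eigenvector_def by (auto simp: adjacency_matrix_def)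
  have row: "(\<Sum>w | (i, w) \<in> parcs G. v $ w) = e * v $ i" if "i < n" for i
  proof -
    have "(?A *\<^sub>v v) $ i = (\<Sum>j<n. ?A $$ (i, j) * v $ j)"
      using that v(1) carrier_matD[OF adjacency_matrix_carrier[of n G]]
      by (auto simp: scalar_prod_def lessThan_atLeast0 intro!: sum.cong)
    then show ?thesis using v that adjacency_row[OF reg that] by simp
  qed
  obtain i where i: "i < n" "v $ i \<noteq> 0" using v(1,2) by (metis eq_vecI index_zero_vec carrier_vecD)
  obtain m where m: "m < n" "\<And>j. j < n \<Longrightarrow> \<bar>v $ j\<bar> \<le> \<bar>v $ m\<bar>"
  proof -
    have "finite ((\<lambda>j. \<bar>v $ j\<bar>) ` {..<n})" "(\<lambda>j. \<bar>v $ j\<bar>) ` {..<n} \<noteq> {}" using i by auto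
    from Max_in[OF this] Max_ge[OF this(1)] that show thesis by fastforce
  qed
  have pos: "\<bar>v $ m\<bar> > 0" using m(2)[OF i(1)] i(2) by linarith
  have "\<bar>e\<bar> * \<bar>v $ m\<bar> = \<bar>\<Sum>w | (m, w) \<in> parcs G. v $ w\<bar>" using row[OF m(1)] by (simp add: abs_mult)
  also have "\<dots> \<le> (\<Sum>w | (m, w) \<in> parcs G. \<bar>v $ w\<bar>)" by (rule sum_abs)
  also have "\<dots> \<le> (\<Sum>w | (m, w) \<in> parcs G. \<bar>v $ m\<bar>)"
    using regular_graph_facts(1)[OF reg] by (intro sum_mono m(2)) auto
  also have "\<dots> = real k * \<bar>v $ m\<bar>" using regular_graph_facts(4)[OF reg m(1)] by simp
  finally show ?thesis using pos by simp
qed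

lemma adjacency_spectrum:
  assumes reg: "regular_graph_on n k G" and n: "0 < n"
  shows "char_poly (adjacency_matrix n G) = (\<Prod>e\<leftarrow>adjacency_spectrum n G. [:- e, 1:])"
    and "length (adjacency_spectrum n G) = n"
    and "adjacency_spectrum n G ! 0 = real k"
    and "1 \<le> i \<Longrightarrow> i < n \<Longrightarrow> \<bar>adjacency_spectrum n G ! i\<bar> \<le> second_eigenvalue n G"
proof -
  let ?A = "adjacency_matrix n G" and ?s = "adjacency_spectrum n G"
  have A: "?A \<in> carrier_mat n n" by simp
  obtain es where es: "char_poly ?A = (\<Prod>e\<leftarrow>es. [:- e, 1:])"
    using symmetric_char_poly_splits[OF A adjacency_matrix_symmetric[OF reg]] by blast
  have nz: "(\<Prod>e\<leftarrow>xs. [:- e, 1:]) \<noteq> (0 :: real poly)" for xs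
    by (auto simp: prod_list_zero_iff)
  have "proots (char_poly ?A) = mset es"
    unfolding es by (induction es) (auto simp: proots_mult[OF _ nz] simp del: mult_pCons_left)
  then have ms: "mset ?s = mset es" by (simp add: adjacency_spectrum_def)
  have "(\<Prod>e\<leftarrow>es. [:- e, 1:]) = (\<Prod>e\<leftarrow>?s. [:- e, 1:])"
    unfolding prod_mset_prod_list[symmetric] mset_map ms ..
  then show cp: "char_poly ?A = (\<Prod>e\<leftarrow>?s. [:- e, 1:])" using es by simp
  have "degree (char_poly ?A) = length ?s" unfolding cp by (simp add: degree_linear_factors)
  then show len: "length ?s = n" using degree_monic_char_poly[OF A] by simp
  have sorted: "sorted (rev ?s)" by (simp add: adjacency_spectrum_def)
  have anti: "?s ! j \<le> ?s ! i" if "i \<le> j" "j < n" for i j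
    using sorted_rev_nth_mono[OF sorted that(1)] that len by simp
  have ev: "e \<in> set ?s \<longleftrightarrow> eigenvalue ?A e" for e
    unfolding eigenvalue_root_char_poly[OF A] cp by (auto simp: poly_prod_list prod_list_zero_iff)
  have "eigenvalue ?A (real k)"
  proof -
    let ?v = "vec n (\<lambda>_. 1 :: real)"
    have "?A *\<^sub>v ?v = real k \<cdot>\<^sub>v ?v"
    proof (intro eq_vecI)
      fix i assume "i < dim_vec (real k \<cdot>\<^sub>v ?v)"
      then have i: "i < n" by simp
      have "(?A *\<^sub>v ?v) $ i = (\<Sum>j<n. ?A $$ (i, j) * 1)"
        using i carrier_matD[OF A] by (auto simp: scalar_prod_def lessThan_atLeast0 intro!: sum.cong)
      also have "\<dots> = real k"
          using adjacency_row[OF reg i, of "\<lambda>_. 1"] regular_graph_facts(4)[OF reg i] by simp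
      finally show "(?A *\<^sub>v ?v) $ i = (real k \<cdot>\<^sub>v ?v) $ i" using i by simp
    qed (use carrier_matD[OF A] in simp)
    moreover have "?v \<noteq> 0\<^sub>v n"
    proof
      assume "?v = 0\<^sub>v n"
      then have "?v $ 0 = 0\<^sub>v n $ 0" by simp
      then show False using n by simp
    qed
    ultimately show ?thesis unfolding eigenvalue_def eigenvector_def
      using carrier_matD[OF A] by (intro exI[of _ ?v]) simp
  qed
  then obtain j where "j < n" "?s ! j = real k" using ev len by (metis in_set_conv_nth)
  then have "real k \<le> ?s ! 0" using anti[of 0 j] by simp
  moreover have "?s ! 0 \<in> set ?s" using len n by simp
  then have "?s ! 0 \<le> real k" using adjacency_eigenvalue_bound[OF reg] ev by fastforce
  ultimately show "?s ! 0 = real k" by simp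
  assume "1 \<le> i" "i < n"
  then have "?s ! i \<le> ?s ! 1" "?s ! (n - 1) \<le> ?s ! i" by (auto intro!: anti)
  then show "\<bar>?s ! i\<bar> \<le> second_eigenvalue n G" unfolding second_eigenvalue_def by linarith
qed

lemma chebyshev_mat_row_sum:
  assumes "A \<in> carrier_mat n n" "\<And>i. i < n \<Longrightarrow> (\<Sum>j<n. A $$ (i, j)) = x" "i < n"
  shows "(\<Sum>j<n. chebyshev_mat c A r $$ (i, j)) = chebyshev c x r"
  using assms(3)
proof (induction r arbitrary: i rule: induct_nat_012)
  case 0
  then have "(\<Sum>j<n. chebyshev_mat c A 0 $$ (i, j)) = (\<Sum>j<n. if j = i then 1 else 0)"
    using assms(1) by (intro sum.cong) auto
  then show ?case using 0 by simp
next
  case 1 then show ?case using assms by simp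
next
  case (ge2 r)
  let ?X = "chebyshev_mat c A (Suc r)" and ?Y = "chebyshev_mat c A r"
  have X: "?X \<in> carrier_mat n n" "?Y \<in> carrier_mat n n" using assms by simp_all
  have "(\<Sum>j<n. chebyshev_mat c A (Suc (Suc r)) $$ (i, j))
      = (\<Sum>j<n. (\<Sum>l<n. A $$ (i, l) * ?X $$ (l, j)) - c * ?Y $$ (i, j))"
    using ge2(3) by (intro sum.cong)
      (auto simp: mat_mult_entry[OF assms(1) X(1)] chebyshev_mat_entry[OF assms(1)] simp del: index_mult_mat(1) chebyshev_mat.simps)
  also have "\<dots> = (\<Sum>l<n. A $$ (i, l) * (\<Sum>j<n. ?X $$ (l, j))) - c * (\<Sum>j<n. ?Y $$ (i, j))"
    by (subst sum_subtractf, subst sum.swap) (simp add: sum_distrib_left)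
  also have "\<dots> = (\<Sum>l<n. A $$ (i, l)) * chebyshev c x (Suc r) - c * chebyshev c x r"
    using ge2 by (simp add: sum_distrib_right)
  also have "\<dots> = chebyshev c x (Suc (Suc r))" using assms(2) ge2(3) by simp
  finally show ?case .
qed

text \<open>
  The row sums of the polynomial in the adjacency matrix are its value at \<open>k\<close>, so subtracting the mean
  entry removes exactly the contribution of the eigenvalue \<open>k\<close> from the squared Frobenius norm. What
  remains is a sum over the other eigenvalues, counted with multiplicity as in the spectrum.
\<close>

lemma chebyshev_mat_adjacency_bound:
  assumes reg: "regular_graph_on n k G" and R: "0 < R" "c \<le> R\<^sup>2" "second_eigenvalue n G \<le> R + c / R"
    and uv: "u < n" "v < n"
  shows "\<bar>chebyshev_mat c (adjacency_matrix n G) r $$ (u, v) - chebyshev c (real k) r / real n\<bar>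
    \<le> sqrt (real n) * ((real r + 1) * R ^ r)"
proof -
  let ?A = "adjacency_matrix n G" and ?s = "adjacency_spectrum n G"
  let ?U = "chebyshev_mat c ?A r" and ?y = "chebyshev c (real k) r" and ?b = "(real r + 1) * R ^ r"
  have n: "0 < n" using uv by simp
  have A: "?A \<in> carrier_mat n n" by simp
  have U: "?U \<in> carrier_mat n n" by simp
  have symU: "?U $$ (i, j) = ?U $$ (j, i)" if "i < n" "j < n" for i j
    using chebyshev_mat_symmetric[OF A adjacency_matrix_symmetric[OF reg], of c r] that carrier_matD[OF U]
    by (metis index_transpose_mat(1))
  have row: "(\<Sum>j<n. ?U $$ (i, j)) = ?y" if "i < n" for i
    using adjacency_row[OF reg, of _ "\<lambda>_. 1"] regular_graph_facts(4)[OF reg] that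
    by (intro chebyshev_mat_row_sum) auto
  have sq: "(\<Sum>i<n. \<Sum>j<n. (?U $$ (i, j))\<^sup>2) = (\<Sum>i<n. (chebyshev c (?s ! i) r)\<^sup>2)"
  proof -
    have "(\<Sum>i<n. \<Sum>j<n. (?U $$ (i, j))\<^sup>2) = mat_trace (?U * ?U)"
      unfolding mat_trace_def using carrier_matD[OF U] symU
      by (auto simp: mat_mult_entry[OF U U] power2_eq_square simp del: index_mult_mat(1) intro!: sum.cong)
    also have "\<dots> = (\<Sum>e\<leftarrow>?s. (chebyshev c e r)\<^sup>2)"
      by (rule mat_trace_chebyshev_square[OF A adjacency_spectrum(1)[OF reg n]])
    also have "\<dots> = (\<Sum>i<n. (chebyshev c (?s ! i) r)\<^sup>2)"
      unfolding sum_list_sum_nth using adjacency_spectrum(2)[OF reg n] by (simp add: lessThan_atLeast0)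
    finally show ?thesis .
  qed
  have "(?U $$ (u, v) - ?y / n)\<^sup>2 \<le> (\<Sum>j<n. (?U $$ (u, j) - ?y / n)\<^sup>2)"
    using uv by (intro member_le_sum) auto
  also have "\<dots> \<le> (\<Sum>i<n. \<Sum>j<n. (?U $$ (i, j) - ?y / n)\<^sup>2)"
    using uv by (intro member_le_sum[of u _ "\<lambda>i. \<Sum>j<n. (?U $$ (i, j) - ?y / n)\<^sup>2"]) (auto intro: sum_nonneg)
  also have "\<dots> = (\<Sum>i<n. \<Sum>j<n. (?U $$ (i, j))\<^sup>2) - ?y\<^sup>2"
  proof -
    have "(\<Sum>j<n. (?U $$ (i, j) - ?y / n)\<^sup>2) = (\<Sum>j<n. (?U $$ (i, j))\<^sup>2) - ?y\<^sup>2 / n" if "i < n" for i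
    proof -
      have "(\<Sum>j<n. (?U $$ (i, j) - ?y / n)\<^sup>2)
          = (\<Sum>j<n. (?U $$ (i, j))\<^sup>2 - 2 * (?y / n) * ?U $$ (i, j) + (?y / n)\<^sup>2)"
        by (simp add: power2_diff algebra_simps)
      also have "\<dots> = (\<Sum>j<n. (?U $$ (i, j))\<^sup>2) - 2 * (?y / n) * ?y + n * (?y / n)\<^sup>2"
        unfolding row[OF that, symmetric] sum_distrib_left by (simp add: sum.distrib sum_subtractf)
      also have "\<dots> = (\<Sum>j<n. (?U $$ (i, j))\<^sup>2) - ?y\<^sup>2 / n"
        using n by (simp add: power2_eq_square field_simps)
      finally show ?thesis .
    qed
    then have "(\<Sum>i<n. \<Sum>j<n. (?U $$ (i, j) - ?y / n)\<^sup>2) = (\<Sum>i<n. (\<Sum>j<n. (?U $$ (i, j))\<^sup>2) - ?y\<^sup>2 / n)"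
      by (intro sum.cong) auto
    then show ?thesis using n by (simp add: sum_subtractf)
  qed
  also have "\<dots> = (\<Sum>i\<in>{..<n} - {0}. (chebyshev c (?s ! i) r)\<^sup>2)"
    unfolding sq using n adjacency_spectrum(3)[OF reg n] by (simp add: sum_diff1)
  also have "\<dots> \<le> (\<Sum>i\<in>{..<n} - {0}. ?b\<^sup>2)"
  proof (intro sum_mono)
    fix i assume "i \<in> {..<n} - {0}"
    then have "\<bar>?s ! i\<bar> \<le> R + c / R" using adjacency_spectrum(4)[OF reg n, of i] R(3) by auto
    from chebyshev_bound[OF R(1,2) this] show "(chebyshev c (?s ! i) r)\<^sup>2 \<le> ?b\<^sup>2"
      using R(1) by (intro abs_le_square_iff[THEN iffD1]) auto
  qed
  also have "\<dots> \<le> real n * ?b\<^sup>2" using n by (simp add: mult_right_mono)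
  also have "\<dots> = (sqrt n * ?b)\<^sup>2" by (simp add: power_mult_distrib)
  finally show ?thesis using R(1) by (simp add: power2_le_iff_abs_le)
qed

section \<open>Non-backtracking walks: mixing and absence of short returns\<close>

lemma nbrw_step_support:
  assumes "regular_graph_on n k G" "2 \<le> k" "e \<in> parcs G"
  shows "finite ({w. (snd e, w) \<in> parcs G} - {fst e})" "card ({w. (snd e, w) \<in> parcs G} - {fst e}) = k - 1"
    "{w. (snd e, w) \<in> parcs G} - {fst e} \<noteq> {}" "set_pmf (nbrw_step G e) \<subseteq> parcs G"
proof -
  obtain u v where e: "e = (u, v)" by (cases e)
  have v: "v < n" using regular_graph_facts(1)[OF assms(1)] assms(3) e by auto
  have c: "card {w. (v, w) \<in> parcs G} = k" using regular_graph_facts(4)[OF assms(1) v] .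
  have f: "finite {w. (v, w) \<in> parcs G}" by (rule card_ge_0_finite) (use c assms(2) in simp)
  have u: "u \<in> {w. (v, w) \<in> parcs G}" using regular_graph_facts(2)[OF assms(1)] assms(3) e by auto
  show f': "finite ({w. (snd e, w) \<in> parcs G} - {fst e})" using f e by simp
  show c': "card ({w. (snd e, w) \<in> parcs G} - {fst e}) = k - 1" using c f u e by simp
  show ne: "{w. (snd e, w) \<in> parcs G} - {fst e} \<noteq> {}" using c' assms(2) by (intro notI) simp
  show "set_pmf (nbrw_step G e) \<subseteq> parcs G" using f' ne e by (auto simp: nbrw_step_def)
qed

text \<open>
  The probability that a walker now on the directed edge \<open>e\<close> is at the vertex \<open>x\<close> after \<open>r\<close> steps,
  by recursion on the first step.
\<close>

fun head_prob :: "nat pair_pre_digraph \<Rightarrow> nat \<Rightarrow> nat \<times> nat \<Rightarrow> nat \<Rightarrow> real" where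
  "head_prob G 0 e x = of_bool (snd e = x)"
| "head_prob G (Suc r) e x = (\<integral>e'. head_prob G r e' x \<partial>measure_pmf (nbrw_step G e))"

lemma expectation_nbrw_step:
  fixes f :: "nat \<times> nat \<Rightarrow> real"
  assumes "regular_graph_on n k G" "2 \<le> k" "e \<in> parcs G"
  shows "(\<integral>e'. f e' \<partial>measure_pmf (nbrw_step G e))
    = (\<Sum>w\<in>{w. (snd e, w) \<in> parcs G} - {fst e}. f (snd e, w)) / (real k - 1)"
  using nbrw_step_support[OF assms] assms(2)
  by (simp add: nbrw_step_def split_beta integral_pmf_of_set of_nat_diff)

lemma nbrw_step_bounds:
  fixes f :: "nat \<times> nat \<Rightarrow> real"
  assumes "regular_graph_on n k G" "2 \<le> k" "e \<in> parcs G"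
    and "\<And>e'. e' \<in> parcs G \<Longrightarrow> a \<le> f e' \<and> f e' \<le> b"
  shows "a \<le> (\<integral>e'. f e' \<partial>measure_pmf (nbrw_step G e))" "(\<integral>e'. f e' \<partial>measure_pmf (nbrw_step G e)) \<le> b"
proof -
  have fin: "finite (set_pmf (nbrw_step G e))"
    using nbrw_step_support[OF assms(1-3)] by (auto simp: nbrw_step_def split_beta)
  have i: "integrable (measure_pmf (nbrw_step G e)) f" by (rule integrable_measure_pmf_finite[OF fin])
  have "AE e' in measure_pmf (nbrw_step G e). a \<le> f e' \<and> f e' \<le> b"
    using nbrw_step_support(4)[OF assms(1-3)] assms(4) by (auto simp: AE_measure_pmf_iff)
  then show "a \<le> (\<integral>e'. f e' \<partial>measure_pmf (nbrw_step G e))" "(\<integral>e'. f e' \<partial>measure_pmf (nbrw_step G e)) \<le> b"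
    using i by (auto intro!: measure_pmf.integral_ge_const measure_pmf.integral_le_const)
qed

lemma head_prob_bounds:
  assumes "regular_graph_on n k G" "2 \<le> k"
  shows "e \<in> parcs G \<Longrightarrow> 0 \<le> head_prob G r e x \<and> head_prob G r e x \<le> 1"
proof (induction r arbitrary: e)
  case (Suc r)
  then show ?case using nbrw_step_bounds[OF assms Suc(2), of 0 "\<lambda>e'. head_prob G r e' x" 1] by simp
qed simp

lemma head_prob_Suc:
  assumes "regular_graph_on n k G" "2 \<le> k" "(u, v) \<in> parcs G"
  shows "head_prob G (Suc r) (u, v) x
      = (\<Sum>w\<in>{w. (v, w) \<in> parcs G} - {u}. head_prob G r (v, w) x) / (real k - 1)"
  using expectation_nbrw_step[OF assms] by simp

lemma head_prob_Suc_scaled: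
  assumes "regular_graph_on n k G" "2 \<le> k" "(u, v) \<in> parcs G"
  shows "(real k - 1) ^ Suc r * head_prob G (Suc r) (u, v) x
    = (\<Sum>w\<in>{w. (v, w) \<in> parcs G} - {u}. (real k - 1) ^ r * head_prob G r (v, w) x)"
  using assms(2) unfolding head_prob_Suc[OF assms] sum_distrib_left[symmetric] by simp

lemma head_prob_sum:
  assumes "regular_graph_on n k G" "2 \<le> k"
  shows "e \<in> parcs G \<Longrightarrow> (\<Sum>x<n. head_prob G r e x) = 1"
proof (induction r arbitrary: e)
  case 0
  then have "snd e < n" using regular_graph_facts(1)[OF assms(1)] by auto
  then show ?case by simp
next
  case (Suc r)
  obtain u v where e: "e = (u, v)" by (cases e)
  have uv: "(u, v) \<in> parcs G" using Suc e by simp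
  let ?N = "{w. (v, w) \<in> parcs G} - {u}"
  have "(\<Sum>x<n. head_prob G (Suc r) e x) = (\<Sum>w\<in>?N. \<Sum>x<n. head_prob G r (v, w) x) / (real k - 1)"
    unfolding e head_prob_Suc[OF assms uv] by (subst sum.swap) (simp add: sum_divide_distrib)
  also have "\<dots> = real (card ?N) / (real k - 1)" using Suc(1) by simp
  also have "\<dots> = 1" using nbrw_step_support(2)[OF assms uv] assms(2) by simp
  finally show ?case .
qed

text \<open>
  Let \<open>U\<^sub>r\<close> be the polynomial \<open>chebyshev (k - 1)\<close> of degree \<open>r\<close>. The non-backtracking walks of length \<open>r\<close>
  from \<open>v\<close> to \<open>x\<close> that do not start towards \<open>u\<close> number \<open>U\<^sub>r(A)(v, x) - U\<^sub>r\<^sub>-\<^sub>1(A)(u, x)\<close>.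
  The induction sums over the neighbours of \<open>v\<close> other than \<open>u\<close> and uses that there are \<open>k - 1\<close> of them.
\<close>

lemma head_prob_chebyshev:
  assumes reg: "regular_graph_on n k G" "2 \<le> k" and x: "x < n"
  defines "U \<equiv> \<lambda>r v. chebyshev_mat (real k - 1) (adjacency_matrix n G) r $$ (v, x)"
  shows "(u, v) \<in> parcs G \<Longrightarrow> head_prob G 0 (u, v) x = U 0 v"
    and "(u, v) \<in> parcs G \<Longrightarrow> (real k - 1) ^ Suc r * head_prob G (Suc r) (u, v) x = U (Suc r) v - U r u"
proof -
  have V: "u < n" "v < n" if "(u, v) \<in> parcs G" for u v
    using regular_graph_facts(1)[OF reg(1)] that by auto
  have U0: "U 0 v = of_bool (v = x)" if "v < n" for v
    using that x by (simp add: U_def adjacency_matrix_def)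
  have U1: "U 1 v = (\<Sum>w | (v, w) \<in> parcs G. U 0 w)" if "v < n" for v
  proof -
    have "U 1 v = (\<Sum>w<n. adjacency_matrix n G $$ (v, w) * U 0 w)"
      using that x U0 by (simp add: U_def if_distrib cong: if_cong)
    then show ?thesis using adjacency_row[OF reg(1) that] by simp
  qed
  have U2: "U (Suc (Suc r)) v = (\<Sum>w | (v, w) \<in> parcs G. U (Suc r) w) - (real k - 1) * U r v"
      if "v < n" for r v
    unfolding U_def chebyshev_mat_entry[OF adjacency_matrix_carrier that x]
      mat_mult_entry[OF adjacency_matrix_carrier chebyshev_mat_carrier[OF adjacency_matrix_carrier] that x]
      adjacency_row[OF reg(1) that] ..
  have split: "(\<Sum>w | (v, w) \<in> parcs G. f w) = f u + (\<Sum>w\<in>{w. (v, w) \<in> parcs G} - {u}. f w)"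
    if "(u, v) \<in> parcs G" for u v and f :: "nat \<Rightarrow> real"
  proof (rule sum.remove)
    show "finite {w. (v, w) \<in> parcs G}" using nbrw_step_support(1)[OF reg that] by simp
    show "u \<in> {w. (v, w) \<in> parcs G}" using regular_graph_facts(2)[OF reg(1)] that by auto
  qed
  have k: "real k - 1 \<noteq> 0" using reg(2) by simp
  show b: "head_prob G 0 (u, v) x = U 0 v" if "(u, v) \<in> parcs G" for u v using V[OF that] U0 by simp
  show "(real k - 1) ^ Suc r * head_prob G (Suc r) (u, v) x = U (Suc r) v - U r u" if "(u, v) \<in> parcs G"
    using that
  proof (induction r arbitrary: u v)
    case 0
    have "(real k - 1) ^ Suc 0 * head_prob G (Suc 0) (u, v) x = (\<Sum>w\<in>{w. (v, w) \<in> parcs G} - {u}. U 0 w)"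
      unfolding head_prob_Suc[OF reg 0] using k b by (auto intro!: sum.cong simp del: head_prob.simps)
    then show ?case using U1[OF V(2)[OF 0]] split[OF 0, of "U 0"] by simp
  next
    case (Suc r)
    let ?N = "{w. (v, w) \<in> parcs G} - {u}"
    have "(real k - 1) ^ Suc (Suc r) * head_prob G (Suc (Suc r)) (u, v) x
        = (\<Sum>w\<in>?N. (real k - 1) ^ Suc r * head_prob G (Suc r) (v, w) x)"
      by (rule head_prob_Suc_scaled[OF reg Suc(2)])
    also have "\<dots> = (\<Sum>w\<in>?N. U (Suc r) w - U r v)" using Suc(1) by (intro sum.cong) auto
    also have "\<dots> = (\<Sum>w\<in>?N. U (Suc r) w) - (real k - 1) * U r v"
      using nbrw_step_support(2)[OF reg Suc(2)] reg(2) by (simp add: sum_subtractf of_nat_diff)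
    also have "\<dots> = U (Suc (Suc r)) v - U (Suc r) u"
      using U2[OF V(2)[OF Suc(2)], of r] split[OF Suc(2), of "U (Suc r)"] by simp
    finally show ?case .
  qed
qed

text \<open>
  At the trivial eigenvalue the closed form above has to give the total number \<open>(k - 1)\<^sup>r\<close> of
  non-backtracking continuations.
\<close>

lemma chebyshev_at_degree: "chebyshev (k - 1) k (Suc r) - chebyshev (k - 1) k r = (k - 1) ^ Suc r"
proof (induction r)
  case (Suc r)
  have "chebyshev (k - 1) k (Suc (Suc r)) - chebyshev (k - 1) k (Suc r)
      = (k - 1) * (chebyshev (k - 1) k (Suc r) - chebyshev (k - 1) k r)" by (simp add: algebra_simps)
  then show ?case using Suc by simp
qed simp

text \<open>
  Both matrix polynomials in the closed form are close to their mean entries, and the mean entries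
  differ by exactly \<open>(k - 1)\<^sup>r / n\<close>. Since \<open>R\<close> can be taken smaller than \<open>k - 1\<close>, the bound decays
  geometrically, and a logarithmic number of steps beats every power of \<open>n\<close>.
\<close>

lemma nbrw_mixing:
  assumes reg: "regular_graph_on n k G" and k: "2 \<le> k"
    and R: "1 \<le> R" "real k - 1 \<le> R\<^sup>2" "second_eigenvalue n G \<le> R + (real k - 1) / R"
    and e: "e \<in> parcs G" and x: "x < n"
  shows "\<bar>head_prob G (Suc r) e x - 1 / real n\<bar>
      \<le> 2 * sqrt (real n) * (real r + 2) * (R / (real k - 1)) ^ Suc r"
proof -
  obtain u v where e': "e = (u, v)" by (cases e)
  have uv: "(u, v) \<in> parcs G" "u < n" "v < n" using e regular_graph_facts(1)[OF reg] e' by auto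
  define c where "c = real k - 1"
  have c: "c > 0" using k by (simp add: c_def)
  let ?U = "\<lambda>r v. chebyshev_mat c (adjacency_matrix n G) r $$ (v, x)"
  have b: "\<bar>?U s w - chebyshev c (real k) s / n\<bar> \<le> sqrt n * ((real s + 1) * R ^ s)" if "w < n" for s w
    using chebyshev_mat_adjacency_bound[OF reg _ _ _ that x, of R c s] R by (simp add: c_def)
  have "c ^ Suc r * (head_prob G (Suc r) e x - 1 / n) = ?U (Suc r) v - ?U r u - c ^ Suc r / n"
    using head_prob_chebyshev(2)[OF reg k x uv(1), of r] unfolding right_diff_distrib c_def e' by simp
  also have "\<dots> = (?U (Suc r) v - chebyshev c (real k) (Suc r) / n) - (?U r u - chebyshev c (real k) r / n)"
    unfolding c_def chebyshev_at_degree[symmetric] by (simp add: diff_divide_distrib)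
  finally have "c ^ Suc r * \<bar>head_prob G (Suc r) e x - 1 / n\<bar>
      = \<bar>(?U (Suc r) v - chebyshev c (real k) (Suc r) / n) - (?U r u - chebyshev c (real k) r / n)\<bar>"
    using c by (metis abs_mult abs_of_pos zero_less_power)
  also have "\<dots> \<le> sqrt n * ((real (Suc r) + 1) * R ^ Suc r) + sqrt n * ((real r + 1) * R ^ r)"
    using b[OF uv(3), of "Suc r"] b[OF uv(2), of r] by linarith
  also have "\<dots> \<le> sqrt n * ((real r + 2) * R ^ Suc r) + sqrt n * ((real r + 2) * R ^ Suc r)"
  proof -
    have "R ^ r \<le> R ^ Suc r" using R(1) by (intro power_increasing) auto
    then have "(real r + 1) * R ^ r \<le> (real r + 2) * R ^ Suc r" using R(1) by (intro mult_mono) auto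
    then show ?thesis by (intro add_mono mult_left_mono) (auto simp: add.commute)
  qed
  finally have "\<bar>head_prob G (Suc r) e x - 1 / n\<bar> \<le> 2 * sqrt n * (real r + 2) * R ^ Suc r / c ^ Suc r"
    using c by (simp add: field_simps)
  then show ?thesis by (simp add: c_def power_divide)
qed

fun nb_walk :: "nat pair_pre_digraph \<Rightarrow> nat list \<Rightarrow> bool" where
  "nb_walk G (x # y # z # xs) \<longleftrightarrow> (x, y) \<in> parcs G \<and> x \<noteq> z \<and> nb_walk G (y # z # xs)"
| "nb_walk G [x, y] \<longleftrightarrow> (x, y) \<in> parcs G"
| "nb_walk G _ \<longleftrightarrow> True"

lemma nb_walk_Cons: "nb_walk G (x # xs) \<Longrightarrow> nb_walk G xs"
  by (cases "(G, x # xs)" rule: nb_walk.cases) auto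

lemma nb_walk_nth:
  "nb_walk G xs \<Longrightarrow> Suc i < length xs \<Longrightarrow> (xs ! i, xs ! Suc i) \<in> parcs G"
  "nb_walk G xs \<Longrightarrow> Suc (Suc i) < length xs \<Longrightarrow> xs ! i \<noteq> xs ! Suc (Suc i)"
proof (induction G xs arbitrary: i rule: nb_walk.induct)
  case (1 G x y z xs)
  { case 1 then show ?case using "1.IH" by (cases i) auto }
  { case 2 then show ?case using "1.IH" by (cases i) auto }
qed auto

text \<open>
  Walk back along \<open>x, y, ps\<close> to \<open>x\<close> and go on along \<open>x, zs\<close>. The vertex \<open>y\<close> in front of the second walk
  expresses that the turn at \<open>x\<close> is no backtracking.
\<close>

lemma nb_walk_join:
  assumes sym: "\<And>u v. (u, v) \<in> parcs G \<longleftrightarrow> (v, u) \<in> parcs G"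
  shows "nb_walk G (x # y # ps) \<Longrightarrow> nb_walk G (y # x # zs) \<Longrightarrow> nb_walk G (rev (y # ps) @ x # zs)"
proof (induction ps arbitrary: x y zs)
  case (Cons p ps)
  have "nb_walk G (y # p # ps)" "nb_walk G (p # y # x # zs)"
    using Cons(2,3) sym nb_walk_nth(1)[OF nb_walk_Cons[OF Cons(2)], of 0] by auto
  from Cons(1)[OF this] show ?case by simp
qed simp

lemma pawalk_of_vertices:
  "pawalk_verts (xs ! i) (map (\<lambda>t. (xs ! t, xs ! Suc t)) [i..<i + m]) = map ((!) xs) [i..<Suc (i + m)]"
  "pcas (xs ! i) (map (\<lambda>t. (xs ! t, xs ! Suc t)) [i..<i + m]) (xs ! (i + m))"
proof (induction m arbitrary: i)
  case (Suc m)
  have e: "[i..<i + Suc m] = i # [Suc i..<Suc i + m]" "[i..<Suc (i + Suc m)]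
      = i # [Suc i..<Suc (Suc i + m)]" for i
    by (simp_all add: upt_rec[of i] del: upt_Suc)
  { case 1 show ?case unfolding e using Suc(1)[of "Suc i"] by (simp del: upt_Suc) }
  { case 2 show ?case unfolding e using Suc(2)[of "Suc i"] by (simp del: upt_Suc) }
qed auto

text \<open>
  Between the first repetition of a vertex and its previous occurrence the walk is a cycle in which
  no vertex repeats. It has length at least three: there are no loops, and length two would be
  backtracking. The closed walk itself may backtrack at its base point.
\<close>

lemma girth_le_closed_nb_walk:
  assumes reg: "regular_graph_on n k G" and w: "nb_walk G xs" and len: "2 \<le> length xs" and closed: "hd xs
      = last xs"
  shows "girth G \<le> enat (length xs - 1)"
proof -
  interpret pair_graph G using reg by (simp add: regular_graph_on_def)
  define Q where "Q j \<longleftrightarrow> j < length xs \<and> (\<exists>i<j. xs ! i = xs ! j)" for j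
  have "xs \<noteq> []" using len by auto
  then have "Q (length xs - 1)"
    using len closed by (auto simp: Q_def hd_conv_nth last_conv_nth intro!: exI[of _ 0])
  \<comment> \<open>the first time at which the walk is at a vertex seen before\<close>
  define j where "j = (LEAST j. Q j)"
  have "Q j" unfolding j_def by (rule LeastI) fact
  then obtain i where ij: "i < j" "j < length xs" "xs ! i = xs ! j" by (auto simp: Q_def)
  have least: "xs ! a \<noteq> xs ! b" if "a < b" "b < j" for a b
    using not_less_Least[of b Q] that ij unfolding j_def[symmetric] by (auto simp: Q_def)
  define m where "m = j - i"
  have j: "j = i + m" using ij by (simp add: m_def)
  have "m \<noteq> 0" using ij j by simp
  moreover have "m \<noteq> 1"
  proof
    assume "m = 1"
    then show False using nb_walk_nth(1)[OF w, of i] ij j regular_graph_facts(3)[OF reg] by auto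
  qed
  moreover have "m \<noteq> 2"
  proof
    assume "m = 2"
    then show False using nb_walk_nth(2)[OF w, of i] ij j by auto
  qed
  ultimately have m: "3 \<le> m" by linarith
  define p where "p = map (\<lambda>t. (xs ! t, xs ! Suc t)) [i..<i + m]"
  have arcs: "set p \<subseteq> parcs G" using nb_walk_nth(1)[OF w] ij j by (auto simp: p_def)
  have pv: "pawalk_verts (xs ! i) p = map ((!) xs) [i..<Suc (i + m)]" "pcas (xs ! i) p (xs ! i)"
    using pawalk_of_vertices[of xs i m] ij j by (simp_all add: p_def)
  have "distinct (map ((!) xs) [Suc i..<Suc j])"
  proof -
    have "inj_on ((!) xs) {Suc i..<Suc j}"
    proof (rule linorder_inj_onI)
      fix a b assume ab: "a < b" "a \<in> {Suc i..<Suc j}" "b \<in> {Suc i..<Suc j}"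
      show "xs ! a \<noteq> xs ! b"
      proof (cases "b = j")
        case True then show ?thesis using least[of i a] ab ij by auto
      qed (use ab least in auto)
    qed auto
    then show ?thesis by (simp add: distinct_map del: upt_Suc)
  qed
  moreover have "tl (pawalk_verts (xs ! i) p) = map ((!) xs) [Suc i..<Suc j]"
    unfolding pv j by (simp add: upt_rec[of i])
  moreover have "xs ! i \<in> pverts G"
    using nb_walk_nth(1)[OF w, of i] ij in_arcsD1 by (metis Suc_lessI Suc_lessD less_trans_Suc)
  moreover have "p \<noteq> []" using m by (simp add: p_def)
  ultimately have "cycle p" unfolding cycle_def awalk_def using arcs pv(2) by auto
  moreover have "length p = m" by (simp add: p_def)
  ultimately have "girth G \<le> enat m" unfolding girth_def using m by (intro INF_lower2[of p]) auto
  also have "enat m \<le> enat (length xs - 1)" using ij j by simp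
  finally show ?thesis .
qed

lemma head_prob_pos_walk:
  assumes "regular_graph_on n k G" "2 \<le> k"
  shows "(u, v) \<in> parcs G \<Longrightarrow> head_prob G r (u, v) x \<noteq> 0 \<Longrightarrow>
    \<exists>ps. length ps = r \<and> nb_walk G (u # v # ps) \<and> last (v # ps) = x"
proof (induction r arbitrary: u v)
  case 0
  then show ?case by (auto intro!: exI[of _ "[]"] split: if_splits)
next
  case (Suc r)
  then obtain w where w: "(v, w) \<in> parcs G" "w \<noteq> u" "head_prob G r (v, w) x \<noteq> 0"
    unfolding head_prob_Suc[OF assms Suc(2)] by (auto elim!: sum.not_neutral_contains_not_neutral)
  from Suc(1)[OF w(1,3)] obtain ps where "length ps = r" "nb_walk G (v # w # ps)" "last (w # ps) = x" by blast
  then show ?case using w Suc(2) by (intro exI[of _ "w # ps"]) auto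
qed

text \<open>
  Below half the girth two different walks of the same length with the same ends would join to a
  closed non-backtracking walk that is too short. So at most one of the \<open>(k - 1)\<^sup>r\<close> continuations ends
  in a given vertex.
\<close>

lemma head_prob_locally_tree:
  assumes reg: "regular_graph_on n k G" "2 \<le> k" and e: "e \<in> parcs G" and g: "enat (2 * r) < girth G"
  shows "(real k - 1) ^ r * head_prob G r e x \<le> 1"
  using e g
proof (induction r arbitrary: e)
  case 0 then show ?case by simp
next
  case (Suc r)
  obtain u v where e: "e = (u, v)" by (cases e)
  have uv: "(u, v) \<in> parcs G" using Suc e by simp
  let ?N = "{w. (v, w) \<in> parcs G} - {u}"
  define f where "f w = (real k - 1) ^ r * head_prob G r (v, w) x" for w
  have eq: "(real k - 1) ^ Suc r * head_prob G (Suc r) e x = (\<Sum>w\<in>?N. f w)"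
    unfolding e f_def by (rule head_prob_Suc_scaled[OF reg uv])
  have "enat (2 * r) < girth G" using Suc(3) by (rule le_less_trans[rotated]) simp
  then have f1: "f w \<le> 1" if "w \<in> ?N" for w unfolding f_def using Suc(1)[of "(v, w)"] that by simp
  have unique: "w = w'" if "w \<in> ?N" "w' \<in> ?N" "f w \<noteq> 0" "f w' \<noteq> 0" for w w'
  proof (rule ccontr)
    assume neq: "w \<noteq> w'"
    have a: "(v, w) \<in> parcs G" "(v, w') \<in> parcs G" "head_prob G r (v, w) x \<noteq> 0" "head_prob G r (v, w') x \<noteq> 0"
      using that by (auto simp: f_def)
    obtain ps where ps: "length ps = r" "nb_walk G (v # w # ps)" "last (w # ps) = x"
      using head_prob_pos_walk[OF reg a(1,3)] by blast
    obtain qs where qs: "length qs = r" "nb_walk G (v # w' # qs)" "last (w' # qs) = x"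
      using head_prob_pos_walk[OF reg a(2,4)] by blast
    let ?xs = "rev (w # ps) @ v # w' # qs"
    have "nb_walk G (w # v # w' # qs)" using qs neq a regular_graph_facts(2)[OF reg(1)] by auto
    then have "nb_walk G ?xs" by (rule nb_walk_join[OF regular_graph_facts(2)[OF reg(1)] ps(2)])
    moreover have "hd ?xs = last ?xs"
      using ps(3) qs(3) by (auto simp: hd_append hd_rev split: if_splits)
    ultimately have "girth G \<le> enat (length ?xs - 1)"
      by (intro girth_le_closed_nb_walk[OF reg(1)]) auto
    then have "girth G \<le> enat (2 * Suc r)" using ps qs by (simp add: mult_2)
    then show False using Suc(3) by simp
  qed
  show ?case
  proof (cases "\<exists>w\<in>?N. f w \<noteq> 0")
    case False
    then show ?thesis unfolding eq by (simp add: sum.neutral)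
  next
    case True
    then obtain w where w: "w \<in> ?N" "f w \<noteq> 0" by blast
    have "(\<Sum>w\<in>?N. f w) = (\<Sum>w\<in>{w}. f w)"
    proof (rule sum.mono_neutral_right)
      show "finite ?N" using nbrw_step_support(1)[OF reg uv] by simp
      show "\<forall>w'\<in>?N - {w}. f w' = 0" using unique[OF w(1) _ w(2)] by blast
    qed (use w in blast)
    then show ?thesis unfolding eq using f1[OF w(1)] by simp
  qed
qed

lemma head_prob_no_short_return:
  assumes reg: "regular_graph_on n k G" "2 \<le> k" and e: "e \<in> parcs G" and g: "enat r < girth G" "1 \<le> r"
  shows "head_prob G r e (snd e) = 0"
proof (rule ccontr)
  assume a: "head_prob G r e (snd e) \<noteq> 0"
  obtain u v where e': "e = (u, v)" by (cases e)
  obtain ps where ps: "length ps = r" "nb_walk G (u # v # ps)" "last (v # ps) = v"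
    using head_prob_pos_walk[OF reg, of u v r v] a e e' by auto
  have "girth G \<le> enat (length (v # ps) - 1)"
    using ps g nb_walk_Cons[OF ps(2)] by (intro girth_le_closed_nb_walk[OF reg(1)]) auto
  then show False using g ps by simp
qed

text \<open>
  Only the last \<open>l\<close> steps are used; averaging over the earlier ones preserves the bound.
\<close>

lemma head_prob_small:
  assumes reg: "regular_graph_on n k G" "2 \<le> k" and g: "enat (2 * l) < girth G" "l \<le> r"
  shows "e \<in> parcs G \<Longrightarrow> head_prob G r e x \<le> (1 / (real k - 1)) ^ l"
  using g(2)
proof (induction r arbitrary: e rule: dec_induct)
  case base
  then show ?case using head_prob_locally_tree[OF reg base g(1)] reg(2) by (simp add: field_simps)
next
  case (step r)
  then show ?case
    using nbrw_step_bounds(2)[OF reg step(4), of 0 "\<lambda>e'. head_prob G r e' x"] head_prob_bounds[OF reg] by simp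
qed

text \<open>
  Up to time \<open>2 l\<close> there is no return at all, and from time \<open>l\<close> on every vertex is
  unlikely. Mixing alone would not give this: its error terms are small only after the mixing time.
\<close>

lemma head_prob_return_sum:
  assumes reg: "regular_graph_on n k G" "2 \<le> k" and g: "enat (2 * l) < girth G" and e: "e \<in> parcs G"
  shows "(\<Sum>r=1..m. head_prob G r e (snd e)) \<le> real m * (1 / (real k - 1)) ^ l"
proof -
  have "(\<Sum>r=1..m. head_prob G r e (snd e)) \<le> (\<Sum>r=1..m. (1 / (real k - 1)) ^ l)"
  proof (intro sum_mono)
    fix r assume r: "r \<in> {1..m}"
    show "head_prob G r e (snd e) \<le> (1 / (real k - 1)) ^ l"
    proof (cases "l \<le> r")
      case True then show ?thesis by (rule head_prob_small[OF reg g _ e])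
    next
      case False
      then have "enat r \<le> enat (2 * l)" by simp
      then have "enat r < girth G" using g by (rule le_less_trans)
      then show ?thesis using head_prob_no_short_return[OF reg e, of r] r reg(2) by simp
    qed
  qed
  then show ?thesis by simp
qed

section \<open>From the continuous-time process to its jump chain\<close>

text \<open>
  The probability of being at \<open>s\<close> at time \<open>t\<close> is supermultiplicative in \<open>t\<close>, so a bound for small times,
  where the rate is the derivative, extends to all times by Bernoulli's inequality.
\<close>

lemma transition_exit_bound:
  assumes tf: "transition_function S g P" and s: "s \<in> S" and c: "- g s s \<le> c" and t: "0 \<le> t"
  shows "1 - pmf (P t s) s \<le> c * t"
proof (cases "t = 0")
  case True then show ?thesis using tf s by (simp add: transition_function_def)
next
  case False
  then have t: "t > 0" using t by simp
  define a where "a u = pmf (P u s) s" for u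
  have super: "a u * a v \<le> a (u + v)" if "u \<ge> 0" "v \<ge> 0" for u v
  proof -
    have "P (u + v) s = bind_pmf (P u s) (P v)" using tf s that by (simp add: transition_function_def)
    then have "a (u + v) = (\<integral>x. pmf (P v x) s \<partial>measure_pmf (P u s))" by (simp add: a_def pmf_bind)
    also have "\<dots> \<ge> (\<integral>x. indicator {s} x * a v \<partial>measure_pmf (P u s))"
    proof (rule integral_mono)
      show "integrable (measure_pmf (P u s)) (\<lambda>x. indicator {s} x * a v)"
        by (rule measure_pmf.integrable_const_bound[of _ "a v"]) (auto simp: a_def indicator_def)
      show "integrable (measure_pmf (P u s)) (\<lambda>x. pmf (P v x) s)"
        by (rule measure_pmf.integrable_const_bound[of _ 1]) (auto simp: pmf_le_1)
    qed (auto simp: indicator_def a_def)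
    also have "(\<integral>x. indicator {s} x * a v \<partial>measure_pmf (P u s)) = a u * a v"
      by (simp add: a_def measure_pmf_single)
    finally show ?thesis .
  qed
  have pow: "a u ^ n \<le> a (real n * u)" if "u \<ge> 0" for u n
  proof (induction n)
    case 0 show ?case using tf s by (simp add: a_def transition_function_def)
  next
    case (Suc n)
    have "a u ^ Suc n \<le> a u * a (real n * u)" using Suc by (simp add: a_def mult_left_mono)
    also have "\<dots> \<le> a (u + real n * u)" using that by (intro super) auto
    finally show ?case by (simp add: algebra_simps)
  qed
  have lim: "((\<lambda>h. (a h - 1) / h) \<longlongrightarrow> g s s) (at_right 0)"
    using tf s unfolding transition_function_def a_def by force
  have eps: "1 - c * t \<le> a t + \<epsilon> * t" if \<epsilon>: "\<epsilon> > 0" for \<epsilon>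
  proof -
    \<comment> \<open>cut \<open>[0, t]\<close> into equal pieces so short that the derivative at zero governs each of them\<close>
    define h where "h j = t / real (Suc j)" for j
    have h0: "h \<longlonglongrightarrow> 0" unfolding h_def by real_asymp
    have hpos: "h j > 0" for j using t by (simp add: h_def)
    have "filterlim h (at_right 0) sequentially"
      using h0 hpos by (intro tendsto_imp_filterlim_at_right) auto
    then have "((\<lambda>j. (a (h j) - 1) / h j) \<longlongrightarrow> g s s) sequentially"
      by (rule filterlim_compose[OF lim])
    then have "eventually (\<lambda>j. (a (h j) - 1) / h j > g s s - \<epsilon>) sequentially"
      by (rule order_tendstoD(1)) (use \<epsilon> in simp)
    moreover have "(\<lambda>j. (c + \<epsilon>) * h j) \<longlonglongrightarrow> (c + \<epsilon>) * 0" by (intro tendsto_intros h0)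
    then have "eventually (\<lambda>j. (c + \<epsilon>) * h j < 1) sequentially" by (intro order_tendstoD(2)) auto
    ultimately have "eventually (\<lambda>j. (a (h j) - 1) / h j > g s s - \<epsilon> \<and> (c + \<epsilon>) * h j < 1) sequentially"
      by eventually_elim simp
    then obtain j where j: "(a (h j) - 1) / h j > g s s - \<epsilon>" "(c + \<epsilon>) * h j < 1"
      by (auto simp: eventually_sequentially)
    have "(a (h j) - 1) / h j \<ge> - (c + \<epsilon>)" using j(1) c by simp
    then have *: "a (h j) \<ge> 1 + - ((c + \<epsilon>) * h j)"
      using hpos[of j] by (simp add: field_simps)
    have th: "real (Suc j) * h j = t" by (simp add: h_def)
    have "1 + real (Suc j) * (- ((c + \<epsilon>) * h j)) \<le> (1 + - ((c + \<epsilon>) * h j)) ^ Suc j"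
      by (rule Bernoulli_inequality) (use j(2) in simp)
    also have "\<dots> \<le> a (h j) ^ Suc j" using * j(2) by (intro power_mono) auto
    also have "\<dots> \<le> a t" using pow[of "h j" "Suc j"] hpos[of j] unfolding th by simp
    also have "1 + real (Suc j) * (- ((c + \<epsilon>) * h j)) = 1 - (c + \<epsilon>) * (real (Suc j) * h j)" by simp
    finally show ?thesis unfolding th by (simp add: algebra_simps)
  qed
  have "1 - c * t \<le> a t + \<delta>" if "\<delta> > 0" for \<delta>
    using eps[of "\<delta> / t"] t that by simp
  then have "1 - c * t \<le> a t" by (rule field_le_epsilon)
  then show ?thesis by (simp add: a_def)
qed

text \<open>
  Differentiate the invariance at time zero. The exit bound dominates the difference quotients
  uniformly in the state, which justifies exchanging limit and expectation.
\<close>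

lemma stationary_generator:
  assumes tf: "transition_function S g P" and st: "stationary_distribution S P p"
    and c: "\<And>s. s \<in> S \<Longrightarrow> - g s s \<le> c" and s': "s' \<in> S"
  shows "(\<integral>s. g s s' \<partial>measure_pmf p) = 0"
proof -
  have pS: "AE s in measure_pmf p. s \<in> S" using st
      by (auto simp: stationary_distribution_def AE_measure_pmf_iff)
  define h where "h j = 1 / real (Suc j)" for j
  have hpos: "h j > 0" for j by (simp add: h_def)
  have fh: "filterlim h (at_right 0) sequentially"
  proof (rule tendsto_imp_filterlim_at_right)
    show "h \<longlonglongrightarrow> 0" unfolding h_def by real_asymp
  qed (simp add: hpos)
  define q where "q j s = (pmf (P (h j) s) s' - of_bool (s' = s)) / h j" for j s
  have ub: "\<bar>q j s\<bar> \<le> c" if "s \<in> S" for j s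
  proof -
    have e: "1 - pmf (P (h j) s) s \<le> c * h j"
      using transition_exit_bound[OF tf that c[OF that]] hpos[of j] by simp
    have "\<bar>pmf (P (h j) s) s' - of_bool (s' = s)\<bar> \<le> 1 - pmf (P (h j) s) s"
    proof (cases "s' = s")
      case True then show ?thesis by (simp add: pmf_le_1)
    next
      case False
      have "measure (P (h j) s) {s, s'} \<le> 1" by simp
      then show ?thesis using False by (simp add: measure_measure_pmf_finite)
    qed
    then show ?thesis using e hpos[of j] by (simp add: q_def field_simps)
  qed
  have "(\<lambda>j. \<integral>s. q j s \<partial>measure_pmf p) \<longlonglongrightarrow> (\<integral>s. g s s' \<partial>measure_pmf p)"
  proof (rule integral_dominated_convergence[where w = "\<lambda>_. c"])
    show "AE s in measure_pmf p. (\<lambda>j. q j s) \<longlonglongrightarrow> g s s'"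
      using pS
    proof eventually_elim
      case (elim s)
      then have "((\<lambda>h. (pmf (P h s) s' - of_bool (s' = s)) / h) \<longlongrightarrow> g s s') (at_right 0)"
        using tf s' by (auto simp: transition_function_def)
      from filterlim_compose[OF this fh] show ?case unfolding q_def .
    qed
    show "AE s in measure_pmf p. norm (q j s) \<le> c" for j
      using pS ub by (auto elim: eventually_mono)
  qed auto
  moreover have "(\<integral>s. q j s \<partial>measure_pmf p) = 0" for j
  proof -
    have i1: "integrable (measure_pmf p) (\<lambda>s. pmf (P (h j) s) s')"
      by (rule measure_pmf.integrable_const_bound[of _ 1]) (auto simp: pmf_le_1)
    have i2: "integrable (measure_pmf p) (\<lambda>s. indicator {s'} s :: real)"
      by (rule measure_pmf.integrable_const_bound[of _ 1]) auto
    have eq: "q j s = (pmf (P (h j) s) s' - indicator {s'} s) / h j" for s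
      by (auto simp: q_def indicator_def)
    have "(\<integral>s. q j s \<partial>measure_pmf p) = (pmf (bind_pmf p (P (h j))) s' - pmf p s') / h j"
      unfolding eq using i1 i2 by (simp add: pmf_bind measure_pmf_single)
    also have "bind_pmf p (P (h j)) = p"
      using st hpos[of j] by (auto simp: stationary_distribution_def)
    finally show ?thesis by simp
  qed
  ultimately have "(\<lambda>j :: nat. 0) \<longlonglongrightarrow> (\<integral>s. g s s' \<partial>measure_pmf p)" by simp
  then show ?thesis by (simp add: LIMSEQ_const_iff)
qed

text \<open>
  \<open>K\<close> is the identity plus the generator divided by a constant not smaller than any exit rate.
  Replacing the semigroup by one fixed kernel removes continuous time from the rest of the argument.
\<close>

lemma stationary_uniformized:
  assumes tf: "transition_function S g P" and st: "stationary_distribution S P p" and c: "0 < c"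
    and K: "\<And>s s'. s \<in> S \<Longrightarrow> s' \<in> S \<Longrightarrow> pmf (K s) s' = of_bool (s' = s) + g s s' / c"
    and KS: "\<And>s. s \<in> S \<Longrightarrow> set_pmf (K s) \<subseteq> S"
  shows "bind_pmf p K = p"
proof (rule pmf_eqI)
  fix i
  have pS: "set_pmf p \<subseteq> S" using st by (auto simp: stationary_distribution_def)
  show "pmf (bind_pmf p K) i = pmf p i"
  proof (cases "i \<in> S")
    case False
    then have "i \<notin> set_pmf p" "i \<notin> set_pmf (bind_pmf p K)" using pS KS by auto
    then show ?thesis by (metis pmf_eq_0_set_pmf)
  next
    case True
    have "- g s s \<le> c" if "s \<in> S" for s
    proof -
      have "0 \<le> c * pmf (K s) s" using c by simp
      also have "\<dots> = c + g s s" using K[OF that that] c by (simp add: field_simps)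
      finally show ?thesis by simp
    qed
    from stationary_generator[OF tf st this True] have 0: "(\<integral>s. g s i \<partial>measure_pmf p) = 0" .
    have "pmf (bind_pmf p K) i - pmf p i
        = (\<integral>s. pmf (K s) i \<partial>measure_pmf p) - (\<integral>s. indicator {i} s \<partial>measure_pmf p)"
      by (simp add: pmf_bind measure_pmf_single)
    also have "\<dots> = (\<integral>s. pmf (K s) i - indicator {i} s \<partial>measure_pmf p)"
      by (rule Bochner_Integration.integral_diff[symmetric])
        (auto intro!: measure_pmf.integrable_const_bound[of _ 1] simp: pmf_le_1)
    also have "\<dots> = (\<integral>s. g s i / c \<partial>measure_pmf p)"
      by (rule integral_cong_AE) (use pS K True in \<open>auto simp: AE_measure_pmf_iff indicator_def\<close>)
    also have "\<dots> = 0" using 0 by simp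
    finally show ?thesis by simp
  qed
qed

text \<open>
  Each of the \<open>n\<close> servers is offered departures at rate 1, also when it is idle; since natural number
  subtraction leaves an empty queue empty, idle servers contribute no change, and the total rate
  \<open>(1 + lam) n\<close> is the same in all states.
\<close>

definition jump_chain ::
    "real \<Rightarrow> nat \<Rightarrow> nat \<Rightarrow> nat pair_pre_digraph \<Rightarrow> (state \<Rightarrow> nat pmf) \<Rightarrow> state \<Rightarrow> state pmf" where
  "jump_chain lam d n G \<tau> s = bernoulli_pmf (lam / (1 + lam)) \<bind>
     (\<lambda>b. if b then arrival d G \<tau> s else map_pmf (\<lambda>j. departure j s) (pmf_of_set {..<n}))"

lemma arrival_support:
  assumes reg: "regular_graph_on n k G" "2 \<le> k" and tie: "tie_breaking_rule n d G \<tau>" and s: "s \<in> states n d G"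
  shows "set_pmf (arrival d G \<tau> s) \<subseteq> states n d G"
proof -
  obtain q w where qw: "s = (q, w)" by (cases s)
  have w: "w i \<in> parcs G" if "i < d" for i using s qw that by (auto simp: states_def)
  have tau: "j < n" if "j \<in> set_pmf (\<tau> s)" for j
  proof -
    have "j \<in> (\<lambda>i. snd (w i)) ` {..<d}" using tie s that
        by (auto simp: tie_breaking_rule_def shortest_queues_def qw)
    then show ?thesis using w regular_graph_facts(1)[OF reg(1)] by force
  qed
  have "set_pmf (walkers_step d G w) \<subseteq> {..<d} \<rightarrow>\<^sub>E parcs G"
    using nbrw_step_support(4)[OF reg w]
    by (auto simp: walkers_step_def set_Pi_pmf PiE_dflt_def PiE_iff extensional_def)
  moreover have "q(j := Suc (q j)) \<in> {..<n} \<rightarrow>\<^sub>E UNIV" if "j < n" for j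
    using s that by (auto simp: qw states_def PiE_iff extensional_def)
  ultimately have "(q(j := Suc (q j)), w') \<in> states n d G"
    if "j \<in> set_pmf (\<tau> s)" "w' \<in> set_pmf (walkers_step d G w)" for j w'
    using that tau by (auto simp: states_def)
  then show ?thesis by (auto simp: arrival_def qw)
qed

lemma departure_states:
  "s \<in> states n d G \<Longrightarrow> j < n \<Longrightarrow> departure j s \<in> states n d G"
  by (auto simp: departure_def states_def PiE_iff extensional_def split: prod.splits)

lemma stationary_jump_chain:
  assumes reg: "regular_graph_on n k G" "2 \<le> k" and tie: "tie_breaking_rule n d G \<tau>"
    and lam: "0 < lam" and n: "0 < n"
    and tf: "transition_function (states n d G) (nbrw_pod_generator lam d n G \<tau>) P"
    and st: "stationary_distribution (states n d G) P p"
  shows "bind_pmf p (jump_chain lam d n G \<tau>) = p"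
proof (rule stationary_uniformized[OF tf st, of "(1 + lam) * real n"])
  show "0 < (1 + lam) * real n" using lam n by simp
next
  fix s assume s: "s \<in> states n d G"
  show "set_pmf (jump_chain lam d n G \<tau> s) \<subseteq> states n d G"
    using arrival_support[OF reg tie s] departure_states[OF s] n
    by (auto simp: jump_chain_def lessThan_empty_iff set_pmf_of_set split: if_splits)
  fix s' assume s': "s' \<in> states n d G"
  let ?D = "\<lambda>j. of_bool (s' = departure j s) :: real"
  have idle: "departure j s = s" if "j \<in> {..<n} - busy_servers n s" for j
    using that by (cases s) (auto simp: departure_def busy_servers_def)
  have B: "busy_servers n s \<subseteq> {..<n}" by (auto simp: busy_servers_def)
  have dep: "pmf (map_pmf (\<lambda>j. departure j s) (pmf_of_set {..<n})) s' = (\<Sum>j<n. ?D j) / n"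
  proof -
    have "pmf (map_pmf (\<lambda>j. departure j s) (pmf_of_set {..<n})) s'
        = real (card ({..<n} \<inter> {j. departure j s = s'})) / n"
      using n by (simp add: pmf_map vimage_def measure_pmf_of_set lessThan_empty_iff)
    also have "real (card ({..<n} \<inter> {j. departure j s = s'})) = (\<Sum>j<n. ?D j)"
      by (simp add: of_bool_def sum.If_cases) (rule arg_cong[of _ _ card], auto)
    finally show ?thesis .
  qed
  have "(\<Sum>j<n. ?D j) = (\<Sum>j\<in>busy_servers n s. ?D j) + (\<Sum>j\<in>{..<n} - busy_servers n s. ?D j)"
    using B by (metis add.commute finite_lessThan sum.subset_diff)
  also have "(\<Sum>j\<in>{..<n} - busy_servers n s. ?D j) = (\<Sum>j\<in>{..<n} - busy_servers n s. of_bool (s' = s))"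
    using idle by (intro sum.cong) auto
  also have "\<dots> = (real n - real (card (busy_servers n s))) * of_bool (s' = s)"
    using B card_mono[OF _ B] by (simp add: card_Diff_subset finite_subset[OF B] of_nat_diff)
  finally have D: "(\<Sum>j<n. ?D j) = (\<Sum>j\<in>busy_servers n s. ?D j)
      + (real n - real (card (busy_servers n s))) * of_bool (s' = s)" .
  have p: "0 \<le> lam / (1 + lam)" "lam / (1 + lam) \<le> 1" "1 - lam / (1 + lam) = 1 / (1 + lam)"
    using lam by (auto simp: field_simps)
  have "pmf (jump_chain lam d n G \<tau> s) s' = lam / (1 + lam) * pmf (arrival d G \<tau> s) s'
      + 1 / (1 + lam) * ((\<Sum>j<n. ?D j) / n)"
    unfolding jump_chain_def dep[symmetric] pmf_bind using p by (simp add: integral_bernoulli_pmf)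
  also have "\<dots> = of_bool (s' = s) + nbrw_pod_generator lam d n G \<tau> s s' / ((1 + lam) * real n)"
    unfolding D nbrw_pod_generator_def using lam n
    by (simp add: divide_simps) (simp add: algebra_simps)?
  finally show "pmf (jump_chain lam d n G \<tau> s) s' = of_bool (s' = s)
      + nbrw_pod_generator lam d n G \<tau> s s' / ((1 + lam) * real n)" .
qed

section \<open>Stationary balance equations\<close>

lemma integrable_pmf_bounded:
  fixes f :: "'a \<Rightarrow> real"
  assumes "\<And>x. x \<in> set_pmf p \<Longrightarrow> \<bar>f x\<bar> \<le> B"
  shows "integrable (measure_pmf p) f"
  using assms by (intro measure_pmf.integrable_const_bound[of _ B]) (auto simp: AE_measure_pmf_iff)

text \<open>
  Boundedness makes Fubini available for functions of either sign: it is applied to the nonnegative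
  function \<open>f + B\<close>.
\<close>

lemma expectation_bind_bounded:
  fixes f :: "'b \<Rightarrow> real"
  assumes "\<And>x y. x \<in> set_pmf p \<Longrightarrow> y \<in> set_pmf (K x) \<Longrightarrow> \<bar>f y\<bar> \<le> B"
  shows "measure_pmf.expectation (bind_pmf p K) f
      = measure_pmf.expectation p (\<lambda>x. measure_pmf.expectation (K x) f)"
proof -
  have pos: "measure_pmf.expectation (bind_pmf p K) g
      = measure_pmf.expectation p (\<lambda>x. measure_pmf.expectation (K x) g)"
    if g: "\<And>x y. x \<in> set_pmf p \<Longrightarrow> y \<in> set_pmf (K x) \<Longrightarrow> 0 \<le> g y \<and> g y \<le> C" for g :: "'b \<Rightarrow> real" and C
  proof -
    have inner: "(\<integral>\<^sup>+y. ennreal (g y) \<partial>measure_pmf (K x)) = ennreal (measure_pmf.expectation (K x) g)"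
      if "x \<in> set_pmf p" for x
      using g[OF that] by (intro nn_integral_eq_integral integrable_pmf_bounded[of _ _ C]) (auto simp: AE_measure_pmf_iff)
    have "measure_pmf.expectation (bind_pmf p K) g
        = enn2real (\<integral>\<^sup>+y. ennreal (g y) \<partial>measure_pmf (bind_pmf p K))"
      using g by (intro integral_eq_nn_integral) (auto simp: AE_measure_pmf_iff)
    also have "\<dots> = enn2real (\<integral>\<^sup>+x. ennreal (measure_pmf.expectation (K x) g) \<partial>measure_pmf p)"
      unfolding nn_integral_bind_pmf using inner
      by (intro arg_cong[of _ _ enn2real] nn_integral_cong_AE) (auto simp: AE_measure_pmf_iff)
    also have "\<dots> = measure_pmf.expectation p (\<lambda>x. measure_pmf.expectation (K x) g)"
      using g by (intro integral_eq_nn_integral[symmetric])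
        (auto simp: AE_measure_pmf_iff intro!: integral_nonneg_AE)
    finally show ?thesis .
  qed
  have i1: "integrable (measure_pmf (bind_pmf p K)) f"
    using assms by (intro integrable_pmf_bounded[of _ _ B]) auto
  have i2: "integrable (measure_pmf (K x)) f" if "x \<in> set_pmf p" for x
    using assms that by (intro integrable_pmf_bounded[of _ _ B]) auto
  have b2: "\<bar>measure_pmf.expectation (K x) f\<bar> \<le> B" if "x \<in> set_pmf p" for x
  proof -
    have "\<bar>measure_pmf.expectation (K x) f\<bar> \<le> measure_pmf.expectation (K x) (\<lambda>y. \<bar>f y\<bar>)"
      by (rule integral_abs_bound)
    also have "\<dots> \<le> B"
      using assms[OF that] i2[OF that]
          by (intro measure_pmf.integral_le_const) (auto simp: AE_measure_pmf_iff)
    finally show ?thesis .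
  qed
  have "measure_pmf.expectation (bind_pmf p K) (\<lambda>y. f y + B)
      = measure_pmf.expectation p (\<lambda>x. measure_pmf.expectation (K x) (\<lambda>y. f y + B))"
    using assms by (intro pos[of _ "2 * B"]) (fastforce simp: abs_le_iff)+
  also have "\<dots> = measure_pmf.expectation p (\<lambda>x. measure_pmf.expectation (K x) f + B)"
    using i2 by (intro integral_cong_AE) (auto simp: AE_measure_pmf_iff)
  also have "\<dots> = measure_pmf.expectation p (\<lambda>x. measure_pmf.expectation (K x) f) + B"
    using b2 by (subst Bochner_Integration.integral_add) (auto intro!: integrable_pmf_bounded[of _ _ B])
  finally show ?thesis using i1 by simp
qed

lemma expectation_pair_bounded:
  fixes f :: "'a \<times> 'b \<Rightarrow> real"
  assumes "\<And>x y. x \<in> set_pmf p \<Longrightarrow> y \<in> set_pmf q \<Longrightarrow> \<bar>f (x, y)\<bar> \<le> B"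
  shows "measure_pmf.expectation (pair_pmf p q) f
    = measure_pmf.expectation p (\<lambda>x. measure_pmf.expectation q (\<lambda>y. f (x, y)))"
proof -
  have "pair_pmf p q = bind_pmf p (\<lambda>x. map_pmf (Pair x) q)"
    by (simp add: pair_pmf_def map_pmf_def)
  then have "measure_pmf.expectation (pair_pmf p q) f
      = measure_pmf.expectation p (\<lambda>x. measure_pmf.expectation (map_pmf (Pair x) q) f)"
    by (simp only:) (rule expectation_bind_bounded[where B = B], use assms in auto)
  then show ?thesis by simp
qed

locale nbrw_pod =
  fixes lam :: real and d k n :: nat and G :: "nat pair_pre_digraph" and \<tau> :: "state \<Rightarrow> nat pmf" and p :: "state pmf"
  assumes lam: "0 < lam" and d: "1 \<le> d" and k: "2 \<le> k" and n: "0 < n"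
    and reg: "regular_graph_on n k G"
    and tie: "tie_breaking_rule n d G \<tau>"
    and p_states: "set_pmf p \<subseteq> states n d G"
    and stationary: "bind_pmf p (jump_chain lam d n G \<tau>) = p"
begin

abbreviation E :: "(state \<Rightarrow> real) \<Rightarrow> real" where "E \<equiv> measure_pmf.expectation p"
abbreviation S :: "state set" where "S \<equiv> states n d G"

text \<open>
  Boundedness is required on the states only. Elsewhere, for instance for a walker not on an edge,
  the functions of interest take meaningless default values.
\<close>

definition bdd :: "(state \<Rightarrow> real) \<Rightarrow> bool" where "bdd f \<longleftrightarrow> (\<exists>B. \<forall>s\<in>S. \<bar>f s\<bar> \<le> B)"

lemma bddI: "(\<And>s. s \<in> S \<Longrightarrow> \<bar>f s\<bar> \<le> B) \<Longrightarrow> bdd f" unfolding bdd_def by blast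

lemma bdd_const [intro]: "bdd (\<lambda>_. c)" by (auto simp: bdd_def)

lemma bdd_add [intro]: "bdd f \<Longrightarrow> bdd g \<Longrightarrow> bdd (\<lambda>s. f s + g s)"
  unfolding bdd_def
proof (elim exE)
  fix B C assume "\<forall>s\<in>S. \<bar>f s\<bar> \<le> B" "\<forall>s\<in>S. \<bar>g s\<bar> \<le> C"
  then show "\<exists>B. \<forall>s\<in>S. \<bar>f s + g s\<bar> \<le> B" by (intro exI[of _ "B + C"]) fastforce
qed

lemma bdd_mult [intro]: "bdd f \<Longrightarrow> bdd g \<Longrightarrow> bdd (\<lambda>s. f s * g s)"
  unfolding bdd_def
proof (elim exE)
  fix B C assume "\<forall>s\<in>S. \<bar>f s\<bar> \<le> B" "\<forall>s\<in>S. \<bar>g s\<bar> \<le> C"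
  then show "\<exists>B. \<forall>s\<in>S. \<bar>f s * g s\<bar> \<le> B"
    by (intro exI[of _ "B * C"]) (auto simp: abs_mult intro!: mult_mono' order_trans[OF abs_ge_zero])
qed

lemma bdd_abs [intro]: "bdd f \<Longrightarrow> bdd (\<lambda>s. \<bar>f s\<bar>)" by (simp add: bdd_def)
lemma bdd_diff [intro]: "bdd f \<Longrightarrow> bdd g \<Longrightarrow> bdd (\<lambda>s. f s - g s)" using bdd_add[of f "\<lambda>s. - g s"]
    by (simp add: bdd_def)
lemma bdd_divide [intro]: "bdd f \<Longrightarrow> bdd (\<lambda>s. f s / c)" using bdd_mult[of f "\<lambda>_. 1 / c"] by auto
lemma bdd_sum [intro]: "(\<And>i. i \<in> A \<Longrightarrow> bdd (f i)) \<Longrightarrow> bdd (\<lambda>s. \<Sum>i\<in>A. f i s)"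
  by (induction A rule: infinite_finite_induct) auto
lemma bdd_of_bool [intro]: "bdd (\<lambda>s. of_bool (P s))" by (rule bddI[of _ 1]) auto
lemma bdd_power [intro]: "bdd f \<Longrightarrow> bdd (\<lambda>s. f s ^ m)" by (induction m) auto

lemma bdd_cong: "bdd f \<Longrightarrow> (\<And>s. s \<in> S \<Longrightarrow> f s = g s) \<Longrightarrow> bdd g" by (auto simp: bdd_def)

lemma bdd_expectation:
  assumes "bdd f" "\<And>s. s \<in> S \<Longrightarrow> set_pmf (K s) \<subseteq> S"
  shows "bdd (\<lambda>s. measure_pmf.expectation (K s) f)"
proof -
  obtain B where B: "\<And>s. s \<in> S \<Longrightarrow> \<bar>f s\<bar> \<le> B" using assms(1) by (auto simp: bdd_def)
  show ?thesis
  proof (rule bddI[of _ B])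
    fix s assume s: "s \<in> S"
    have "\<bar>measure_pmf.expectation (K s) f\<bar> \<le> measure_pmf.expectation (K s) (\<lambda>y. \<bar>f y\<bar>)"
      by (rule integral_abs_bound)
    also have "\<dots> \<le> B"
      using assms(2)[OF s] B
      by (intro measure_pmf.integral_le_const integrable_pmf_bounded[of _ _ B]) (auto simp: AE_measure_pmf_iff)
    finally show "\<bar>measure_pmf.expectation (K s) f\<bar> \<le> B" .
  qed
qed

lemma bdd_integrable: "bdd f \<Longrightarrow> integrable (measure_pmf p) f"
  using p_states unfolding bdd_def by (meson integrable_pmf_bounded subsetD)

lemma E_add: "bdd f \<Longrightarrow> bdd g \<Longrightarrow> E (\<lambda>s. f s + g s) = E f + E g"
  by (simp add: bdd_integrable)
lemma E_diff: "bdd f \<Longrightarrow> bdd g \<Longrightarrow> E (\<lambda>s. f s - g s) = E f - E g"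
  by (simp add: bdd_integrable)
lemma E_sum: "(\<And>i. i \<in> A \<Longrightarrow> bdd (f i)) \<Longrightarrow> E (\<lambda>s. \<Sum>i\<in>A. f i s) = (\<Sum>i\<in>A. E (f i))"
  by (simp add: bdd_integrable)
lemma E_cong: "(\<And>s. s \<in> S \<Longrightarrow> f s = g s) \<Longrightarrow> E f = E g"
  using p_states by (intro integral_cong_AE) (auto simp: AE_measure_pmf_iff)
lemma E_mono: "bdd f \<Longrightarrow> bdd g \<Longrightarrow> (\<And>s. s \<in> S \<Longrightarrow> f s \<le> g s) \<Longrightarrow> E f \<le> E g"
  using p_states by (intro integral_mono_AE bdd_integrable) (auto simp: AE_measure_pmf_iff)
lemma E_le_const: "bdd f \<Longrightarrow> (\<And>s. s \<in> S \<Longrightarrow> f s \<le> c) \<Longrightarrow> E f \<le> c"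
  using E_mono[of f "\<lambda>_. c"] by auto
lemma E_abs_le: "bdd f \<Longrightarrow> bdd g \<Longrightarrow> (\<And>s. s \<in> S \<Longrightarrow> \<bar>f s\<bar> \<le> g s) \<Longrightarrow> \<bar>E f\<bar> \<le> E g"
  by (rule order_trans[OF integral_abs_bound], rule E_mono) auto

lemma arrival_states: "s \<in> S \<Longrightarrow> set_pmf (arrival d G \<tau> s) \<subseteq> S"
  by (rule arrival_support[OF reg k tie])

lemma walker_arc: "(q, w) \<in> S \<Longrightarrow> a < d \<Longrightarrow> w a \<in> parcs G"
  by (auto simp: states_def)

lemma walker_vertex: "(q, w) \<in> S \<Longrightarrow> a < d \<Longrightarrow> snd (w a) < n"
  using walker_arc[of q w a] regular_graph_facts(1)[OF reg] by force

lemma chosen: "(q, w) \<in> S \<Longrightarrow> j \<in> set_pmf (\<tau> (q, w)) \<Longrightarrow>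
    j \<in> (\<lambda>a. snd (w a)) ` {..<d} \<and> (\<forall>a<d. q j \<le> q (snd (w a))) \<and> j < n"
  using tie walker_vertex[of q w] by (fastforce simp: tie_breaking_rule_def shortest_queues_def)

lemma walkers_states: "(q, w) \<in> S \<Longrightarrow> w' \<in> set_pmf (walkers_step d G w) \<Longrightarrow> (q, w') \<in> S"
proof -
  assume s: "(q, w) \<in> S" and w': "w' \<in> set_pmf (walkers_step d G w)"
  have "w' \<in> {..<d} \<rightarrow>\<^sub>E parcs G"
    using nbrw_step_support(4)[OF reg k walker_arc[OF s]] w'
    by (auto simp: walkers_step_def set_Pi_pmf PiE_dflt_def PiE_iff extensional_def)
  then show ?thesis using s by (simp add: states_def)
qed

lemma queue_states: "(q, w) \<in> S \<Longrightarrow> j < n \<Longrightarrow> (q(j := x), w) \<in> S"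
  by (auto simp: states_def PiE_iff extensional_def)

lemma arrival_expectation:
  assumes f: "bdd f" and s: "(q, w) \<in> S"
  shows "measure_pmf.expectation (arrival d G \<tau> (q, w)) f
    = (\<integral>j. (\<integral>w'. f (q(j := Suc (q j)), w') \<partial>walkers_step d G w) \<partial>\<tau> (q, w))"
proof -
  obtain B where B: "\<And>s. s \<in> S \<Longrightarrow> \<bar>f s\<bar> \<le> B" using f by (auto simp: bdd_def)
  show ?thesis unfolding arrival_def
    using B queue_states[OF walkers_states[OF s]] chosen[OF s]
    by (simp add: split_beta expectation_pair_bounded[where B = B])
qed

lemma jump_chain_expectation:
  assumes "s \<in> S" "bdd f"
  shows "(1 + lam) * measure_pmf.expectation (jump_chain lam d n G \<tau> s) f
    = lam * measure_pmf.expectation (arrival d G \<tau> s) f + (\<Sum>j<n. f (departure j s)) / n"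
proof -
  obtain B where B: "\<And>s. s \<in> S \<Longrightarrow> \<bar>f s\<bar> \<le> B" using assms(2) by (auto simp: bdd_def)
  have "measure_pmf.expectation (jump_chain lam d n G \<tau> s) f
      = measure_pmf.expectation (arrival d G \<tau> s) f * (lam / (1 + lam))
        + measure_pmf.expectation (map_pmf (\<lambda>j. departure j s) (pmf_of_set {..<n})) f * (1 - lam / (1 + lam))"
    unfolding jump_chain_def
  proof (subst expectation_bind_bounded[where B = B])
    fix b y assume "b \<in> set_pmf (bernoulli_pmf (lam / (1 + lam)))"
      "y \<in> set_pmf (if b then arrival d G \<tau> s else map_pmf (\<lambda>j. departure j s) (pmf_of_set {..<n}))"
    then have "y \<in> S"
      using arrival_states[OF assms(1)] departure_states[OF assms(1)] n
      by (auto simp: set_pmf_of_set lessThan_empty_iff split: if_splits)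
    then show "\<bar>f y\<bar> \<le> B" by (rule B)
  qed (use lam in \<open>simp add: integral_bernoulli_pmf\<close>)
  moreover have "measure_pmf.expectation (map_pmf (\<lambda>j. departure j s) (pmf_of_set {..<n})) f
      = (\<Sum>j<n. f (departure j s)) / n"
    using n by (simp add: integral_pmf_of_set lessThan_empty_iff)
  moreover have "1 - lam / (1 + lam) = 1 / (1 + lam)" using lam by (simp add: field_simps)
  ultimately have "measure_pmf.expectation (jump_chain lam d n G \<tau> s) f
      = (lam * measure_pmf.expectation (arrival d G \<tau> s) f + (\<Sum>j<n. f (departure j s)) / n) / (1 + lam)"
    by (simp add: add_divide_distrib mult.commute)
  then show ?thesis using lam by simp
qed

text \<open>
  A step of the jump chain does not change the expectation of \<open>f\<close>. Multiplied by \<open>1 + lam\<close>, the expected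
  change is the sum of a part due to arrivals and a part due to departures from a uniform server.
\<close>

lemma balance:
  assumes f: "bdd f"
  shows "lam * E (\<lambda>s. measure_pmf.expectation (arrival d G \<tau> s) f - f s)
    + E (\<lambda>s. \<Sum>j<n. f (departure j s) - f s) / n = 0"
proof -
  obtain B where B: "\<And>s. s \<in> S \<Longrightarrow> \<bar>f s\<bar> \<le> B" using f by (auto simp: bdd_def)
  have jS: "set_pmf (jump_chain lam d n G \<tau> s) \<subseteq> S" if "s \<in> S" for s
    using arrival_states[OF that] departure_states[OF that] n
    by (auto simp: jump_chain_def set_pmf_of_set lessThan_empty_iff split: if_splits)
  have bj: "bdd (\<lambda>s. measure_pmf.expectation (jump_chain lam d n G \<tau> s) f)"
    and ba: "bdd (\<lambda>s. measure_pmf.expectation (arrival d G \<tau> s) f)"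
    by (intro bdd_expectation f jS arrival_states; assumption)+
  have bD: "bdd (\<lambda>s. \<Sum>j<n. f (departure j s))"
    by (intro bdd_sum bddI[of _ B] B departure_states) auto
  have "E f = E (\<lambda>s. measure_pmf.expectation (jump_chain lam d n G \<tau> s) f)"
    using expectation_bind_bounded[of p "jump_chain lam d n G \<tau>" f B] jS p_states B
    unfolding stationary by blast
  then have "(1 + lam) * E f = E (\<lambda>s. (1 + lam) * measure_pmf.expectation (jump_chain lam d n G \<tau> s) f)"
    by simp
  also have "\<dots> = E (\<lambda>s. lam * measure_pmf.expectation (arrival d G \<tau> s) f + (\<Sum>j<n. f (departure j s)) / n)"
    by (intro E_cong jump_chain_expectation f)
  also have "\<dots> = lam * E (\<lambda>s. measure_pmf.expectation (arrival d G \<tau> s) f)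
      + E (\<lambda>s. \<Sum>j<n. f (departure j s)) / n"
    using ba bD by (subst E_add) auto
  finally show ?thesis using ba bD f n
    by (simp add: sum_subtractf E_diff bdd_mult bdd_const field_simps)
qed

lemma walkers_expectation_prod:
  assumes s: "(q, w) \<in> S" and f: "\<And>a e. a < d \<Longrightarrow> e \<in> parcs G \<Longrightarrow> 0 \<le> f a e"
  shows "(\<integral>w'. (\<Prod>a<d. f a (w' a)) \<partial>walkers_step d G w) = (\<Prod>a<d. \<integral>e. f a e \<partial>nbrw_step G (w a) :: real)"
  unfolding walkers_step_def
proof (rule expectation_prod_Pi_pmf)
  fix a assume "a \<in> {..<d}"
  then have a: "w a \<in> parcs G" using walker_arc[OF s] by simp
  have "finite (set_pmf (nbrw_step G (w a)))"
    using nbrw_step_support[OF reg k a] by (auto simp: nbrw_step_def split_beta)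
  then show "integrable (measure_pmf (nbrw_step G (w a))) (f a)" by (rule integrable_measure_pmf_finite)
  fix e assume "e \<in> set_pmf (nbrw_step G (w a))"
  then have "e \<in> parcs G" using nbrw_step_support(4)[OF reg k a] by blast
  then show "0 \<le> f a e" using f \<open>a \<in> {..<d}\<close> by blast
qed simp

lemma walkers_expectation_one:
  fixes f :: "nat \<times> nat \<Rightarrow> real"
  assumes "a < d"
  shows "(\<integral>w'. f (w' a) \<partial>walkers_step d G w) = (\<integral>e. f e \<partial>nbrw_step G (w a))"
proof -
  have "(\<integral>w'. f (w' a) \<partial>walkers_step d G w) = (\<integral>e. f e \<partial>map_pmf (\<lambda>w'. w' a) (walkers_step d G w))" by simp
  also have "map_pmf (\<lambda>w'. w' a) (walkers_step d G w) = nbrw_step G (w a)"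
    unfolding walkers_step_def using assms by (simp add: Pi_pmf_component)
  finally show ?thesis .
qed

lemma walkers_integrable: "(q, w) \<in> S \<Longrightarrow> integrable (measure_pmf (walkers_step d G w)) (f :: _ \<Rightarrow> real)"
proof (rule integrable_measure_pmf_finite)
  assume s: "(q, w) \<in> S"
  have "finite (set_pmf (nbrw_step G (w a)))" if "a < d" for a
    using nbrw_step_support[OF reg k walker_arc[OF s that]] by (auto simp: nbrw_step_def split_beta)
  then show "finite (set_pmf (walkers_step d G w))"
    unfolding walkers_step_def by (subst set_Pi_pmf) (auto intro!: finite_PiE_dflt)
qed

lemma tau_integrable: "(q, w) \<in> S \<Longrightarrow> integrable (measure_pmf (\<tau> (q, w))) (f :: _ \<Rightarrow> real)"
proof (rule integrable_measure_pmf_finite)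
  assume s: "(q, w) \<in> S"
  show "finite (set_pmf (\<tau> (q, w)))"
    using chosen[OF s] by (rule_tac finite_subset[of _ "{..<n}"]) auto
qed

lemma head_prob_ge0: "e \<in> parcs G \<Longrightarrow> 0 \<le> head_prob G r e x" and head_prob_le1: "e \<in> parcs G \<Longrightarrow>
    head_prob G r e x \<le> 1"
  using head_prob_bounds[OF reg k] by auto

end

lemma queue_proportion_sum:
  "queue_proportion n q i = (\<Sum>x<n. of_bool (i \<le> q x)) / real n"
proof -
  have "{j \<in> {..<n}. i \<le> q j} = {..<n} \<inter> {j. i \<le> q j}" by auto
  then show ?thesis by (simp add: queue_proportion_def of_bool_def sum.If_cases)
qed

lemma queue_proportion_range: "0 \<le> queue_proportion n q i" "queue_proportion n q i \<le> 1"
proof -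
  have "card {j \<in> {..<n}. i \<le> q j} \<le> card {..<n}" by (intro card_mono) auto
  then show "0 \<le> queue_proportion n q i" "queue_proportion n q i \<le> 1"
    by (auto simp: queue_proportion_def divide_le_eq_1)
qed

lemma queue_proportion_0: "0 < n \<Longrightarrow> queue_proportion n q 0 = 1"
  by (simp add: queue_proportion_sum)

lemma queue_proportion_Suc:
  assumes "j < n"
  shows "queue_proportion n (q(j := Suc (q j)))
    = (queue_proportion n q)(Suc (q j) := queue_proportion n q (Suc (q j)) + 1 / real n)"
proof
  fix i
  have "(\<Sum>x<n. of_bool (i \<le> (q(j := Suc (q j))) x)) = (\<Sum>x<n. of_bool (i \<le> q x) + (if x = j then of_bool (i
      = Suc (q j)) else 0 :: real))"
    by (intro sum.cong) auto
  also have "\<dots> = (\<Sum>x<n. of_bool (i \<le> q x)) + of_bool (i = Suc (q j))"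
    using assms by (simp add: sum.distrib)
  finally show "queue_proportion n (q(j := Suc (q j))) i
    = ((queue_proportion n q)(Suc (q j) := queue_proportion n q (Suc (q j)) + 1 / real n)) i"
    by (simp add: queue_proportion_sum add_divide_distrib)
qed

lemma queue_proportion_pred:
  assumes "j < n" "0 < q j"
  shows "queue_proportion n (q(j := q j - 1))
    = (queue_proportion n q)(q j := queue_proportion n q (q j) - 1 / real n)"
proof
  fix i
  have "(\<Sum>x<n. of_bool (i \<le> (q(j := q j - 1)) x)) = (\<Sum>x<n. of_bool (i \<le> q x) - (if x = j then of_bool (i
      = q j) else 0 :: real))"
    using assms(2) by (intro sum.cong) auto
  also have "\<dots> = (\<Sum>x<n. of_bool (i \<le> q x)) - of_bool (i = q j)"
    using assms by (simp add: sum_subtractf)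
  finally show "queue_proportion n (q(j := q j - 1)) i
    = ((queue_proportion n q)(q j := queue_proportion n q (q j) - 1 / real n)) i"
    by (simp add: queue_proportion_sum diff_divide_distrib)
qed

context nbrw_pod
begin

abbreviation X :: "state \<Rightarrow> nat \<Rightarrow> real" where "X s \<equiv> queue_proportion n (fst s)"

text \<open>
  The shortest of the queues seen by the walkers has length at least \<open>i\<close>; so it is this indicator,
  and not the tie-breaking rule, that determines the length of the queue joined.
\<close>

definition all_ge :: "nat \<Rightarrow> state \<Rightarrow> real" where
  "all_ge i s = of_bool (\<forall>a<d. i \<le> fst s (snd (snd s a)))"

lemma all_ge_chosen: "s \<in> S \<Longrightarrow> j \<in> set_pmf (\<tau> s) \<Longrightarrow> all_ge i s = of_bool (i \<le> fst s j)"
  using chosen[of "fst s" "snd s" j] by (auto simp: all_ge_def intro: order_trans)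

text \<open>
  An arrival at a queue of length \<open>i - 1\<close> raises \<open>X\<^sub>i\<close> by \<open>1 / n\<close> and a departure from a queue of length \<open>i\<close>
  lowers it by \<open>1 / n\<close>; all other coordinates stay. So only increments of \<open>F\<close> in coordinate directions occur,
  and a quadratic error bound for these replaces differentiability. The events happen at a total rate of
  order \<open>n\<close>, whence the error \<open>O(1 / n)\<close>.
\<close>

lemma rate_balance:
  fixes F :: "(nat \<Rightarrow> real) \<Rightarrow> real" and g :: "nat \<Rightarrow> (nat \<Rightarrow> real) \<Rightarrow> real"
  assumes F: "\<And>x. (\<And>i. x i \<in> {0..1}) \<Longrightarrow> \<bar>F x\<bar> \<le> B"
    and g: "\<And>x i. (\<And>i. x i \<in> {0..1}) \<Longrightarrow> \<bar>g i x\<bar> \<le> Bg"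
    and grad: "\<And>x i y. (\<And>i. x i \<in> {0..1}) \<Longrightarrow> y \<in> {0..1} \<Longrightarrow> 1 \<le> i \<Longrightarrow> i \<le> M \<Longrightarrow>
      \<bar>F (x(i := y)) - F x - (y - x i) * g i x\<bar> \<le> C * (y - x i)\<^sup>2"
    and cyl: "\<And>x i y. M < i \<Longrightarrow> F (x(i := y)) = F x"
    and C: "0 \<le> C"
  shows "\<bar>E (\<lambda>s. \<Sum>i=1..M. g i (X s) * (lam * (all_ge (i - 1) s - all_ge i s) - (X s i - X s (i + 1))))\<bar>
    \<le> C * (lam + 1) / real n"
proof -
  have Xr: "X s i \<in> {0..1}" for s i using queue_proportion_range by auto
  define f where "f s = F (X s)" for s :: state
  have bf: "bdd f" unfolding f_def by (rule bddI[of _ B]) (rule F[OF Xr])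
  have bX: "bdd (\<lambda>s. X s i)" for i by (rule bddI[of _ 1]) (use Xr in auto)
  have bg: "bdd (\<lambda>s. g i (X s))" for i by (rule bddI[of _ Bg]) (rule g[OF Xr])
  have bA: "bdd (all_ge i)" for i unfolding all_ge_def by auto
  define up where "up s = (\<Sum>i=1..M. g i (X s) * (all_ge (i - 1) s - all_ge i s))" for s
  define down where "down s = (\<Sum>i=1..M. g i (X s) * (X s i - X s (i + 1)))" for s
  define A where "A s = measure_pmf.expectation (arrival d G \<tau> s) f - f s" for s
  define D where "D s = (\<Sum>j<n. f (departure j s) - f s)" for s
  have bup: "bdd up" unfolding up_def by (intro bdd_sum bdd_mult bdd_diff bg bA)
  have bdown: "bdd down" unfolding down_def by (intro bdd_sum bdd_mult bdd_diff bg bX)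
  have bAA: "bdd A" unfolding A_def by (intro bdd_diff bdd_expectation bf arrival_states)
  obtain Bf where Bf: "\<And>s. s \<in> S \<Longrightarrow> \<bar>f s\<bar> \<le> Bf" using bf by (auto simp: bdd_def)
  have bD: "bdd D" unfolding D_def by (intro bdd_sum bdd_diff bf bddI[of _ Bf] Bf departure_states) auto
  have single: "(\<Sum>i=1..M. g i x * of_bool (i = l)) = (if 1 \<le> l \<and> l \<le> M then g l x else 0)" for l x
    by (simp add: of_bool_def if_distrib cong: if_cong)
  have arr: "\<bar>real n * A s - up s\<bar> \<le> C / real n" if "s \<in> S" for s
  proof -
    obtain q w where qw: "s = (q, w)" by (cases s)
    have s: "(q, w) \<in> S" using that qw by simp
    \<comment> \<open>every server that the tie-breaking rule may choose has the same queue length, so the error is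
      bounded for each of them\<close>
    define v where "v j = real n * (F (queue_proportion n (q(j := Suc (q j)))) - F (X s)) - up s" for j
    have vb: "\<bar>v j\<bar> \<le> C / real n" if j: "j \<in> set_pmf (\<tau> s)" for j
    proof -
      have jn: "j < n" using chosen[OF s] j qw by blast
      let ?y = "X s (Suc (q j)) + 1 / real n"
      have eq: "queue_proportion n (q(j := Suc (q j))) = (X s)(Suc (q j) := ?y)"
        using queue_proportion_Suc[OF jn] qw by simp
      have y: "?y \<in> {0..1}" using eq queue_proportion_range[of n "q(j := Suc (q j))" "Suc (q j)"] by simp
      have "up s = (\<Sum>i=1..M. g i (X s) * of_bool (i = Suc (q j)))"
        unfolding up_def using all_ge_chosen[OF \<open>s \<in> S\<close> j] qw by (intro sum.cong) auto
      then have up: "up s = (if Suc (q j) \<le> M then g (Suc (q j)) (X s) else 0)" unfolding single by simp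
      show ?thesis
      proof (cases "Suc (q j) \<le> M")
        case True
        have "\<bar>F ((X s)(Suc (q j) := ?y)) - F (X s) - (?y - X s (Suc (q j))) * g (Suc (q j)) (X s)\<bar>
            \<le> C * (?y - X s (Suc (q j)))\<^sup>2"
          using True y by (intro grad Xr) auto
        then have "real n * \<bar>F ((X s)(Suc (q j) := ?y)) - F (X s) - (1 / real n) * g (Suc (q j)) (X s)\<bar>
            \<le> real n * (C * (1 / real n)\<^sup>2)"
          using n by (intro mult_left_mono) auto
        then have "\<bar>real n * (F ((X s)(Suc (q j) := ?y)) - F (X s) - (1 / real n) * g (Suc (q j)) (X s))\<bar>
            \<le> C / real n"
          using n by (simp add: abs_mult power2_eq_square)
        then show ?thesis unfolding v_def eq up using True n by (simp add: right_diff_distrib)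
      next
        case False
        then show ?thesis unfolding v_def eq up using cyl C by simp
      qed
    qed
    have "real n * A s - up s = (\<integral>j. v j \<partial>\<tau> s)"
    proof -
      have "measure_pmf.expectation (arrival d G \<tau> s) f
          = (\<integral>j. F (queue_proportion n (q(j := Suc (q j)))) \<partial>\<tau> s)"
        unfolding qw arrival_expectation[OF bf s] by (simp add: f_def)
      then show ?thesis unfolding v_def A_def f_def qw using tau_integrable[OF s] by simp
    qed
    also have "\<bar>\<integral>j. v j \<partial>\<tau> s\<bar> \<le> (\<integral>j. \<bar>v j\<bar> \<partial>\<tau> s)" by (rule integral_abs_bound)
    also have "\<dots> \<le> C / real n"
      using vb tau_integrable[OF s] qw
          by (intro measure_pmf.integral_le_const) (auto simp: AE_measure_pmf_iff)
    finally show ?thesis .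
  qed
  have dep: "\<bar>D s + down s\<bar> \<le> C / real n" if "s \<in> S" for s
  proof -
    obtain q w where qw: "s = (q, w)" by (cases s)
    define u where "u j = f (departure j s) - f s + (1 / real n) * (\<Sum>i=1..M. g i (X s) * of_bool (i
        = q j))" for j
    have ub: "\<bar>u j\<bar> \<le> C * (1 / real n)\<^sup>2" if jn: "j < n" for j
    proof (cases "q j = 0")
      case True
      then have "q(j := q j - 1) = q" by auto
      then show ?thesis unfolding u_def single f_def departure_def qw using True C by simp
    next
      case False
      let ?y = "X s (q j) - 1 / real n"
      have eq: "queue_proportion n (q(j := q j - 1)) = (X s)(q j := ?y)"
        using queue_proportion_pred[OF jn] False qw by simp
      have y: "?y \<in> {0..1}" using eq queue_proportion_range[of n "q(j := q j - 1)" "q j"] by simp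
      have f: "f (departure j s) = F ((X s)(q j := ?y))" using eq by (simp add: f_def departure_def qw)
      show ?thesis
      proof (cases "q j \<le> M")
        case True
        have "\<bar>F ((X s)(q j := ?y)) - F (X s) - (?y - X s (q j)) * g (q j) (X s)\<bar> \<le> C * (?y - X s (q j))\<^sup>2"
          using True False y by (intro grad Xr) auto
        then show ?thesis unfolding u_def single f using True False by (simp add: f_def power_divide)
      next
        case False
        then show ?thesis unfolding u_def single f using cyl C by (simp add: f_def)
      qed
    qed
    have "down s = (\<Sum>i=1..M. g i (X s) * ((1 / real n) * (\<Sum>j<n. of_bool (i = q j))))"
      unfolding down_def
    proof (intro sum.cong refl arg_cong2[of _ _ _ _ "(*)"])
      fix i
      have "X s i - X s (i + 1) = (1 / real n) * (\<Sum>j<n. of_bool (i \<le> q j) - of_bool (i + 1 \<le> q j))"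
        by (simp add: qw queue_proportion_sum sum_subtractf diff_divide_distrib)
      also have "(\<Sum>j<n. of_bool (i \<le> q j) - of_bool (i + 1 \<le> q j)) = (\<Sum>j<n. of_bool (i = q j) :: real)"
        by (intro sum.cong) auto
      finally show "X s i - X s (i + 1) = (1 / real n) * (\<Sum>j<n. of_bool (i = q j))" .
    qed
    also have "\<dots> = (\<Sum>j<n. (1 / real n) * (\<Sum>i=1..M. g i (X s) * of_bool (i = q j)))"
      unfolding sum_distrib_left by (subst sum.swap) (simp add: mult_ac)
    finally have "D s + down s = (\<Sum>j<n. u j)" unfolding D_def u_def by (simp add: sum.distrib)
    also have "\<bar>\<Sum>j<n. u j\<bar> \<le> (\<Sum>j<n. C * (1 / real n)\<^sup>2)" using ub
        by (intro order_trans[OF sum_abs] sum_mono) auto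
    also have "\<dots> = C / real n" using n by (simp add: power2_eq_square)
    finally show ?thesis .
  qed
  have "lam * E A + E D / n = 0" using balance[OF bf] unfolding A_def D_def .
  then have zero: "lam * (real n * E A) + E D = 0" using n by (simp add: field_simps)
  have "E (\<lambda>s. \<Sum>i=1..M. g i (X s) * (lam * (all_ge (i - 1) s - all_ge i s) - (X s i - X s (i + 1))))
      = E (\<lambda>s. lam * up s - down s)"
    unfolding up_def down_def sum_distrib_left sum_subtractf[symmetric]
    by (intro E_cong sum.cong) (auto simp: algebra_simps)
  also have "\<dots> = lam * E up - E down" using E_diff[OF bdd_mult[OF bdd_const bup] bdown, of lam] by simp
  also have "\<dots> = - lam * E (\<lambda>s. real n * A s - up s) - E (\<lambda>s. D s + down s)"
  proof -
    have "E (\<lambda>s. real n * A s - up s) = real n * E A - E up"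
      using E_diff[OF bdd_mult[OF bdd_const bAA] bup, of "real n"] by simp
    moreover have "E (\<lambda>s. D s + down s) = E D + E down" by (rule E_add[OF bD bdown])
    ultimately show ?thesis using zero by (simp only: right_diff_distrib)
  qed
  finally have "\<bar>E (\<lambda>s. \<Sum>i=1..M. g i (X s) * (lam * (all_ge (i - 1) s - all_ge i s) - (X s i - X s (i + 1))))\<bar>
      \<le> lam * \<bar>E (\<lambda>s. real n * A s - up s)\<bar> + \<bar>E (\<lambda>s. D s + down s)\<bar>"
    using lam abs_mult[of "lam" "E (\<lambda>s. real n * A s - up s)"] by linarith
  also have "\<dots> \<le> lam * (C / real n) + C / real n"
    using E_abs_le[OF _ bdd_const arr] E_abs_le[OF _ bdd_const dep] bAA bup bD bdown lam
    by (intro add_mono mult_left_mono) (auto simp: bdd_diff bdd_mult bdd_add bdd_const)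
  also have "\<dots> = C * (lam + 1) / real n" by (simp add: distrib_left add_divide_distrib mult.commute)
  finally show ?thesis .
qed

end

section \<open>Visits of walkers to each other\<close>

context nbrw_pod
begin

text \<open>
  The walkers move only at arrivals and independently of the queues, so they form a Markov chain
  of their own, for which their stationary marginal is invariant.
\<close>

lemma walkers_balance:
  assumes g: "\<And>q w. (q, w) \<in> S \<Longrightarrow> \<bar>g w\<bar> \<le> B"
  shows "E (\<lambda>s. \<integral>w'. g w' \<partial>walkers_step d G (snd s)) = E (\<lambda>s. g (snd s))"
proof -
  have bg: "bdd (\<lambda>s. g (snd s))" by (rule bddI[of _ B]) (metis g prod.collapse)
  have a: "measure_pmf.expectation (arrival d G \<tau> s) (\<lambda>s. g (snd s)) = (\<integral>w'. g w' \<partial>walkers_step d G (snd s))"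
    if "s \<in> S" for s
    using arrival_expectation[OF bg, of "fst s" "snd s"] that by simp
  have ba: "bdd (\<lambda>s. \<integral>w'. g w' \<partial>walkers_step d G (snd s))"
    by (rule bdd_cong[OF bdd_expectation[OF bg arrival_states] a])
  have "lam * E (\<lambda>s. measure_pmf.expectation (arrival d G \<tau> s) (\<lambda>s. g (snd s)) - g (snd s)) = 0"
    using balance[OF bg] by (simp add: departure_def split_beta)
  moreover have "E (\<lambda>s. measure_pmf.expectation (arrival d G \<tau> s) (\<lambda>s. g (snd s)) - g (snd s))
      = E (\<lambda>s. \<integral>w'. g w' \<partial>walkers_step d G (snd s)) - E (\<lambda>s. g (snd s))"
    using E_diff[OF ba bg] E_cong[of "\<lambda>s. measure_pmf.expectation (arrival d G \<tau> s) (\<lambda>s. g (snd s)) - g (snd s)"] a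
    by (smt (verit))
  ultimately show ?thesis using lam by simp
qed

lemma walkers_expectation_two:
  fixes f g :: "nat \<times> nat \<Rightarrow> real"
  assumes s: "(q, w) \<in> S" and ab: "a < d" "b < d" "a \<noteq> b"
    and fg: "\<And>e. e \<in> parcs G \<Longrightarrow> 0 \<le> f e \<and> 0 \<le> g e"
  shows "(\<integral>w'. f (w' a) * g (w' b) \<partial>walkers_step d G w)
    = (\<integral>e. f e \<partial>nbrw_step G (w a)) * (\<integral>e. g e \<partial>nbrw_step G (w b))"
proof -
  have split: "(\<Prod>i<d. if i = a then X i else if i = b then Y i else 1) = X a * Y b" for X Y :: "nat \<Rightarrow> real"
  proof -
    have "(\<Prod>i<d. if i = a then X i else if i = b then Y i else 1)
        = X a * (\<Prod>i\<in>{..<d} - {a}. if i = a then X i else if i = b then Y i else 1)"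
      using ab by (subst prod.remove[of _ a]) auto
    also have "(\<Prod>i\<in>{..<d} - {a}. if i = a then X i else if i = b then Y i else 1)
        = Y b * (\<Prod>i\<in>{..<d} - {a} - {b}. if i = a then X i else if i = b then Y i else 1)"
      using ab by (subst prod.remove[of _ b]) auto
    also have "(\<Prod>i\<in>{..<d} - {a} - {b}. if i = a then X i else if i = b then Y i else 1) = 1"
      by (intro prod.neutral) auto
    finally show ?thesis by simp
  qed
  let ?F = "\<lambda>i e. if i = a then f e else if i = b then g e else 1"
  have "(\<integral>w'. f (w' a) * g (w' b) \<partial>walkers_step d G w) = (\<integral>w'. (\<Prod>i<d. ?F i (w' i)) \<partial>walkers_step d G w)"
  proof -
    have "f (w' a) * g (w' b) = (\<Prod>i<d. ?F i (w' i))" for w'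
      using split[of "\<lambda>i. f (w' i)" "\<lambda>i. g (w' i)"] by simp
    then show ?thesis by simp
  qed
  also have "\<dots> = (\<Prod>i<d. \<integral>e. ?F i e \<partial>nbrw_step G (w i))"
    using fg by (intro walkers_expectation_prod[OF s]) auto
  also have "\<dots> = (\<Prod>i<d. if i = a then \<integral>e. f e \<partial>nbrw_step G (w i)
      else if i = b then \<integral>e. g e \<partial>nbrw_step G (w i) else 1)"
    by (intro prod.cong) auto
  finally show ?thesis unfolding split .
qed

text \<open>
  Two walkers are shifted forward in time together. The left-hand side is the mean probability that
  walker \<open>a\<close>, after \<open>r\<close> steps, is where walker \<open>b\<close> is now.
\<close>

lemma meeting_shift:
  assumes ab: "a < d" "b < d" "a \<noteq> b"
  shows "E (\<lambda>s. \<Sum>x<n. head_prob G r (snd s a) x * head_prob G 0 (snd s b) x)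
    = E (\<lambda>s. \<Sum>x<n. head_prob G (r + i) (snd s a) x * head_prob G i (snd s b) x)"
proof (induction i)
  case (Suc i)
  let ?g = "\<lambda>w. \<Sum>x<n. head_prob G (r + i) (w a) x * head_prob G i (w b) x"
  have bnd: "\<bar>?g w\<bar> \<le> (\<Sum>x<n. 1)" if "(q, w) \<in> S" for q w
    using walker_arc[OF that ab(1)] walker_arc[OF that ab(2)]
    by (intro order_trans[OF sum_abs] sum_mono) (auto simp: abs_mult head_prob_ge0 head_prob_le1 intro!: mult_le_one)
  from walkers_balance[where g = ?g, OF bnd]
  have "E (\<lambda>s. ?g (snd s)) = E (\<lambda>s. \<integral>w'. ?g w' \<partial>walkers_step d G (snd s))" by simp
  also have "\<dots> = E (\<lambda>s. \<Sum>x<n. head_prob G (r + Suc i) (snd s a) x * head_prob G (Suc i) (snd s b) x)"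
  proof (rule E_cong)
    fix s assume "s \<in> S"
    then have s: "(fst s, snd s) \<in> S" by simp
    have "(\<integral>w'. ?g w' \<partial>walkers_step d G (snd s))
        = (\<Sum>x<n. \<integral>w'. head_prob G (r + i) (w' a) x * head_prob G i (w' b) x \<partial>walkers_step d G (snd s))"
      by (rule Bochner_Integration.integral_sum) (rule walkers_integrable[OF s])
    moreover have "(\<integral>w'. head_prob G (r + i) (w' a) x * head_prob G i (w' b) x \<partial>walkers_step d G (snd s))
        = head_prob G (r + Suc i) (snd s a) x * head_prob G (Suc i) (snd s b) x" for x
      using walkers_expectation_two[OF s ab, of "\<lambda>e. head_prob G (r
          + i) e x" "\<lambda>e. head_prob G i e x"] head_prob_ge0 by simp
    ultimately show "(\<integral>w'. ?g w' \<partial>walkers_step d G (snd s))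
        = (\<Sum>x<n. head_prob G (r + Suc i) (snd s a) x * head_prob G (Suc i) (snd s b) x)" by simp
  qed
  finally show ?case using Suc by simp
qed simp

end

text \<open>
  The single small quantity \<open>\<eta>\<close> collects all that is needed of the graph: after \<open>m\<close> steps a walker
  is uniform up to a relative error \<open>\<eta>\<close>, and \<open>m\<close> is small enough for both \<open>m / n\<close> and the expected number of
  returns within \<open>m\<close> steps to be at most \<open>\<eta>\<close>.
\<close>

locale mixing_nbrw_pod = nbrw_pod +
  fixes m :: nat and \<eta> :: real
  assumes \<eta>: "0 \<le> \<eta>" "\<eta> \<le> 1"
    and mix: "e \<in> parcs G \<Longrightarrow> x < n \<Longrightarrow> \<bar>head_prob G m e x - 1 / real n\<bar> \<le> \<eta> / real n"
    and m_le: "real m \<le> \<eta> * real n"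
    and ret: "e \<in> parcs G \<Longrightarrow> (\<Sum>r<m. head_prob G (Suc r) e (snd e)) \<le> \<eta>"
begin

text \<open>
  Let both walkers make \<open>m\<close> steps first. Then walker \<open>b\<close> is nearly uniform, given the starting
  positions, independently of walker \<open>a\<close>.
\<close>

lemma meeting_probability:
  assumes ab: "a < d" "b < d" "a \<noteq> b"
  shows "E (\<lambda>s. head_prob G r (snd s a) (snd (snd s b))) \<le> 2 / real n"
proof -
  have arcs: "snd s a \<in> parcs G" "snd s b \<in> parcs G" if "s \<in> S" for s
    using walker_arc[of "fst s" "snd s"] that ab by auto
  have "E (\<lambda>s. head_prob G r (snd s a) (snd (snd s b)))
      = E (\<lambda>s. \<Sum>x<n. head_prob G r (snd s a) x * head_prob G 0 (snd s b) x)"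
  proof (rule E_cong)
    fix s assume "s \<in> S"
    then have "snd (snd s b) < n" using walker_vertex[of "fst s" "snd s"] ab by simp
    then show "head_prob G r (snd s a) (snd (snd s b))
        = (\<Sum>x<n. head_prob G r (snd s a) x * head_prob G 0 (snd s b) x)"
      by (simp add: of_bool_def if_distrib cong: if_cong)
  qed
  also have "\<dots> = E (\<lambda>s. \<Sum>x<n. head_prob G (r + m) (snd s a) x * head_prob G m (snd s b) x)"
    by (rule meeting_shift[OF ab])
  also have "\<dots> \<le> 2 / real n"
  proof (rule E_le_const)
    show "bdd (\<lambda>s. \<Sum>x<n. head_prob G (r + m) (snd s a) x * head_prob G m (snd s b) x)"
      using arcs head_prob_ge0 head_prob_le1 by (intro bdd_sum bdd_mult bddI[of _ 1]) auto
    fix s assume s: "s \<in> S"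
    have "(\<Sum>x<n. head_prob G (r + m) (snd s a) x * head_prob G m (snd s b) x)
        \<le> (\<Sum>x<n. head_prob G (r + m) (snd s a) x * (2 / n))"
    proof (intro sum_mono mult_left_mono)
      fix x assume "x \<in> {..<n}"
      then have "head_prob G m (snd s b) x \<le> 1 / n + \<eta> / n" using mix[OF arcs(2)[OF s], of x] by simp
      also have "\<dots> \<le> 2 / n" using \<eta> n by (simp add: field_simps)
      finally show "head_prob G m (snd s b) x \<le> 2 / n" .
    qed (use head_prob_ge0 arcs[OF s] in auto)
    also have "\<dots> = 2 / n" using head_prob_sum[OF reg k arcs(1)[OF s]]
        by (simp add: sum_distrib_right[symmetric] sum_divide_distrib[symmetric])
    finally show "(\<Sum>x<n. head_prob G (r + m) (snd s a) x * head_prob G m (snd s b) x) \<le> 2 / real n" .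
  qed
  finally show ?thesis .
qed

text \<open>
  The expected number of visits, within \<open>m\<close> steps, of all walkers to all places at which a walker is
  standing now. It bounds what an arriving job can change, wherever ties send it.
\<close>

definition visits :: "(nat \<Rightarrow> nat \<times> nat) \<Rightarrow> real" where
  "visits w = (\<Sum>a<d. \<Sum>b<d. \<Sum>r<m. head_prob G (Suc r) (w a) (snd (w b)))"

lemma bdd_head_prob: "a < d \<Longrightarrow> bdd (\<lambda>s. head_prob G r (snd s a) (f s))"
proof (rule bddI[of _ 1])
  fix s assume "a < d" "s \<in> S"
  then have "snd s a \<in> parcs G" using walker_arc[of "fst s" "snd s"] by auto
  then show "\<bar>head_prob G r (snd s a) (f s)\<bar> \<le> 1" using head_prob_ge0 head_prob_le1 by simp
qed

lemma bdd_visits: "bdd (\<lambda>s. visits (snd s))"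
  unfolding visits_def by (intro bdd_sum bdd_head_prob) auto

lemma visits_bound: "E (\<lambda>s. visits (snd s)) \<le> 3 * (real d)\<^sup>2 * \<eta>"
proof -
  have "E (\<lambda>s. visits (snd s)) = (\<Sum>a<d. \<Sum>b<d. E (\<lambda>s. \<Sum>r<m. head_prob G (Suc r) (snd s a) (snd (snd s b))))"
  proof -
    have "E (\<lambda>s. visits (snd s)) = (\<Sum>a<d. E (\<lambda>s. \<Sum>b<d. \<Sum>r<m. head_prob G (Suc r) (snd s a) (snd (snd s b))))"
      unfolding visits_def by (intro E_sum bdd_sum bdd_head_prob) auto
    also have "\<dots> = (\<Sum>a<d. \<Sum>b<d. E (\<lambda>s. \<Sum>r<m. head_prob G (Suc r) (snd s a) (snd (snd s b))))"
      by (intro sum.cong refl E_sum bdd_sum bdd_head_prob) auto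
    finally show ?thesis .
  qed
  also have "\<dots> \<le> (\<Sum>a<d. \<Sum>b<d. 3 * \<eta>)"
  proof (intro sum_mono)
    fix a b assume ab: "a \<in> {..<d}" "b \<in> {..<d}"
    show "E (\<lambda>s. \<Sum>r<m. head_prob G (Suc r) (snd s a) (snd (snd s b))) \<le> 3 * \<eta>"
    proof (cases "a = b")
      case True
      have "E (\<lambda>s. \<Sum>r<m. head_prob G (Suc r) (snd s a) (snd (snd s b))) \<le> \<eta>"
      proof (rule E_le_const)
        show "bdd (\<lambda>s. \<Sum>r<m. head_prob G (Suc r) (snd s a) (snd (snd s b)))" using ab
            by (intro bdd_sum bdd_head_prob) auto
        fix s assume "s \<in> S"
        then have "snd s a \<in> parcs G" using walker_arc[of "fst s" "snd s"] ab by auto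
        then show "(\<Sum>r<m. head_prob G (Suc r) (snd s a) (snd (snd s b))) \<le> \<eta>" using ret True by blast
      qed
      then show ?thesis using \<eta> by simp
    next
      case False
      have "E (\<lambda>s. \<Sum>r<m. head_prob G (Suc r) (snd s a) (snd (snd s b)))
          = (\<Sum>r<m. E (\<lambda>s. head_prob G (Suc r) (snd s a) (snd (snd s b))))"
        using ab by (intro E_sum bdd_head_prob) auto
      also have "\<dots> \<le> (\<Sum>r<m. 2 / n)" using ab False by (intro sum_mono meeting_probability) auto
      also have "\<dots> = 2 * (m / n)" by simp
      also have "m / n \<le> \<eta>" using m_le n by (simp add: field_simps)
      finally show ?thesis using \<eta> by simp
    qed
  qed
  also have "\<dots> = 3 * (real d)\<^sup>2 * \<eta>" by (simp add: power2_eq_square)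
  finally show ?thesis .
qed

lemma visits_ge:
  assumes s: "(q, w) \<in> S" and j: "j \<in> set_pmf (\<tau> (q, w))"
  shows "(\<Sum>r<m. \<Sum>a<d. head_prob G (Suc r) (w a) j) \<le> visits w"
    and "(\<Sum>r<m. head_prob G (Suc r) (w 0) j) \<le> visits w"
proof -
  obtain b where b: "b < d" "j = snd (w b)" using chosen[OF s j] by auto
  have pos: "0 \<le> head_prob G (Suc r) (w a) x" if "a < d" for a r x
      using head_prob_ge0[OF walker_arc[OF s that]] .
  have "(\<Sum>r<m. \<Sum>a<d. head_prob G (Suc r) (w a) j) = (\<Sum>a<d. \<Sum>r<m. head_prob G (Suc r) (w a) (snd (w b)))"
    unfolding b(2) by (rule sum.swap)
  also have "\<dots> \<le> visits w"
    unfolding visits_def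
    by (intro sum_mono member_le_sum[of b _ "\<lambda>b. \<Sum>r<m. head_prob G (Suc r) (w _) (snd (w b))"] sum_nonneg pos)
      (use b in auto)
  finally show 1: "(\<Sum>r<m. \<Sum>a<d. head_prob G (Suc r) (w a) j) \<le> visits w" .
  have "(\<Sum>r<m. head_prob G (Suc r) (w 0) j) \<le> (\<Sum>r<m. \<Sum>a<d. head_prob G (Suc r) (w a) j)"
    using d by (intro sum_mono member_le_sum[of 0 _ "\<lambda>a. head_prob G (Suc _) (w a) j"] pos) auto
  then show "(\<Sum>r<m. head_prob G (Suc r) (w 0) j) \<le> visits w" using 1 by simp
qed

end

section \<open>Decorrelation of walkers and queues\<close>

context nbrw_pod
begin

text \<open>
  \<open>\<Sum>\<^bsub>r<m\<^esub> H\<^sub>r\<close> is a truncated solution of the Poisson equation for the walkers with frozen queues: one step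
  of the walkers changes it by \<open>H\<^sub>m - H\<^sub>0\<close>. Balance for its product with \<open>F(q)\<close> expresses
  \<open>F(q) (H\<^sub>0 - H\<^sub>m)\<close> by the effect of the queue changes alone, at arrivals (\<open>A\<close>) and departures (\<open>D\<close>).
\<close>

lemma corrector:
  fixes H :: "nat \<Rightarrow> (nat \<Rightarrow> nat) \<Rightarrow> (nat \<Rightarrow> nat \<times> nat) \<Rightarrow> real" and m :: nat
  assumes F: "\<And>q w. (q, w) \<in> S \<Longrightarrow> \<bar>F q\<bar> \<le> B"
    and H: "\<And>r q w. (q, w) \<in> S \<Longrightarrow> \<bar>H r q w\<bar> \<le> C"
    and step: "\<And>r q w. (q, w) \<in> S \<Longrightarrow> (\<integral>w'. H r q w' \<partial>walkers_step d G w) = H (Suc r) q w"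
  defines "A \<equiv> \<lambda>s. \<integral>j. F ((fst s)(j := Suc (fst s j)))
      * (\<Sum>r<m. H (Suc r) ((fst s)(j := Suc (fst s j))) (snd s))
      - F (fst s) * (\<Sum>r<m. H (Suc r) (fst s) (snd s)) \<partial>\<tau> s"
    and "D \<equiv> \<lambda>s. \<Sum>j<n. F ((fst s)(j := fst s j - 1)) * (\<Sum>r<m. H r ((fst s)(j := fst s j - 1)) (snd s))
      - F (fst s) * (\<Sum>r<m. H r (fst s) (snd s))"
  shows "E (\<lambda>s. F (fst s) * (H 0 (fst s) (snd s) - H m (fst s) (snd s))) = E A + E D / (lam * n)"
    and "bdd A" and "bdd D"
proof -
  have bF: "bdd (\<lambda>s. F (fst s))" by (rule bddI[of _ B]) (metis F prod.collapse)
  have bH: "bdd (\<lambda>s. H r (fst s) (snd s))" for r by (rule bddI[of _ C]) (metis H prod.collapse)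
  define f where "f s = F (fst s) * (\<Sum>r<m. H r (fst s) (snd s))" for s
  have bf: "bdd f" unfolding f_def by (intro bdd_mult bF bdd_sum bH)
  define K where "K s = F (fst s) * (H 0 (fst s) (snd s) - H m (fst s) (snd s))" for s
  have bK: "bdd K" unfolding K_def by (intro bdd_mult bF bdd_diff bH)
  have arr: "measure_pmf.expectation (arrival d G \<tau> s) f - f s = A s - K s" if "s \<in> S" for s
  proof -
    obtain q w where qw: "s = (q, w)" by (cases s)
    have s: "(q, w) \<in> S" using that qw by simp
    let ?up = "\<lambda>j. q(j := Suc (q j))"
    have "measure_pmf.expectation (arrival d G \<tau> s) f
        = (\<integral>j. (\<integral>w'. F (?up j) * (\<Sum>r<m. H r (?up j) w') \<partial>walkers_step d G w) \<partial>\<tau> (q, w))"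
      unfolding qw arrival_expectation[OF bf s] by (simp add: f_def)
    also have "\<dots> = (\<integral>j. F (?up j) * (\<Sum>r<m. H (Suc r) (?up j) w) \<partial>\<tau> (q, w))"
    proof (rule integral_cong_AE)
      show "AE j in measure_pmf (\<tau> (q, w)). (\<integral>w'. F (?up j) * (\<Sum>r<m. H r (?up j) w') \<partial>walkers_step d G w)
          = F (?up j) * (\<Sum>r<m. H (Suc r) (?up j) w)"
        unfolding AE_measure_pmf_iff
      proof
        fix j assume "j \<in> set_pmf (\<tau> (q, w))"
        then have s': "(?up j, w) \<in> S" using queue_states[OF s] chosen[OF s] by blast
        have "(\<integral>w'. (\<Sum>r<m. H r (?up j) w') \<partial>walkers_step d G w) = (\<Sum>r<m. H (Suc r) (?up j) w)"
          using step[OF s'] by (subst Bochner_Integration.integral_sum) (auto intro: walkers_integrable[OF s])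
        then show "(\<integral>w'. F (?up j) * (\<Sum>r<m. H r (?up j) w') \<partial>walkers_step d G w)
          = F (?up j) * (\<Sum>r<m. H (Suc r) (?up j) w)" by simp
      qed
    qed auto
    also have "\<dots> = A s + F q * (\<Sum>r<m. H (Suc r) q w)"
      unfolding A_def qw using tau_integrable[OF s] by simp
    also have "\<dots> = A s - K s + f s"
    proof -
      have tele: "(\<Sum>r<m. H (Suc r) q w) = (\<Sum>r<m. H r q w) + H m q w - H 0 q w"
        by (induction m) auto
      show ?thesis unfolding K_def f_def qw fst_conv snd_conv tele by (simp add: algebra_simps)
    qed
    finally show ?thesis by simp
  qed
  have bAK: "bdd (\<lambda>s. A s - K s)"
    by (rule bdd_cong[OF bdd_diff[OF bdd_expectation[OF bf arrival_states] bf] arr])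
  show bA: "bdd A" using bdd_add[OF bAK bK] by simp
  have Deq: "D s = (\<Sum>j<n. f (departure j s) - f s)" for s
    by (simp add: D_def f_def departure_def split_beta)
  obtain Bf where Bf: "\<And>s. s \<in> S \<Longrightarrow> \<bar>f s\<bar> \<le> Bf" using bf by (auto simp: bdd_def)
  show bD: "bdd D" unfolding Deq
    by (intro bdd_sum bdd_diff bf bddI[of _ Bf] Bf departure_states) auto
  have "lam * E (\<lambda>s. A s - K s) + E D / n = 0"
    using balance[OF bf] E_cong[OF arr] unfolding Deq by simp
  then have "lam * (E A - E K) + E D / n = 0" using E_diff[OF bA bK] by simp
  then show "E (\<lambda>s. F (fst s) * (H 0 (fst s) (snd s) - H m (fst s) (snd s))) = E A + E D / (lam * n)"
    using lam n unfolding K_def[symmetric] by (simp add: field_simps)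
qed

end

text \<open>
  The mean of \<open>\<psi>\<close> of the queue length that a walker now on \<open>e\<close> finds after \<open>r\<close> steps, the queues
  being frozen.
\<close>

definition head_mean :: "nat pair_pre_digraph \<Rightarrow> nat \<Rightarrow> (nat \<Rightarrow> real) \<Rightarrow> nat \<Rightarrow> (nat \<Rightarrow> nat) \<Rightarrow> nat \<times> nat \<Rightarrow> real" where
  "head_mean G n \<psi> r q e = (\<Sum>x<n. head_prob G r e x * \<psi> (q x))"

context nbrw_pod
begin

lemma head_mean_step:
  assumes "e \<in> parcs G"
  shows "(\<integral>e'. head_mean G n \<psi> r q e' \<partial>nbrw_step G e) = head_mean G n \<psi> (Suc r) q e"
proof -
  have "finite (set_pmf (nbrw_step G e))"
    using nbrw_step_support[OF reg k assms] by (auto simp: nbrw_step_def split_beta)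
  then have "integrable (measure_pmf (nbrw_step G e)) f" for f :: "nat \<times> nat \<Rightarrow> real"
    by (rule integrable_measure_pmf_finite)
  then show ?thesis unfolding head_mean_def by (subst Bochner_Integration.integral_sum) auto
qed

lemma head_mean_bounds:
  assumes "e \<in> parcs G" "\<And>i. 0 \<le> \<psi> i" "\<And>i. \<psi> i \<le> C"
  shows "0 \<le> head_mean G n \<psi> r q e" "head_mean G n \<psi> r q e \<le> C"
proof -
  show "0 \<le> head_mean G n \<psi> r q e"
    unfolding head_mean_def using head_prob_ge0[OF assms(1)] assms(2) by (intro sum_nonneg mult_nonneg_nonneg)
  have "head_mean G n \<psi> r q e \<le> (\<Sum>x<n. head_prob G r e x * C)"
    unfolding head_mean_def using head_prob_ge0[OF assms(1)] assms(3) by (intro sum_mono mult_left_mono)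
  also have "\<dots> = C" using head_prob_sum[OF reg k assms(1)] by (simp add: sum_distrib_right[symmetric])
  finally show "head_mean G n \<psi> r q e \<le> C" .
qed

lemma head_mean_upd:
  assumes "j < n"
  shows "head_mean G n \<psi> r (q(j := x)) e - head_mean G n \<psi> r q e = head_prob G r e j * (\<psi> x - \<psi> (q j))"
proof -
  have "head_mean G n \<psi> r (q(j := x)) e - head_mean G n \<psi> r q e
      = (\<Sum>y<n. if y = j then head_prob G r e j * (\<psi> x - \<psi> (q j)) else 0)"
    unfolding head_mean_def sum_subtractf[symmetric] by (intro sum.cong) (auto simp: right_diff_distrib)
  then show ?thesis using assms by simp
qed

lemma head_mean_0: "snd e < n \<Longrightarrow> head_mean G n \<psi> 0 q e = \<psi> (q (snd e))"
  by (simp add: head_mean_def of_bool_def if_distribR if_distrib cong: if_cong)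

end

context mixing_nbrw_pod
begin

lemma head_mean_mixed:
  assumes "e \<in> parcs G" "\<And>i. 0 \<le> \<psi> i" "\<And>i. \<psi> i \<le> C"
  shows "\<bar>head_mean G n \<psi> m q e - (\<Sum>x<n. \<psi> (q x)) / real n\<bar> \<le> \<eta> * C"
    and "head_mean G n \<psi> m q e \<le> (1 + \<eta>) * ((\<Sum>x<n. \<psi> (q x)) / real n)"
proof -
  have "\<bar>head_mean G n \<psi> m q e - (\<Sum>x<n. \<psi> (q x)) / real n\<bar>
      = \<bar>\<Sum>x<n. (head_prob G m e x - 1 / real n) * \<psi> (q x)\<bar>"
    by (simp add: head_mean_def sum_subtractf left_diff_distrib sum_divide_distrib)
  also have "\<dots> \<le> (\<Sum>x<n. \<bar>head_prob G m e x - 1 / real n\<bar> * \<psi> (q x))"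
    by (rule order_trans[OF sum_abs]) (simp add: abs_mult assms(2))
  also have "\<dots> \<le> (\<Sum>x<n. (\<eta> / real n) * C)"
    using mix[OF assms(1)] assms(2,3) \<eta> by (intro sum_mono mult_mono) auto
  also have "\<dots> = \<eta> * C" using n by simp
  finally show "\<bar>head_mean G n \<psi> m q e - (\<Sum>x<n. \<psi> (q x)) / real n\<bar> \<le> \<eta> * C" .
  have "head_mean G n \<psi> m q e \<le> (\<Sum>x<n. ((1 + \<eta>) / real n) * \<psi> (q x))"
    unfolding head_mean_def
  proof (intro sum_mono mult_right_mono assms(2))
    fix x assume "x \<in> {..<n}"
    then show "head_prob G m e x \<le> (1 + \<eta>) / real n" using mix[OF assms(1), of x]
        by (auto simp: add_divide_distrib)
  qed
  also have "\<dots> = (1 + \<eta>) * ((\<Sum>x<n. \<psi> (q x)) / real n)" by (simp add: sum_distrib_left sum_divide_distrib)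
  finally show "head_mean G n \<psi> m q e \<le> (1 + \<eta>) * ((\<Sum>x<n. \<psi> (q x)) / real n)" .
qed

text \<open>
  The corrector for \<open>A\<^sub>i\<close> is a product over the walkers, as they move independently, and a
  product of numbers in \<open>[0, 1]\<close> changes by at most the sum of the changes of its factors. Arrivals cost
  at most the number of \<open>visits\<close>; departures, summed over all servers, cost \<open>m d\<close>, but they are divided by the
  arrival rate \<open>lam n\<close>.
\<close>

lemma decorrelation:
  assumes F: "\<And>q w. (q, w) \<in> S \<Longrightarrow> \<bar>F q\<bar> \<le> B" and BL: "0 \<le> B" "0 \<le> L"
    and lip: "\<And>q w j x. (q, w) \<in> S \<Longrightarrow> j < n \<Longrightarrow> x = Suc (q j) \<or> x = q j - 1 \<Longrightarrow> \<bar>F (q(j := x)) - F q\<bar> \<le> L / real n"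
  shows "\<bar>E (\<lambda>s. F (fst s) * (all_ge i s - X s i ^ d))\<bar> \<le> (B + L) * (4 * (real d)\<^sup>2 * (1 + 1 / lam)) * \<eta>"
proof -
  \<comment> \<open>\<open>H r q w\<close> is the probability that, with the queues frozen at \<open>q\<close>, all walkers see queues of length
    at least \<open>i\<close> after \<open>r\<close> steps from \<open>w\<close>\<close>
  define \<psi> :: "nat \<Rightarrow> real" where "\<psi> l = of_bool (i \<le> l)" for l :: nat
  have \<psi>: "0 \<le> \<psi> l" "\<psi> l \<le> 1" for l by (auto simp: \<psi>_def)
  define h where "h = head_mean G n \<psi>"
  define H where "H r q w = (\<Prod>a<d. h r q (w a))" for r q and w :: "nat \<Rightarrow> nat \<times> nat"
  have h01: "0 \<le> h r q e" "h r q e \<le> 1" if "e \<in> parcs G" for r q e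
    unfolding h_def using head_mean_bounds[OF that \<psi>] by auto
  have H01: "0 \<le> H r q w \<and> H r q w \<le> 1" if "(q', w) \<in> S" for r q q' w
    unfolding H_def using h01[OF walker_arc[OF that]] by (auto intro!: prod_nonneg prod_le_1)
  have Hstep: "(\<integral>w'. H r q w' \<partial>walkers_step d G w) = H (Suc r) q w" if "(q, w) \<in> S" for r q w
  proof -
    have "(\<integral>w'. H r q w' \<partial>walkers_step d G w) = (\<Prod>a<d. \<integral>e. h r q e \<partial>nbrw_step G (w a))"
      unfolding H_def by (rule walkers_expectation_prod[OF that]) (rule h01(1))
    also have "\<dots> = H (Suc r) q w"
      unfolding H_def h_def using head_mean_step[OF walker_arc[OF that]] by simp
    finally show ?thesis .
  qed
  have Hupd: "\<bar>H r (q(j := x)) w - H r q w\<bar>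
      \<le> (\<Sum>a<d. head_prob G r (w a) j)" if s: "(q, w) \<in> S" and j: "j < n" for r q w j x
  proof -
    have "\<bar>H r (q(j := x)) w - H r q w\<bar> \<le> (\<Sum>a<d. \<bar>h r (q(j := x)) (w a) - h r q (w a)\<bar>)"
      unfolding H_def real_norm_def[symmetric] using h01[OF walker_arc[OF s]] by (intro norm_prod_diff) auto
    also have "\<dots> \<le> (\<Sum>a<d. head_prob G r (w a) j)"
    proof (intro sum_mono)
      fix a assume "a \<in> {..<d}"
      then have e: "0 \<le> head_prob G r (w a) j" using head_prob_ge0[OF walker_arc[OF s]] by simp
      have "\<bar>\<psi> x - \<psi> (q j)\<bar> \<le> 1" by (auto simp: \<psi>_def)
      then have "head_prob G r (w a) j * \<bar>\<psi> x - \<psi> (q j)\<bar> \<le> head_prob G r (w a) j * 1" using e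
          by (rule mult_left_mono)
      then show "\<bar>h r (q(j := x)) (w a) - h r q (w a)\<bar> \<le> head_prob G r (w a) j"
        unfolding h_def head_mean_upd[OF j] using e by (simp add: abs_mult)
    qed
    finally show ?thesis .
  qed
  have H0: "H 0 (fst s) (snd s) = all_ge i s" if "s \<in> S" for s
  proof -
    have "snd (snd s a) < n" if "a < d" for a using walker_vertex[of "fst s" "snd s"] \<open>s \<in> S\<close> that by simp
    then have "H 0 (fst s) (snd s) = (\<Prod>a<d. of_bool (i \<le> fst s (snd (snd s a))))"
      unfolding H_def h_def by (simp add: head_mean_0 \<psi>_def)
    also have "\<dots> = all_ge i s" unfolding all_ge_def by (auto simp: prod_zero_iff intro!: prod.neutral)
    finally show ?thesis .
  qed
  have Hm: "\<bar>H m (fst s) (snd s) - X s i ^ d\<bar> \<le> d * \<eta>" if "s \<in> S" for s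
  proof -
    have s: "(fst s, snd s) \<in> S" using that by simp
    have "\<bar>H m (fst s) (snd s) - X s i ^ d\<bar> = \<bar>(\<Prod>a<d. h m (fst s) (snd s a)) - (\<Prod>a<d. X s i)\<bar>"
      by (simp add: H_def)
    also have "\<dots> \<le> (\<Sum>a<d. \<bar>h m (fst s) (snd s a) - X s i\<bar>)"
      unfolding real_norm_def[symmetric] using h01[OF walker_arc[OF s]] queue_proportion_range
      by (intro norm_prod_diff) auto
    also have "\<dots> \<le> (\<Sum>a<d. \<eta>)"
      using head_mean_mixed(1)[where \<psi> = \<psi> and C = 1, OF walker_arc[OF s] \<psi>]
      by (intro sum_mono) (simp add: h_def queue_proportion_sum \<psi>_def)
    finally show ?thesis by simp
  qed
  define AA where "AA = (\<lambda>s. \<integral>j. F ((fst s)(j := Suc (fst s j)))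
      * (\<Sum>r<m. H (Suc r) ((fst s)(j := Suc (fst s j))) (snd s))
      - F (fst s) * (\<Sum>r<m. H (Suc r) (fst s) (snd s)) \<partial>\<tau> s)"
  define DD where "DD = (\<lambda>s. \<Sum>j<n. F ((fst s)(j := fst s j - 1))
      * (\<Sum>r<m. H r ((fst s)(j := fst s j - 1)) (snd s))
      - F (fst s) * (\<Sum>r<m. H r (fst s) (snd s)))"
  have corr: "E (\<lambda>s. F (fst s) * (H 0 (fst s) (snd s) - H m (fst s) (snd s))) = E AA + E DD / (lam * n)"
    "bdd AA" "bdd DD"
    unfolding AA_def DD_def using H01 Hstep
    by (intro corrector[where B = B and C = 1] F; fastforce)+
  have prod_diff: "\<bar>x' * y' - x * y\<bar> \<le> \<bar>x' - x\<bar> * \<bar>y'\<bar> + \<bar>x\<bar> * \<bar>y' - y\<bar>" for x x' y y' :: real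
  proof -
    have "x' * y' - x * y = (x' - x) * y' + x * (y' - y)" by (simp add: algebra_simps)
    then show ?thesis by (metis abs_mult abs_triangle_ineq)
  qed
  have sumH: "\<bar>\<Sum>r<m. H (f r) q w\<bar> \<le> real m" if "(q', w) \<in> S" for f q q' w
  proof -
    have "\<bar>\<Sum>r<m. H (f r) q w\<bar> \<le> (\<Sum>r<m. 1)"
      using H01[OF that] by (intro order_trans[OF sum_abs] sum_mono) simp
    then show ?thesis by simp
  qed
  have change: "\<bar>F (q(j := x)) * (\<Sum>r<m. H (f r) (q(j := x)) w) - F q * (\<Sum>r<m. H (f r) q w)\<bar>
      \<le> (L / n) * m + B * (\<Sum>r<m. \<Sum>a<d. head_prob G (f r) (w a) j)"
    if s: "(q, w) \<in> S" and j: "j < n" "x = Suc (q j) \<or> x = q j - 1" for q w j x f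
  proof (rule order_trans[OF prod_diff], intro add_mono mult_mono)
    show "\<bar>F (q(j := x)) - F q\<bar> \<le> L / n" by (rule lip[OF s j])
    show "\<bar>F q\<bar> \<le> B" by (rule F[OF s])
    show "\<bar>\<Sum>r<m. H (f r) (q(j := x)) w\<bar> \<le> m" by (rule sumH[OF s])
    show "\<bar>(\<Sum>r<m. H (f r) (q(j := x)) w) - (\<Sum>r<m. H (f r) q w)\<bar> \<le> (\<Sum>r<m. \<Sum>a<d. head_prob G (f r) (w a) j)"
      unfolding sum_subtractf[symmetric] using Hupd[OF s j(1)] by (intro order_trans[OF sum_abs] sum_mono)
  qed (use BL in auto)
  have mn: "real m / n \<le> \<eta>" using m_le n by (simp add: field_simps)
  have A: "\<bar>E AA\<bar> \<le> L * \<eta> + B * (3 * (real d)\<^sup>2 * \<eta>)"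
  proof -
    have "\<bar>E AA\<bar> \<le> E (\<lambda>s. (L / n) * m + B * visits (snd s))"
    proof (rule E_abs_le[OF corr(2)])
      show "bdd (\<lambda>s. (L / n) * m + B * visits (snd s))" using bdd_visits by (intro bdd_add bdd_mult bdd_const)
      fix s assume "s \<in> S"
      then have s: "(fst s, snd s) \<in> S" by simp
      define v where "v j = F ((fst s)(j := Suc (fst s j)))
          * (\<Sum>r<m. H (Suc r) ((fst s)(j := Suc (fst s j))) (snd s))
        - F (fst s) * (\<Sum>r<m. H (Suc r) (fst s) (snd s))" for j
      have i: "integrable (measure_pmf (\<tau> s)) f" for f :: "nat \<Rightarrow> real" using tau_integrable[OF s] by simp
      have vb: "\<bar>v j\<bar> \<le> (L / n) * m + B * visits (snd s)" if "j \<in> set_pmf (\<tau> s)" for j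
      proof -
        have j: "j \<in> set_pmf (\<tau> (fst s, snd s))" "j < n" using that chosen[OF s] by auto
        have "\<bar>v j\<bar> \<le> (L / n) * m + B * (\<Sum>r<m. \<Sum>a<d. head_prob G (Suc r) (snd s a) j)"
          unfolding v_def using change[OF s j(2), of _ Suc] by simp
        also have "\<dots> \<le> (L / n) * m + B * visits (snd s)"
          using visits_ge(1)[OF s j(1)] BL by (intro add_left_mono mult_left_mono) auto
        finally show ?thesis .
      qed
      have "\<bar>AA s\<bar> \<le> (\<integral>j. \<bar>v j\<bar> \<partial>\<tau> s)" unfolding AA_def v_def by (rule integral_abs_bound)
      also have "\<dots> \<le> (L / n) * m + B * visits (snd s)"
        using vb i by (intro measure_pmf.integral_le_const) (auto simp: AE_measure_pmf_iff)
      finally show "\<bar>AA s\<bar> \<le> (L / n) * m + B * visits (snd s)" .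
    qed
    also have "\<dots> = L * (m / n) + B * E (\<lambda>s. visits (snd s))"
      using bdd_visits by (subst E_add) (auto intro: bdd_mult)
    also have "\<dots> \<le> L * \<eta> + B * (3 * (real d)\<^sup>2 * \<eta>)"
      using mn visits_bound BL by (intro add_mono mult_left_mono) auto
    finally show ?thesis .
  qed
  have D: "\<bar>E DD\<bar> \<le> n * ((L + B * d) * \<eta>)"
  proof -
    have "\<bar>E DD\<bar> \<le> E (\<lambda>_. n * ((L + B * d) * \<eta>))"
    proof (rule E_abs_le[OF corr(3) bdd_const])
      fix s assume "s \<in> S"
      then have s: "(fst s, snd s) \<in> S" by simp
      have "\<bar>DD s\<bar> \<le> (\<Sum>j<n. (L / n) * m + B * (\<Sum>r<m. \<Sum>a<d. head_prob G r (snd s a) j))"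
        unfolding DD_def using change[OF s, of _ _ "\<lambda>r. r"]
        by (intro order_trans[OF sum_abs] sum_mono) auto
      also have "\<dots> = L * m + B * (\<Sum>r<m. \<Sum>a<d. \<Sum>j<n. head_prob G r (snd s a) j)"
      proof -
        have "(\<Sum>j<n. \<Sum>r<m. \<Sum>a<d. head_prob G r (snd s a) j) = (\<Sum>r<m. \<Sum>a<d. \<Sum>j<n. head_prob G r (snd s a) j)"
          by (subst sum.swap, rule sum.cong[OF refl], rule sum.swap)
        then show ?thesis using n by (simp add: sum.distrib sum_distrib_left[symmetric])
      qed
      also have "(\<Sum>r<m. \<Sum>a<d. \<Sum>j<n. head_prob G r (snd s a) j) = m * d"
        using head_prob_sum[OF reg k walker_arc[OF s]] by simp
      also have "L * m + B * (m * d) = m * (L + B * d)" by (simp add: algebra_simps)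
      also have "\<dots> \<le> (\<eta> * n) * (L + B * d)" using m_le BL by (intro mult_right_mono) auto
      finally show "\<bar>DD s\<bar> \<le> n * ((L + B * d) * \<eta>)" by (simp add: mult_ac)
    qed
    then show ?thesis by simp
  qed
  have bF: "bdd (\<lambda>s. F (fst s))" by (rule bddI[of _ B]) (metis F prod.collapse)
  have bH: "bdd (\<lambda>s. H m (fst s) (snd s))" by (rule bddI[of _ 1]) (use H01 in \<open>metis abs_of_nonneg prod.collapse\<close>)
  have bA: "bdd (all_ge i)" unfolding all_ge_def by auto
  have bX: "bdd (\<lambda>s. X s i)" by (rule bddI[of _ 1]) (use queue_proportion_range in auto)
  have "E (\<lambda>s. F (fst s) * (all_ge i s - X s i ^ d))
      = E (\<lambda>s. F (fst s) * (all_ge i s - H m (fst s) (snd s)))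
          + E (\<lambda>s. F (fst s) * (H m (fst s) (snd s) - X s i ^ d))"
    using bF bH bA bX by (subst E_add[symmetric]) (auto simp: algebra_simps intro!: bdd_mult bdd_diff bdd_power)
  also have "E (\<lambda>s. F (fst s) * (all_ge i s - H m (fst s) (snd s))) = E AA + E DD / (lam * n)"
    unfolding corr(1)[symmetric] using H0 by (intro E_cong) simp
  finally have "\<bar>E (\<lambda>s. F (fst s) * (all_ge i s - X s i ^ d))\<bar>
      \<le> \<bar>E AA\<bar> + \<bar>E DD\<bar> / (lam * n) + \<bar>E (\<lambda>s. F (fst s) * (H m (fst s) (snd s) - X s i ^ d))\<bar>"
    using lam by (simp add: abs_divide[symmetric] abs_mult order_trans[OF abs_triangle_ineq])
  also have "\<bar>E (\<lambda>s. F (fst s) * (H m (fst s) (snd s) - X s i ^ d))\<bar> \<le> E (\<lambda>_. B * (d * \<eta>))"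
  proof (rule E_abs_le)
    fix s assume s: "s \<in> S"
    have "\<bar>F (fst s)\<bar> \<le> B" using F[of "fst s" "snd s"] s by simp
    then show "\<bar>F (fst s) * (H m (fst s) (snd s) - X s i ^ d)\<bar> \<le> B * (d * \<eta>)"
      unfolding abs_mult using Hm[OF s] BL by (intro mult_mono) auto
  qed (use bF bH bX in \<open>auto intro!: bdd_mult bdd_diff bdd_power\<close>)
  finally have "\<bar>E (\<lambda>s. F (fst s) * (all_ge i s - X s i ^ d))\<bar>
      \<le> \<bar>E AA\<bar> + \<bar>E DD\<bar> / (lam * n) + B * (d * \<eta>)" by simp
  also have "\<dots> \<le> (L * \<eta> + B * (3 * (real d)\<^sup>2 * \<eta>)) + (L + B * d) * \<eta> / lam + B * (d * \<eta>)"
  proof (intro add_mono A order_refl)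
    show "\<bar>E DD\<bar> / (lam * n) \<le> (L + B * d) * \<eta> / lam" using D lam n by (simp add: field_simps)
  qed
  also have "\<dots> \<le> (B + L) * (4 * (real d)\<^sup>2 * (1 + 1 / lam)) * \<eta>"
  proof -
    have d1: "1 \<le> real d" "real d \<le> (real d)\<^sup>2" "1 \<le> (real d)\<^sup>2"
    proof -
      show 1: "1 \<le> real d" using d by simp
      then show 2: "real d \<le> (real d)\<^sup>2" using mult_right_mono[OF 1, of "real d"]
          by (simp add: power2_eq_square)
      show "1 \<le> (real d)\<^sup>2" using 1 2 by simp
    qed
    have "L * (1 + 1 / lam) + B * (3 * (real d)\<^sup>2 + d + d / lam) \<le> (B + L) * (4 * (real d)\<^sup>2 * (1 + 1 / lam))"
    proof -
      have "L * (1 + 1 / lam) \<le> L * (4 * (real d)\<^sup>2 * (1 + 1 / lam))"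
      proof (rule mult_left_mono[OF _ BL(2)])
        have "1 \<le> 4 * (real d)\<^sup>2" using d1(3) by linarith
        then have "1 * (1 + 1 / lam) \<le> 4 * (real d)\<^sup>2 * (1 + 1 / lam)"
          using lam by (intro mult_right_mono add_nonneg_nonneg) auto
        then show "1 + 1 / lam \<le> 4 * (real d)\<^sup>2 * (1 + 1 / lam)" by simp
      qed
      moreover have "3 * (real d)\<^sup>2 + d + d / lam \<le> 4 * (real d)\<^sup>2 * (1 + 1 / lam)"
      proof -
        have "d / lam \<le> 4 * (real d)\<^sup>2 / lam" by (rule divide_right_mono) (use d1 lam in linarith)+
        moreover have "4 * (real d)\<^sup>2 * (1 + 1 / lam) = 4 * (real d)\<^sup>2 + 4 * (real d)\<^sup>2 / lam"
          by (simp add: distrib_left)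
        ultimately show ?thesis using d1 by linarith
      qed
      then have "B * (3 * (real d)\<^sup>2 + d + d / lam) \<le> B * (4 * (real d)\<^sup>2 * (1 + 1 / lam))"
        using BL by (intro mult_left_mono)
      ultimately show ?thesis by (simp add: distrib_right)
    qed
    from mult_right_mono[OF this \<eta>(1)] show ?thesis by (simp add: algebra_simps add_divide_distrib)
  qed
  finally show ?thesis .
qed

text \<open>
  The estimate is uniform in the bound \<open>B\<close>, as tail bounds require: a job changes \<open>\<phi>\<close> by
  at most 1, the mixing error is relative, and departures can be discarded because \<open>\<phi>\<close> is nondecreasing.
\<close>

lemma walker_sees_average:
  assumes \<phi>: "\<And>l. 0 \<le> \<phi> l" "\<And>l. \<phi> l \<le> B" "\<And>l. \<phi> l \<le> \<phi> (Suc l)" "\<And>l. \<phi> (Suc l) \<le> \<phi> l + 1"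
  shows "E (\<lambda>s. \<phi> (fst s (snd (snd s 0))))
      \<le> (1 + \<eta>) * E (\<lambda>s. (\<Sum>x<n. \<phi> (fst s x)) / real n) + 3 * (real d)\<^sup>2 * \<eta>"
proof -
  have d0: "0 < d" using d by simp
  define H where "H r q w = head_mean G n \<phi> r q (w 0)" for r q and w :: "nat \<Rightarrow> nat \<times> nat"
  have Hb: "0 \<le> H r q w" "H r q w \<le> B" if "(q', w) \<in> S" for r q q' w
    unfolding H_def using head_mean_bounds[OF walker_arc[OF that d0] \<phi>(1,2)] by auto
  have Hstep: "(\<integral>w'. H r q w' \<partial>walkers_step d G w) = H (Suc r) q w" if "(q, w) \<in> S" for r q w
    unfolding H_def walkers_expectation_one[OF d0] head_mean_step[OF walker_arc[OF that d0]] ..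
  define AA where "AA = (\<lambda>s. \<integral>j. 1 * (\<Sum>r<m. H (Suc r) ((fst s)(j := Suc (fst s j))) (snd s))
      - 1 * (\<Sum>r<m. H (Suc r) (fst s) (snd s)) \<partial>\<tau> s)"
  define DD where "DD = (\<lambda>s. \<Sum>j<n. 1 * (\<Sum>r<m. H r ((fst s)(j := fst s j - 1)) (snd s))
      - 1 * (\<Sum>r<m. H r (fst s) (snd s)))"
  have corr: "E (\<lambda>s. 1 * (H 0 (fst s) (snd s) - H m (fst s) (snd s))) = E AA + E DD / (lam * n)"
    "bdd AA" "bdd DD"
    unfolding AA_def DD_def using Hb Hstep
    by (intro corrector[where B = 1 and C = B and F = "\<lambda>_. 1"]; simp)+
  have A: "E AA \<le> 3 * (real d)\<^sup>2 * \<eta>"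
  proof (rule order_trans[OF E_mono[OF corr(2) bdd_visits] visits_bound])
    fix s assume "s \<in> S"
    then have s: "(fst s, snd s) \<in> S" by simp
    have i: "integrable (measure_pmf (\<tau> s)) f" for f :: "nat \<Rightarrow> real" using tau_integrable[OF s] by simp
    have "(\<Sum>r<m. H (Suc r) ((fst s)(j := Suc (fst s j))) (snd s)) - (\<Sum>r<m. H (Suc r) (fst s) (snd s))
        \<le> visits (snd s)"
      if "j \<in> set_pmf (\<tau> s)" for j
    proof -
      have j: "j \<in> set_pmf (\<tau> (fst s, snd s))" "j < n" using that chosen[OF s] by auto
      have "(\<Sum>r<m. H (Suc r) ((fst s)(j := Suc (fst s j))) (snd s)) - (\<Sum>r<m. H (Suc r) (fst s) (snd s))
          = (\<Sum>r<m. head_prob G (Suc r) (snd s 0) j * (\<phi> (Suc (fst s j)) - \<phi> (fst s j)))"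
        unfolding sum_subtractf[symmetric] H_def head_mean_upd[OF j(2)] ..
      also have "\<dots> \<le> (\<Sum>r<m. head_prob G (Suc r) (snd s 0) j)"
        using head_prob_ge0[OF walker_arc[OF s d0]] \<phi>(4)[of "fst s j"] by (intro sum_mono mult_right_le_one_le) (use \<phi>(3) in \<open>auto simp del: head_prob.simps\<close>)
      also have "\<dots> \<le> visits (snd s)" by (rule visits_ge(2)[OF s j(1)])
      finally show ?thesis .
    qed
    then show "AA s \<le> visits (snd s)"
      unfolding AA_def using i by (intro measure_pmf.integral_le_const) (auto simp: AE_measure_pmf_iff)
  qed
  have D: "E DD \<le> 0"
  proof (rule E_le_const[OF corr(3)])
    fix s assume "s \<in> S"
    then have s: "(fst s, snd s) \<in> S" by simp
    have mono: "\<phi> (l - 1) \<le> \<phi> l" for l using \<phi>(3) by (cases l) auto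
    have "H r ((fst s)(j := fst s j - 1)) (snd s) - H r (fst s) (snd s) \<le> 0" if "j < n" for j r
      unfolding H_def head_mean_upd[OF that]
      using head_prob_ge0[OF walker_arc[OF s d0]] mono[of "fst s j"] by (simp add: mult_nonneg_nonpos)
    then show "DD s \<le> 0" unfolding DD_def by (auto intro!: sum_nonpos sum_mono)
  qed
  have b0: "bdd (\<lambda>s. H r (fst s) (snd s))" for r
    by (rule bddI[of _ B]) (use Hb in \<open>metis abs_of_nonneg prod.collapse\<close>)
  have ba: "bdd (\<lambda>s. (\<Sum>x<n. \<phi> (fst s x)) / real n)"
    by (intro bdd_divide bdd_sum bddI[of _ B]) (use \<phi> in auto)
  have "E (\<lambda>s. \<phi> (fst s (snd (snd s 0)))) = E (\<lambda>s. H 0 (fst s) (snd s))"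
    unfolding H_def using walker_vertex[OF _ d0] by (intro E_cong) (auto simp: head_mean_0)
  also have "\<dots> = E AA + E DD / (lam * n) + E (\<lambda>s. H m (fst s) (snd s))"
    using corr(1) E_diff[OF b0 b0] by simp
  also have "\<dots> \<le> 3 * (real d)\<^sup>2 * \<eta> + 0 + E (\<lambda>s. (1 + \<eta>) * ((\<Sum>x<n. \<phi> (fst s x)) / real n))"
  proof (intro add_mono A E_mono b0 bdd_mult bdd_const ba)
    show "E DD / (lam * n) \<le> 0" using D lam n by (simp add: divide_nonpos_pos)
    fix s assume "s \<in> S"
    then show "H m (fst s) (snd s) \<le> (1 + \<eta>) * ((\<Sum>x<n. \<phi> (fst s x)) / real n)"
      unfolding H_def using head_mean_mixed(2)[OF walker_arc[of "fst s" "snd s", OF _ d0] \<phi>(1,2)] by simp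
  qed
  finally show ?thesis by simp
qed

end

section \<open>Fluid equations and tails\<close>

context nbrw_pod
begin

lemma bdd_X: "bdd (\<lambda>s. X s i)"
  by (rule bddI[of _ 1]) (use queue_proportion_range in auto)

lemma bdd_all_ge: "bdd (all_ge i)"
  unfolding all_ge_def by auto

text \<open>
  In stationarity the flow into queues of length above \<open>i\<close> equals the flow out. Balance for \<open>X\<^sub>i\<^sub>+\<^sub>1\<close>
  only says that the difference of the flows does not depend on \<open>i\<close>; it tends to zero since all queues
  are finite.
\<close>

lemma tail_flow: "E (\<lambda>s. X s (Suc i)) = lam * E (all_ge i)"
proof -
  have one: "lam * E (all_ge i) - E (\<lambda>s. X s (Suc i))
      = lam * E (all_ge (Suc i)) - E (\<lambda>s. X s (Suc (Suc i)))" for i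
  proof -
    have "\<bar>E (\<lambda>s. \<Sum>j=1..Suc i. of_bool (j
        = Suc i) * (lam * (all_ge (j - 1) s - all_ge j s) - (X s j - X s (j + 1))))\<bar>
        \<le> 0 * (lam + 1) / real n"
      by (rule rate_balance[where F = "\<lambda>x. x (Suc i)" and B = 1 and Bg = 1]) auto
    moreover have "(\<Sum>j=1..Suc i. of_bool (j
        = Suc i) * (lam * (all_ge (j - 1) s - all_ge j s) - (X s j - X s (j + 1))))
        = lam * (all_ge i s - all_ge (Suc i) s) - (X s (Suc i) - X s (Suc (Suc i)))" for s
      by (simp add: of_bool_def if_distribR if_distrib cong: if_cong)
    ultimately have "E (\<lambda>s. lam * (all_ge i s - all_ge (Suc i) s) - (X s (Suc i) - X s (Suc (Suc i))))
        = 0" by simp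
    moreover have "E (\<lambda>s. lam * (all_ge i s - all_ge (Suc i) s) - (X s (Suc i) - X s (Suc (Suc i))))
        = lam * (E (all_ge i) - E (all_ge (Suc i))) - (E (\<lambda>s. X s (Suc i)) - E (\<lambda>s. X s (Suc (Suc i))))"
      using bdd_X bdd_all_ge by (simp add: E_diff bdd_mult bdd_diff bdd_const)
    ultimately show ?thesis by (simp add: algebra_simps)
  qed
  have const: "lam * E (all_ge i) - E (\<lambda>s. X s (Suc i))
      = lam * E (all_ge (i + r)) - E (\<lambda>s. X s (Suc (i + r)))" for r
    by (induction r) (use one in auto)
  have lim: "(\<lambda>r. E (\<lambda>s. f s (i + r))) \<longlonglongrightarrow> 0"
    if f: "\<And>s r. \<bar>f s r\<bar> \<le> 1" "\<And>s r. s \<in> S \<Longrightarrow> (\<Sum>x<n. fst s x) < r \<Longrightarrow> f s r = 0" for f :: "state \<Rightarrow> nat \<Rightarrow> real"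
  proof -
    have "(\<lambda>r. E (\<lambda>s. f s (i + r))) \<longlonglongrightarrow> E (\<lambda>_. 0)"
    proof (rule integral_dominated_convergence[where w = "\<lambda>_. 1"])
      show "AE s in measure_pmf p. (\<lambda>r. f s (i + r)) \<longlonglongrightarrow> 0"
        unfolding AE_measure_pmf_iff
      proof
        fix s assume "s \<in> set_pmf p"
        then have s: "s \<in> S" using p_states by blast
        have "eventually (\<lambda>r. f s (i + r) = 0) sequentially"
          using eventually_gt_at_top[of "\<Sum>x<n. fst s x"] by eventually_elim (use f(2)[OF s] in simp)
        then show "(\<lambda>r. f s (i + r)) \<longlonglongrightarrow> 0" by (rule tendsto_eventually)
      qed
    qed (use f in auto)
    then show ?thesis by simp
  qed
  have le: "fst s x \<le> (\<Sum>x<n. fst s x)" if "x < n" for s :: state and x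
    using that by (intro member_le_sum) auto
  have "(\<lambda>r. E (\<lambda>s. X s (Suc (i + r)))) \<longlonglongrightarrow> 0"
  proof (rule lim[of "\<lambda>s r. X s (Suc r)"])
    fix s :: state and r :: nat assume "(\<Sum>x<n. fst s x) < r"
    then have "fst s x < Suc r" if "x < n" for x using le[OF that, of s] by simp
    then show "X s (Suc r) = 0" by (auto simp: queue_proportion_sum intro!: sum.neutral dest: leD)
  qed (use queue_proportion_range in auto)
  moreover have "(\<lambda>r. E (\<lambda>s. all_ge (i + r) s)) \<longlonglongrightarrow> 0"
  proof (rule lim[of "\<lambda>s r. all_ge r s"])
    fix s :: state and r :: nat assume s: "s \<in> S" "(\<Sum>x<n. fst s x) < r"
    then have "fst s (snd (snd s 0)) < r"
      using le[of "snd (snd s 0)" s] walker_vertex[of "fst s" "snd s" 0] d by simp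
    then show "all_ge r s = 0" using d by (auto simp: all_ge_def intro!: exI[of _ 0])
  qed (auto simp: all_ge_def)
  ultimately have "(\<lambda>r. lam * E (all_ge (i + r)) - E (\<lambda>s. X s (Suc (i + r)))) \<longlonglongrightarrow> lam * 0 - 0"
    by (intro tendsto_intros)
  then have "lam * E (all_ge i) - E (\<lambda>s. X s (Suc i)) = 0"
    unfolding const[symmetric] by (simp add: LIMSEQ_const_iff)
  then show ?thesis by simp
qed

end

context mixing_nbrw_pod
begin

text \<open>
  Combines the balance of rates with the decorrelation of walkers and queues: \<open>g\<^sub>i(X)\<close> is a function
  of the queues that changes by at most \<open>L / n\<close> when one job is added or removed.
\<close>

lemma fluid_balance:
  fixes F :: "(nat \<Rightarrow> real) \<Rightarrow> real" and g :: "nat \<Rightarrow> (nat \<Rightarrow> real) \<Rightarrow> real"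
  assumes F: "\<And>x. (\<And>i. x i \<in> {0..1}) \<Longrightarrow> \<bar>F x\<bar> \<le> B"
    and g: "\<And>x i. (\<And>i. x i \<in> {0..1}) \<Longrightarrow> \<bar>g i x\<bar> \<le> Bg"
    and grad: "\<And>x i y. (\<And>i. x i \<in> {0..1}) \<Longrightarrow> y \<in> {0..1} \<Longrightarrow> 1 \<le> i \<Longrightarrow> i \<le> M \<Longrightarrow>
      \<bar>F (x(i := y)) - F x - (y - x i) * g i x\<bar> \<le> C * (y - x i)\<^sup>2"
    and cyl: "\<And>x i y. M < i \<Longrightarrow> F (x(i := y)) = F x"
    and lip: "\<And>x i l y. (\<And>i. x i \<in> {0..1}) \<Longrightarrow> y \<in> {0..1} \<Longrightarrow> \<bar>g i (x(l := y)) - g i x\<bar> \<le> L * \<bar>y - x l\<bar>"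
    and C: "0 \<le> C" and L: "0 \<le> L"
  shows "\<bar>E (\<lambda>s. \<Sum>i=1..M. g i (X s) * drift lam d (X s) i)\<bar>
    \<le> C * (lam + 1) / real n + 2 * lam * real M * ((Bg + L) * (4 * (real d)\<^sup>2 * (1 + 1 / lam)) * \<eta>)"
proof -
  have Xr: "queue_proportion n q i \<in> {0..1}" for q i using queue_proportion_range by auto
  have Bg: "0 \<le> Bg" using g[of "\<lambda>_. 0" 0] by (simp add: order_trans[OF abs_ge_zero])
  have bg: "bdd (\<lambda>s. g i (X s))" for i by (rule bddI[of _ Bg]) (rule g[OF Xr])
  define \<epsilon> where "\<epsilon> = (Bg + L) * (4 * (real d)\<^sup>2 * (1 + 1 / lam)) * \<eta>"
  have dec: "\<bar>E (\<lambda>s. g i (X s) * (all_ge l s - X s l ^ d))\<bar> \<le> \<epsilon>" for i l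
    unfolding \<epsilon>_def
  proof (rule decorrelation[where F = "\<lambda>q. g i (queue_proportion n q)", OF _ Bg L])
    show "\<bar>g i (queue_proportion n q)\<bar> \<le> Bg" for q by (rule g[OF Xr])
    fix q w j x assume s: "(q, w) \<in> S" and j: "j < n" and x: "x = Suc (q j) \<or> x = q j - 1"
    show "\<bar>g i (queue_proportion n (q(j := x))) - g i (queue_proportion n q)\<bar> \<le> L / real n"
    proof (cases "x = Suc (q j)")
      case True
      let ?y = "queue_proportion n q (Suc (q j)) + 1 / real n"
      have eq: "queue_proportion n (q(j := x)) = (queue_proportion n q)(Suc (q j) := ?y)"
        unfolding True by (rule queue_proportion_Suc[OF j])
      have "?y \<in> {0..1}" using Xr[of "q(j := x)" "Suc (q j)"] unfolding eq by simp
      from lip[where x = "queue_proportion n q" and i = i and l = "Suc (q j)", OF Xr this] show ?thesis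
          unfolding eq by simp
    next
      case False
      then have x: "x = q j - 1" using x by simp
      show ?thesis
      proof (cases "q j = 0")
        case True
        then have "q(j := x) = q" using x by auto
        then show ?thesis using L by simp
      next
        case False
        let ?y = "queue_proportion n q (q j) - 1 / real n"
        have eq: "queue_proportion n (q(j := x)) = (queue_proportion n q)(q j := ?y)"
          unfolding x by (rule queue_proportion_pred[OF j]) (use False in simp)
        have "?y \<in> {0..1}" using Xr[of "q(j := x)" "q j"] unfolding eq by simp
        from lip[where x = "queue_proportion n q" and i = i and l = "q j", OF Xr this] show ?thesis
            unfolding eq by simp
      qed
    qed
  qed
  define T where "T s = (\<Sum>i=1..M. g i (X s) * (lam * (all_ge (i - 1) s - all_ge i s) - (X s i - X s (i
      + 1))))" for s
  define R where "R i s
      = g i (X s) * (all_ge (i - 1) s - X s (i - 1) ^ d) - g i (X s) * (all_ge i s - X s i ^ d)" for i s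
  have bT: "bdd T" unfolding T_def by (intro bdd_sum bdd_mult bdd_diff bg bdd_const bdd_all_ge bdd_X)
  have bR: "bdd (R i)" for i unfolding R_def by (intro bdd_mult bdd_diff bg bdd_all_ge bdd_X bdd_power)
  have bS: "bdd (\<lambda>s. \<Sum>i=1..M. R i s)" by (intro bdd_sum bR)
  have "E (\<lambda>s. \<Sum>i=1..M. g i (X s) * drift lam d (X s) i) = E (\<lambda>s. T s - lam * (\<Sum>i=1..M. R i s))"
    unfolding T_def R_def sum_distrib_left sum_subtractf[symmetric] drift_def
    by (intro E_cong sum.cong) (auto simp: algebra_simps)
  also have "\<dots> = E T - lam * (\<Sum>i=1..M. E (R i))"
    using E_diff[OF bT bdd_mult[OF bdd_const bS], of lam] E_sum[of "{1..M}" R, OF bR] by simp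
  also have "\<bar>\<dots>\<bar> \<le> \<bar>E T\<bar> + lam * (\<Sum>i=1..M. \<bar>E (R i)\<bar>)"
  proof -
    have "\<bar>E T - lam * (\<Sum>i=1..M. E (R i))\<bar> \<le> \<bar>E T\<bar> + \<bar>lam * (\<Sum>i=1..M. E (R i))\<bar>" by (rule abs_triangle_ineq4)
    also have "\<bar>lam * (\<Sum>i=1..M. E (R i))\<bar> \<le> lam * (\<Sum>i=1..M. \<bar>E (R i)\<bar>)"
      using lam by (simp add: abs_mult sum_abs)
    finally show ?thesis by simp
  qed
  also have "\<dots> \<le> C * (lam + 1) / real n + lam * (\<Sum>i=1..M. 2 * \<epsilon>)"
  proof (intro add_mono mult_left_mono sum_mono)
    show "\<bar>E T\<bar> \<le> C * (lam + 1) / real n" unfolding T_def by (rule rate_balance[OF F g grad cyl C]) auto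
    fix i
    have "E (R i) = E (\<lambda>s. g i (X s) * (all_ge (i - 1) s - X s (i - 1) ^ d)) - E (\<lambda>s. g i (X s)
        * (all_ge i s - X s i ^ d))"
      unfolding R_def by (intro E_diff bdd_mult bdd_diff bg bdd_all_ge bdd_X bdd_power)
    then show "\<bar>E (R i)\<bar> \<le> 2 * \<epsilon>" using dec[of i "i - 1"] dec[of i i] by linarith
  qed (use lam in auto)
  finally show ?thesis unfolding \<epsilon>_def by (simp add: mult_ac)
qed

text \<open>
  All walkers seeing a long queue implies that walker 0 sees one. The sum over the levels is taken
  before applying \<open>walker_sees_average\<close>, so that the error is paid once and not once per level.
\<close>

lemma tail_step:
  assumes lam1: "lam \<le> 1"
  shows "(\<Sum>i=M..<I. E (\<lambda>s. X s (Suc i))) \<le> lam * (1 + \<eta>) * (\<Sum>i=M..<I. E (\<lambda>s. X s i)) + 3 * (real d)\<^sup>2 * \<eta>"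
proof -
  \<comment> \<open>the part of a queue between the levels \<open>M\<close> and \<open>I\<close>: nondecreasing, and with increments at most 1\<close>
  define \<phi> :: "nat \<Rightarrow> real" where "\<phi> l = (\<Sum>i=M..<I. of_bool (i \<le> l))" for l
  have see: "E (\<lambda>s. \<phi> (fst s (snd (snd s 0))))
      \<le> (1 + \<eta>) * E (\<lambda>s. (\<Sum>x<n. \<phi> (fst s x)) / real n) + 3 * (real d)\<^sup>2 * \<eta>"
  proof (rule walker_sees_average)
    fix l
    show "0 \<le> \<phi> l" unfolding \<phi>_def by (intro sum_nonneg) auto
    show "\<phi> l \<le> real (I - M)"
    proof -
      have "\<phi> l \<le> (\<Sum>i=M..<I. 1)" unfolding \<phi>_def by (intro sum_mono) auto
      then show ?thesis by simp
    qed
    show "\<phi> l \<le> \<phi> (Suc l)" unfolding \<phi>_def by (intro sum_mono) auto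
    have "\<phi> (Suc l) = (\<Sum>i=M..<I. of_bool (i \<le> l) + of_bool (i = Suc l))"
      unfolding \<phi>_def by (intro sum.cong) auto
    also have "\<dots> = \<phi> l + (\<Sum>i=M..<I. of_bool (i = Suc l))" by (simp add: \<phi>_def sum.distrib)
    also have "\<dots> \<le> \<phi> l + 1" by (simp add: of_bool_def)
    finally show "\<phi> (Suc l) \<le> \<phi> l + 1" .
  qed
  have "(\<Sum>i=M..<I. E (\<lambda>s. X s (Suc i))) = lam * (\<Sum>i=M..<I. E (all_ge i))"
    by (simp add: tail_flow sum_distrib_left)
  also have "(\<Sum>i=M..<I. E (all_ge i)) = E (\<lambda>s. \<Sum>i=M..<I. all_ge i s)"
    by (intro E_sum[symmetric] bdd_all_ge)
  also have "\<dots> \<le> E (\<lambda>s. \<phi> (fst s (snd (snd s 0))))"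
    unfolding \<phi>_def by (intro E_mono bdd_sum bdd_all_ge bdd_of_bool sum_mono) (use d in \<open>auto simp: all_ge_def\<close>)
  also have "\<dots> \<le> (1 + \<eta>) * E (\<lambda>s. (\<Sum>x<n. \<phi> (fst s x)) / real n) + 3 * (real d)\<^sup>2 * \<eta>" by (rule see)
  also have "E (\<lambda>s. (\<Sum>x<n. \<phi> (fst s x)) / real n) = E (\<lambda>s. \<Sum>i=M..<I. X s i)"
  proof (rule E_cong)
    fix s :: state
    have "(\<Sum>x<n. \<phi> (fst s x)) = (\<Sum>i=M..<I. \<Sum>x<n. of_bool (i \<le> fst s x))"
      unfolding \<phi>_def by (rule sum.swap)
    then show "(\<Sum>x<n. \<phi> (fst s x)) / real n = (\<Sum>i=M..<I. X s i)"
      by (simp only: queue_proportion_sum sum_divide_distrib)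
  qed
  also have "\<dots> = (\<Sum>i=M..<I. E (\<lambda>s. X s i))" by (intro E_sum bdd_X)
  finally have "(\<Sum>i=M..<I. E (\<lambda>s. X s (Suc i)))
      \<le> lam * ((1 + \<eta>) * (\<Sum>i=M..<I. E (\<lambda>s. X s i)) + 3 * (real d)\<^sup>2 * \<eta>)"
    using lam by (simp add: mult_left_mono)
  also have "\<dots> = lam * (1 + \<eta>) * (\<Sum>i=M..<I. E (\<lambda>s. X s i)) + lam * (3 * (real d)\<^sup>2 * \<eta>)"
    by (simp add: algebra_simps)
  also have "lam * (3 * (real d)\<^sup>2 * \<eta>) \<le> 1 * (3 * (real d)\<^sup>2 * \<eta>)"
    using lam1 \<eta> by (intro mult_right_mono) auto
  finally show ?thesis by simp
qed

text \<open>
  The geometric decay \<open>E X\<^sub>i\<^sub>+\<^sub>1 \<le> \<rho> E X\<^sub>i\<close> holds up to errors of total size \<open>\<delta>\<close>. It is essential that the bound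
  does not depend on the upper end of the sum.
\<close>

lemma tail_sum:
  assumes lam1: "lam \<le> 1" and \<rho>: "lam * (1 + \<eta>) \<le> \<rho>" "\<rho> < 1"
  defines "\<delta> \<equiv> 3 * (real d)\<^sup>2 * \<eta>"
  shows "(\<Sum>i=M..<I. E (\<lambda>s. X s i)) \<le> \<rho> ^ M * ((1 + \<delta>) / (1 - \<rho>)) + \<delta> / (1 - \<rho>)"
proof -
  define T where "T M I = (\<Sum>i=M..<I. E (\<lambda>s. X s i))" for M I
  have \<rho>0: "0 \<le> \<rho>" using \<rho>(1) lam \<eta>
      by (metis add_nonneg_nonneg less_imp_le mult_nonneg_nonneg order_trans zero_le_one)
  have \<delta>: "0 \<le> \<delta>" using \<eta> by (simp add: \<delta>_def)
  have EX: "0 \<le> E (\<lambda>s. X s i)" for i using queue_proportion_range by (intro integral_nonneg_AE) auto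
  have T0: "0 \<le> T M I" for M I unfolding T_def by (intro sum_nonneg EX)
  have step: "T (Suc M) (Suc I) \<le> \<rho> * T M I + \<delta>" for M I
  proof -
    have "T (Suc M) (Suc I) = (\<Sum>i=M..<I. E (\<lambda>s. X s (Suc i)))" unfolding T_def
        by (rule sum.shift_bounds_Suc_ivl)
    also have "\<dots> \<le> lam * (1 + \<eta>) * T M I + \<delta>" unfolding T_def \<delta>_def by (rule tail_step[OF lam1])
    also have "\<dots> \<le> \<rho> * T M I + \<delta>" using \<rho>(1) T0 by (intro add_mono mult_right_mono) auto
    finally show ?thesis .
  qed
  have "T M I \<le> \<rho> ^ M * ((1 + \<delta>) / (1 - \<rho>)) + \<delta> / (1 - \<rho>)" for M I
  proof (induction M arbitrary: I)
    case 0
    have "T 0 I \<le> (1 + \<delta>) / (1 - \<rho>)"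
    proof (induction I)
      case 0 show ?case using \<delta> \<rho> by (simp add: T_def)
    next
      case (Suc I)
      have "T 0 (Suc I) = E (\<lambda>s. X s 0) + T (Suc 0) (Suc I)"
        unfolding T_def by (simp add: sum.atLeast_Suc_lessThan)
      also have "\<dots> \<le> 1 + (\<rho> * T 0 I + \<delta>)" using step[of 0 I] n by (simp add: queue_proportion_0)
      also have "\<dots> \<le> 1 + (\<rho> * ((1 + \<delta>) / (1 - \<rho>)) + \<delta>)" using mult_left_mono[OF Suc \<rho>0] by simp
      also have "\<dots> = (1 + \<delta>) / (1 - \<rho>)" using \<rho> by (simp add: field_simps)
      finally show ?case .
    qed
    moreover have "0 \<le> \<delta> / (1 - \<rho>)" using \<delta> \<rho> by simp
    ultimately show ?case by simp
  next
    case (Suc M)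
    show ?case
    proof (cases I)
      case 0
      have "0 \<le> \<rho> ^ Suc M * ((1 + \<delta>) / (1 - \<rho>)) + \<delta> / (1 - \<rho>)" using \<delta> \<rho> \<rho>0 by simp
      then show ?thesis using 0 by (simp add: T_def)
    next
      case (Suc I')
      have "T (Suc M) I \<le> \<rho> * T M I' + \<delta>" unfolding Suc by (rule step)
      also have "\<dots> \<le> \<rho> * (\<rho> ^ M * ((1 + \<delta>) / (1 - \<rho>)) + \<delta> / (1 - \<rho>)) + \<delta>"
        using Suc.IH[of I'] \<rho>0 by (simp add: mult_left_mono)
      also have "\<dots> = \<rho> ^ Suc M * ((1 + \<delta>) / (1 - \<rho>)) + (\<rho> * (\<delta> / (1 - \<rho>)) + \<delta>)"
        by (simp add: distrib_left)
      also have "\<rho> * (\<delta> / (1 - \<rho>)) + \<delta> = \<delta> / (1 - \<rho>)" using \<rho> by (simp add: field_simps)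
      finally show ?thesis .
    qed
  qed
  then show ?thesis unfolding T_def .
qed

end

section \<open>The fixed point and its stability\<close>

primrec equilibrium :: "real \<Rightarrow> nat \<Rightarrow> nat \<Rightarrow> real" where
  "equilibrium lam d 0 = 1"
| "equilibrium lam d (Suc i) = lam * equilibrium lam d i ^ d"

lemma equilibrium_bounds:
  assumes "0 < lam" "lam < 1" "1 \<le> d"
  shows "0 \<le> equilibrium lam d i" "equilibrium lam d i \<le> lam ^ i" "equilibrium lam d i \<le> 1"
proof -
  have "0 \<le> equilibrium lam d i \<and> equilibrium lam d i \<le> lam ^ i \<and> equilibrium lam d i \<le> 1"
  proof (induction i)
    case (Suc i)
    have "equilibrium lam d i ^ d \<le> equilibrium lam d i ^ 1" using Suc assms by (intro power_decreasing) auto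
    then have le: "lam * equilibrium lam d i ^ d \<le> lam ^ Suc i" using Suc assms by simp
    also have "\<dots> \<le> 1" using assms by (intro power_le_one) auto
    finally have "lam * equilibrium lam d i ^ d \<le> 1" .
    then show ?case using Suc assms le by simp
  qed simp
  then show "0 \<le> equilibrium lam d i" "equilibrium lam d i \<le> lam ^ i" "equilibrium lam d i \<le> 1" by auto
qed

lemma equilibrium_fixed_point: "fixed_point lam d (equilibrium lam d)"
  unfolding fixed_point_def drift_def
proof (intro conjI allI impI)
  fix i :: nat assume "1 \<le> i"
  then obtain j where "i = Suc j" by (cases i) auto
  then show "lam * (equilibrium lam d (i - 1) ^ d - equilibrium lam d i ^ d) - (equilibrium lam d i - equilibrium lam d (i + 1)) = 0"
    by (simp add: algebra_simps)
qed simp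

lemma equilibrium_l1_norm:
  assumes "0 < lam" "lam < 1" "1 \<le> d"
  shows "l1_norm (equilibrium lam d) < \<infinity>"
proof -
  have "l1_norm (equilibrium lam d) \<le> (\<Sum>i. ennreal (lam ^ i))"
    unfolding l1_norm_def using equilibrium_bounds[OF assms] by (intro suminf_le) (auto intro!: ennreal_leI)
  also have "\<dots> = ennreal (\<Sum>i. lam ^ i)"
    using assms by (intro suminf_ennreal2 summable_geometric) auto
  finally show ?thesis by (simp add: le_less_trans)
qed

text \<open>
  At a fixed point \<open>lam y\<^sub>i\<^sup>d - y\<^sub>i\<^sub>+\<^sub>1\<close> does not depend on \<open>i\<close>; summability makes this constant zero, and a
  recursion determines \<open>y\<close>.
\<close>

lemma fixed_point_unique:
  assumes d: "1 \<le> d" and y: "l1_norm y < \<infinity>" "fixed_point lam d y"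
  shows "y = equilibrium lam d"
proof
  have sum: "summable (\<lambda>i. \<bar>y i\<bar>)"
    using y(1) unfolding l1_norm_def by (intro summable_suminf_not_top) auto
  have y0: "y \<longlonglongrightarrow> 0" using summable_LIMSEQ_zero[OF sum] by (simp add: tendsto_rabs_zero_iff)
  define c where "c i = lam * y i ^ d - y (Suc i)" for i
  have step: "c (Suc i) = c i" for i
    using y(2) unfolding fixed_point_def drift_def c_def
        by (auto simp: algebra_simps dest!: spec[of _ "Suc i"])
  have const: "c i = c 0" for i by (induction i) (simp_all add: step)
  have "c \<longlonglongrightarrow> lam * 0 ^ d - 0"
    unfolding c_def by (intro tendsto_intros y0 LIMSEQ_Suc)
  moreover have "c = (\<lambda>_. c 0)" using const by blast
  ultimately have "(\<lambda>_::nat. c 0) \<longlonglongrightarrow> lam * 0 ^ d - 0" by metis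
  then have "c 0 = 0" using d by (simp add: LIMSEQ_const_iff power_0_left)
  then have rec: "y (Suc i) = lam * y i ^ d" for i using const[of i] by (simp add: c_def)
  fix i show "y i = equilibrium lam d i"
    using y(2) rec by (induction i) (auto simp: fixed_point_def)
qed

text \<open>
  A smooth substitute for the absolute value, within \<open>\<epsilon>\<close> of it. The derivative \<open>smooth_sgn\<close> is Lipschitz,
  unlike the sign function; this is required of test functions.
\<close>

definition smooth_abs :: "real \<Rightarrow> real \<Rightarrow> real" where "smooth_abs \<epsilon> y = sqrt (y\<^sup>2 + \<epsilon>\<^sup>2)"
definition smooth_sgn :: "real \<Rightarrow> real \<Rightarrow> real" where "smooth_sgn \<epsilon> y = y / sqrt (y\<^sup>2 + \<epsilon>\<^sup>2)"

lemma smooth_abs_deriv: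
  assumes "0 < \<epsilon>"
  shows "(smooth_abs \<epsilon> has_real_derivative smooth_sgn \<epsilon> y) (at y)"
proof -
  have p: "y\<^sup>2 + \<epsilon>\<^sup>2 > 0" using assms by (simp add: add_nonneg_pos)
  show ?thesis unfolding smooth_abs_def[abs_def] smooth_sgn_def
    using p by (auto intro!: derivative_eq_intros simp: field_simps)
qed

lemma smooth_sgn_bound: "\<bar>smooth_sgn \<epsilon> y\<bar> \<le> 1"
proof -
  have "\<bar>y\<bar> \<le> sqrt (y\<^sup>2 + \<epsilon>\<^sup>2)" by (rule real_le_rsqrt) simp
  moreover have "\<bar>y / s\<bar> \<le> 1" if "\<bar>y\<bar> \<le> s" for s
    using that by (auto simp: abs_divide divide_le_eq_1)
  ultimately show ?thesis by (simp add: smooth_sgn_def)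
qed

lemma smooth_sgn_deriv:
  assumes "0 < \<epsilon>"
  shows "\<exists>D. (smooth_sgn \<epsilon> has_real_derivative D) (at y) \<and> \<bar>D\<bar> \<le> 1 / \<epsilon>"
proof -
  define s where "s = sqrt (y\<^sup>2 + \<epsilon>\<^sup>2)"
  have p: "y\<^sup>2 + \<epsilon>\<^sup>2 > 0" using assms by (simp add: add_nonneg_pos)
  have s: "s > 0" "s\<^sup>2 = y\<^sup>2 + \<epsilon>\<^sup>2" "\<epsilon> \<le> s"
    using p assms by (auto simp: s_def intro: real_le_rsqrt)
  have "(smooth_sgn \<epsilon> has_real_derivative (1 * s - y * smooth_sgn \<epsilon> y) / (s * s)) (at y)"
    unfolding smooth_sgn_def[abs_def] s_def
    by (rule DERIV_divide[OF DERIV_ident smooth_abs_deriv[OF assms, unfolded smooth_abs_def[abs_def] smooth_sgn_def]])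
      (use assms in auto)
  moreover have "(1 * s - y * smooth_sgn \<epsilon> y) / (s * s) = \<epsilon>\<^sup>2 / s ^ 3"
    using s(1,2) unfolding smooth_sgn_def s_def[symmetric]
        by (simp add: field_simps power2_eq_square power3_eq_cube)
  moreover have "\<bar>\<epsilon>\<^sup>2 / s ^ 3\<bar> \<le> 1 / \<epsilon>"
  proof -
    have "\<epsilon> ^ 3 \<le> s ^ 3" using s assms by (intro power_mono) auto
    then show ?thesis using s(1) assms by (simp add: field_simps power2_eq_square power3_eq_cube)
  qed
  ultimately show ?thesis by metis
qed

lemma smooth_sgn_lipschitz:
  assumes "0 < \<epsilon>"
  shows "\<bar>smooth_sgn \<epsilon> z - smooth_sgn \<epsilon> y\<bar> \<le> (1 / \<epsilon>) * \<bar>z - y\<bar>"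
proof -
  obtain D where D: "\<And>y. (smooth_sgn \<epsilon> has_real_derivative D y) (at y)" "\<And>y. \<bar>D y\<bar> \<le> 1 / \<epsilon>"
    using smooth_sgn_deriv[OF assms] by metis
  have "norm (smooth_sgn \<epsilon> z - smooth_sgn \<epsilon> y) \<le> (1 / \<epsilon>) * norm (z - y)"
    by (rule field_differentiable_bound[of UNIV _ D]) (use D in auto)
  then show ?thesis by simp
qed

lemma smooth_abs_taylor:
  assumes "0 < \<epsilon>"
  shows "\<bar>smooth_abs \<epsilon> z - smooth_abs \<epsilon> y - (z - y) * smooth_sgn \<epsilon> y\<bar> \<le> (1 / \<epsilon>) * (z - y)\<^sup>2"
proof -
  have mvt: "\<exists>w. \<bar>w - y\<bar> \<le> \<bar>z - y\<bar> \<and> smooth_abs \<epsilon> z - smooth_abs \<epsilon> y = (z - y) * smooth_sgn \<epsilon> w"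
  proof (cases rule: linorder_cases[of y z])
    case less
    from MVT2[OF less smooth_abs_deriv[OF assms]] show ?thesis by force
  next
    case greater
    from MVT2[OF greater smooth_abs_deriv[OF assms]] obtain w where
      "z < w" "w < y" "smooth_abs \<epsilon> y - smooth_abs \<epsilon> z = (y - z) * smooth_sgn \<epsilon> w" by blast
    then show ?thesis by (intro exI[of _ w]) (auto simp: algebra_simps)
  qed auto
  then obtain w where w: "\<bar>w - y\<bar> \<le> \<bar>z - y\<bar>" "smooth_abs \<epsilon> z - smooth_abs \<epsilon> y
      = (z - y) * smooth_sgn \<epsilon> w" by blast
  have "\<bar>smooth_abs \<epsilon> z - smooth_abs \<epsilon> y - (z - y) * smooth_sgn \<epsilon> y\<bar>
      = \<bar>z - y\<bar> * \<bar>smooth_sgn \<epsilon> w - smooth_sgn \<epsilon> y\<bar>"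
    unfolding w(2) by (simp add: right_diff_distrib[symmetric] abs_mult)
  also have "\<dots> \<le> \<bar>z - y\<bar> * ((1 / \<epsilon>) * \<bar>z - y\<bar>)"
  proof (rule mult_left_mono)
    have "(1 / \<epsilon>) * \<bar>w - y\<bar> \<le> (1 / \<epsilon>) * \<bar>z - y\<bar>" using w(1) assms by (intro mult_left_mono) auto
    then show "\<bar>smooth_sgn \<epsilon> w - smooth_sgn \<epsilon> y\<bar> \<le> (1 / \<epsilon>) * \<bar>z - y\<bar>"
        using smooth_sgn_lipschitz[OF assms, of w y] by simp
  qed simp
  also have "\<dots> = (1 / \<epsilon>) * (\<bar>z - y\<bar> * \<bar>z - y\<bar>)" by (rule mult.left_commute)
  also have "\<dots> = (1 / \<epsilon>) * (z - y)\<^sup>2" by (simp only: abs_mult_self_eq power2_eq_square)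
  finally show ?thesis .
qed

lemma smooth_sgn_mult_self:
  assumes "0 < \<epsilon>"
  shows "\<bar>y\<bar> - \<epsilon> \<le> smooth_sgn \<epsilon> y * y"
proof -
  define s where "s = sqrt (y\<^sup>2 + \<epsilon>\<^sup>2)"
  have s: "s > 0" "s\<^sup>2 = y\<^sup>2 + \<epsilon>\<^sup>2" "\<bar>y\<bar> \<le> s"
    using assms by (auto simp: s_def add_nonneg_pos intro: real_le_rsqrt)
  have "\<epsilon>\<^sup>2 \<le> \<epsilon> * s"
  proof -
    have "\<epsilon> \<le> s" unfolding s_def using assms by (intro real_le_rsqrt) auto
    then show ?thesis using assms by (simp add: power2_eq_square)
  qed
  have "(\<bar>y\<bar> - \<epsilon>) * s \<le> (s - \<epsilon>) * s" using s by (intro mult_right_mono) auto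
  also have "\<dots> \<le> y\<^sup>2" using s(2) \<open>\<epsilon>\<^sup>2 \<le> \<epsilon> * s\<close> by (simp add: power2_eq_square algebra_simps)
  finally show ?thesis unfolding smooth_sgn_def s_def[symmetric] using s(1)
      by (simp add: field_simps power2_eq_square)
qed

lemma power_diff_factor:
  fixes x y :: real
  assumes "x \<in> {0..1}" "y \<in> {0..1}"
  obtains c where "0 \<le> c" "c \<le> real d" "x ^ d - y ^ d = c * (x - y)"
proof
  define c where "c = (\<Sum>i<d. x ^ i * y ^ (d - Suc i))"
  show "x ^ d - y ^ d = c * (x - y)" unfolding c_def by (simp add: power_diff_sumr2 mult.commute)
  show "0 \<le> c" unfolding c_def using assms by (intro sum_nonneg) auto
  have "c \<le> (\<Sum>i<d. 1)" unfolding c_def using assms by (intro sum_mono mult_le_one power_le_one) auto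
  then show "c \<le> real d" by simp
qed

text \<open>
  For the exact sign function the terms telescope: each coordinate can lose mass only to its neighbours, and
  the flow \<open>lam x\<^sub>i\<^sup>d\<close> is increasing in \<open>x\<^sub>i\<close>, so that its deviation has the sign of the deviation of
  \<open>x\<^sub>i\<close>. Coordinate 0 does not deviate, which leaves the loss at coordinate 1. Smoothing the sign costs
  \<open>\<epsilon>\<close> times a constant per coordinate.
\<close>

lemma drift_contraction:
  fixes x z :: "nat \<Rightarrow> real"
  assumes x: "\<And>i. x i \<in> {0..1}" and z: "\<And>i. z i \<in> {0..1}" and x0: "x 0 = z 0"
    and fp: "\<And>i. 1 \<le> i \<Longrightarrow> drift lam d z i = 0" and lam: "0 \<le> lam" and \<epsilon>: "0 < \<epsilon>"
  shows "(\<Sum>i=1..M. smooth_sgn \<epsilon> (x i - z i) * drift lam d x i)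
    \<le> \<bar>x (Suc M) - z (Suc M)\<bar> - \<bar>x 1 - z 1\<bar> + real M * ((lam * real d + 1) * \<epsilon>)"
proof -
  define e where "e i = x i - z i" for i
  define D where "D i = x i ^ d - z i ^ d" for i
  have gD: "\<bar>D i\<bar> - real d * \<epsilon> \<le> smooth_sgn \<epsilon> (e i) * D i" for i
  proof -
    obtain c where c: "0 \<le> c" "c \<le> real d" "D i = c * e i"
      using power_diff_factor[OF x z] unfolding D_def e_def by metis
    have "c * (\<bar>e i\<bar> - \<epsilon>) \<le> c * (smooth_sgn \<epsilon> (e i) * e i)"
      using smooth_sgn_mult_self[OF \<epsilon>] c by (intro mult_left_mono)
    moreover have "c * \<epsilon> \<le> real d * \<epsilon>" using c \<epsilon> by (intro mult_right_mono) auto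
    ultimately show ?thesis using c by (simp add: abs_mult algebra_simps)
  qed
  have g1: "smooth_sgn \<epsilon> y * v \<le> \<bar>v\<bar>" for y v
  proof -
    have "smooth_sgn \<epsilon> y * v \<le> \<bar>smooth_sgn \<epsilon> y\<bar> * \<bar>v\<bar>" by (metis abs_ge_self abs_mult)
    also have "\<dots> \<le> 1 * \<bar>v\<bar>" by (intro mult_right_mono smooth_sgn_bound) auto
    finally show ?thesis by simp
  qed
  have dr: "drift lam d x i = lam * (D (i - 1) - D i) - e i + e (Suc i)" if "1 \<le> i" for i
    using fp[OF that] unfolding drift_def D_def e_def by (simp add: algebra_simps)
  have each: "smooth_sgn \<epsilon> (e i) * drift lam d x i
      \<le> lam * (\<bar>D (i - 1)\<bar> - \<bar>D i\<bar>) + (\<bar>e (Suc i)\<bar> - \<bar>e i\<bar>) + (lam * real d + 1) * \<epsilon>" if "1 \<le> i" for i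
  proof -
    have "smooth_sgn \<epsilon> (e i) * drift lam d x i
        = lam * (smooth_sgn \<epsilon> (e i) * D (i - 1) - smooth_sgn \<epsilon> (e i) * D i) - smooth_sgn \<epsilon> (e i) * e i
            + smooth_sgn \<epsilon> (e i) * e (Suc i)"
      unfolding dr[OF that] by (simp add: algebra_simps)
    also have "\<dots> \<le> lam * (\<bar>D (i - 1)\<bar> - (\<bar>D i\<bar> - real d * \<epsilon>)) - (\<bar>e i\<bar> - \<epsilon>) + \<bar>e (Suc i)\<bar>"
      using g1 gD smooth_sgn_mult_self[OF \<epsilon>] lam by (intro add_mono diff_mono mult_left_mono) auto
    finally show ?thesis by (simp add: algebra_simps)
  qed
  have "(\<Sum>i=1..M. smooth_sgn \<epsilon> (x i - z i) * drift lam d x i)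
      \<le> (\<Sum>i=1..M. lam * (\<bar>D (i - 1)\<bar> - \<bar>D i\<bar>) + (\<bar>e (Suc i)\<bar> - \<bar>e i\<bar>) + (lam * real d + 1) * \<epsilon>)"
    using each by (intro sum_mono) (auto simp: e_def)
  also have "\<dots> = lam * (\<bar>D 0\<bar> - \<bar>D M\<bar>) + (\<bar>e (Suc M)\<bar> - \<bar>e 1\<bar>) + real M * ((lam * real d + 1) * \<epsilon>)"
    by (induction M) (auto simp: algebra_simps)
  also have "\<dots> \<le> \<bar>e (Suc M)\<bar> - \<bar>e 1\<bar> + real M * ((lam * real d + 1) * \<epsilon>)"
    using x0 lam by (simp add: D_def)
  finally show ?thesis by (simp add: e_def)
qed

section \<open>Distance of a stationary system from the fixed point\<close>

text \<open>
  The partial derivatives of \<open>(x\<^sub>i - x'\<^sub>i) (x\<^sub>i\<^sub>+\<^sub>1 - x'\<^sub>i\<^sub>+\<^sub>1)\<close>, where \<open>x'\<close> is the fixed point.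
\<close>

definition cross_gradient :: "real \<Rightarrow> nat \<Rightarrow> nat \<Rightarrow> nat \<Rightarrow> (nat \<Rightarrow> real) \<Rightarrow> real" where
  "cross_gradient lam d i j x =
     (if j = i then x (Suc i) - equilibrium lam d (Suc i)
      else if j = Suc i then x i - equilibrium lam d i
      else 0)"

context nbrw_pod
begin

definition mean_deviation :: "nat \<Rightarrow> real" where
  "mean_deviation i = E (\<lambda>s. \<bar>X s i - equilibrium lam d i\<bar>)"

lemma bdd_deviation: "bdd (\<lambda>s. \<bar>X s i - equilibrium lam d i\<bar>)"
  by (intro bdd_abs bdd_diff bdd_X bdd_const)

lemma mean_deviation_nonneg: "0 \<le> mean_deviation i"
  unfolding mean_deviation_def by (intro integral_nonneg_AE) auto

lemma mean_deviation_0: "mean_deviation 0 = 0"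
  unfolding mean_deviation_def using n by (simp add: queue_proportion_0)

lemma bdd_drift: "bdd (\<lambda>s. drift lam d (X s) i)"
  unfolding drift_def by (intro bdd_diff bdd_mult bdd_const bdd_power bdd_X)

lemma mean_deviation_le:
  assumes "lam < 1"
  shows "mean_deviation i \<le> E (\<lambda>s. X s i) + lam ^ i"
proof -
  have "mean_deviation i \<le> E (\<lambda>s. X s i + lam ^ i)"
    unfolding mean_deviation_def
  proof (intro E_mono bdd_deviation bdd_add bdd_X bdd_const)
    fix s
    show "\<bar>X s i - equilibrium lam d i\<bar> \<le> X s i + lam ^ i"
      using equilibrium_bounds[OF lam assms d, of i] queue_proportion_range[of n "fst s" i] by linarith
  qed
  then show ?thesis by (simp add: E_add[OF bdd_X bdd_const])
qed

text \<open>
  The smoothed \<open>l\<^sub>1\<close> distance of the first \<open>M\<close> coordinates is in balance up to the expectation on the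
  right, so its contraction can only be compensated by the deviation beyond level \<open>M\<close>.
\<close>

lemma mean_deviation_first:
  assumes "lam < 1" "0 < \<epsilon>"
  shows "mean_deviation 1 \<le> mean_deviation (Suc M) + real M * ((lam * real d + 1) * \<epsilon>)
    - E (\<lambda>s. \<Sum>i=1..M. smooth_sgn \<epsilon> (X s i - equilibrium lam d i) * drift lam d (X s) i)"
proof -
  let ?T = "\<lambda>s. \<Sum>i=1..M. smooth_sgn \<epsilon> (X s i - equilibrium lam d i) * drift lam d (X s) i"
  have bg: "bdd (\<lambda>s. smooth_sgn \<epsilon> (X s i - equilibrium lam d i))" for i
      by (rule bddI[of _ 1]) (rule smooth_sgn_bound)
  have bT: "bdd ?T" by (intro bdd_sum bdd_mult bg bdd_drift)
  have "E ?T \<le> E (\<lambda>s. \<bar>X s (Suc M) - equilibrium lam d (Suc M)\<bar> - \<bar>X s 1 - equilibrium lam d 1\<bar>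
      + real M * ((lam * real d + 1) * \<epsilon>))"
  proof (intro E_mono bT bdd_add bdd_diff bdd_deviation bdd_const drift_contraction)
    fix s i
    show "X s i \<in> {0..1}" using queue_proportion_range by auto
    show "equilibrium lam d i \<in> {0..1}" using equilibrium_bounds[OF lam assms(1) d] by auto
    show "X s 0 = equilibrium lam d 0" using n by (simp add: queue_proportion_0)
    show "0 \<le> lam" using lam by simp
    show "0 < \<epsilon>" by fact
    assume "1 \<le> i"
    then show "drift lam d (equilibrium lam d) i = 0" using equilibrium_fixed_point
        by (auto simp: fixed_point_def)
  qed
  also have "\<dots> = mean_deviation (Suc M) - mean_deviation 1 + real M * ((lam * real d + 1) * \<epsilon>)"
    unfolding mean_deviation_def
        using E_diff[OF bdd_deviation bdd_deviation] E_add[OF bdd_diff[OF bdd_deviation bdd_deviation] bdd_const]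
    by (simp del: equilibrium.simps One_nat_def)
  finally show ?thesis by simp
qed

text \<open>
  With \<open>e = X - x'\<close>, the rate of change of \<open>e\<^sub>i e\<^sub>i\<^sub>+\<^sub>1\<close> is \<open>e\<^sub>i\<^sub>+\<^sub>1\<^sup>2\<close> up to terms that contain a factor
  \<open>e\<^sub>i\<close> or \<open>e\<^sub>i\<^sub>-\<^sub>1\<close>: a deviation at level \<open>i + 1\<close> would drive level \<open>i\<close> away from its limit. The square is
  turned into an absolute value by \<open>\<bar>e\<bar> \<le> \<delta> + e\<^sup>2 / \<delta>\<close>.
\<close>

lemma mean_deviation_next:
  assumes lam1: "lam < 1" and \<delta>: "0 < \<delta>" and i: "1 \<le> i"
  shows "mean_deviation (Suc i)
      \<le> \<delta> + (E (\<lambda>s. \<Sum>j=1..Suc i. cross_gradient lam d i j (X s) * drift lam d (X s) j)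
    + real d * mean_deviation (i - 1) + (real d + 3) * mean_deviation i) / \<delta>"
proof -
  define e where "e i s = X s i - equilibrium lam d i" for i s
  define T where "T s = (\<Sum>j=1..Suc i. cross_gradient lam d i j (X s) * drift lam d (X s) j)" for s
  have be: "bdd (e i)" for i unfolding e_def by (intro bdd_diff bdd_X bdd_const)
  have bc: "bdd (\<lambda>s. cross_gradient lam d i j (X s))" for j
    unfolding cross_gradient_def using be[unfolded e_def] bdd_const[of 0]
        by (cases "j = i"; cases "j = Suc i") (simp_all del: equilibrium.simps)
  have bT: "bdd T" unfolding T_def by (intro bdd_sum bdd_mult bc bdd_drift)
  have mean_deviation: "mean_deviation i = E (\<lambda>s. \<bar>e i s\<bar>)" for i by (simp add: mean_deviation_def e_def)
  have Xr: "X s i \<in> {0..1}" for s i using queue_proportion_range by auto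
  have zr: "equilibrium lam d i \<in> {0..1}" for i using equilibrium_bounds[OF lam lam1 d] by auto
  have point: "\<bar>e (Suc i) s\<bar> \<le> \<delta> + (T s + real d * \<bar>e (i - 1) s\<bar> + (real d + 3) * \<bar>e i s\<bar>) / \<delta>" for s
  proof -
    define D where "D j = X s j ^ d - equilibrium lam d j ^ d" for j
    have Db: "\<bar>lam * D j\<bar> \<le> real d * \<bar>e j s\<bar>" for j
    proof -
      obtain c where c: "0 \<le> c" "c \<le> real d" "D j = c * e j s"
        using power_diff_factor[OF Xr zr] unfolding D_def e_def by metis
      have "\<bar>lam * D j\<bar> = (lam * c) * \<bar>e j s\<bar>" using lam c by (simp add: abs_mult)
      also have "\<dots> \<le> (1 * real d) * \<bar>e j s\<bar>" using lam lam1 c by (intro mult_right_mono mult_mono) auto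
      finally show ?thesis by simp
    qed
    have e1: "\<bar>e j s\<bar> \<le> 1" for j using Xr[of s j] zr[of j] by (auto simp: e_def)
    have "drift lam d (equilibrium lam d) i = 0" using equilibrium_fixed_point i
        by (auto simp: fixed_point_def)
    then have dr: "drift lam d (X s) i = lam * D (i - 1) - lam * D i - e i s + e (Suc i) s"
      unfolding drift_def D_def e_def by (simp add: algebra_simps)
    have db: "\<bar>drift lam d (X s) (Suc i)\<bar> \<le> 2"
    proof -
      have "\<bar>lam * (X s i ^ d - X s (Suc i) ^ d)\<bar> \<le> 1 * 1"
        unfolding abs_mult
      proof (intro mult_mono)
        have "0 \<le> X s j ^ d" "X s j ^ d \<le> 1" for j using Xr[of s j] by (auto intro: power_le_one)
        then show "\<bar>X s i ^ d - X s (Suc i) ^ d\<bar> \<le> 1" by (smt (verit))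
      qed (use lam lam1 in auto)
      moreover have "\<bar>X s (Suc i) - X s (Suc i + 1)\<bar> \<le> 1" using Xr[of s "Suc i"] Xr[of s "Suc i + 1"] by auto
      ultimately show ?thesis unfolding drift_def diff_Suc_1 by linarith
    qed
    have T: "T s = e (Suc i) s * drift lam d (X s) i + e i s * drift lam d (X s) (Suc i)"
    proof -
      have "T s = (\<Sum>j=1..Suc i. (if j = i then e (Suc i) s * drift lam d (X s) i else 0)
          + (if j = Suc i then e i s * drift lam d (X s) (Suc i) else 0))"
        unfolding T_def by (intro sum.cong) (auto simp: cross_gradient_def e_def)
      then show ?thesis using i by (simp add: sum.distrib)
    qed
    have b1: "\<bar>e (Suc i) s * v\<bar> \<le> \<bar>v\<bar>" for v
      using mult_right_mono[OF e1[of "Suc i"], of "\<bar>v\<bar>"] by (simp add: abs_mult)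
    have b2: "\<bar>e i s * drift lam d (X s) (Suc i)\<bar> \<le> \<bar>e i s\<bar> * 2"
      unfolding abs_mult using db by (intro mult_left_mono) auto
    have "(e (Suc i) s)\<^sup>2
        = T s - e (Suc i) s * (lam * D (i - 1)) + e (Suc i) s * (lam * D i) + e (Suc i) s * e i s
        - e i s * drift lam d (X s) (Suc i)"
      unfolding T dr by (simp add: power2_eq_square algebra_simps)
    also have "\<dots> \<le> T s + real d * \<bar>e (i - 1) s\<bar> + (real d + 3) * \<bar>e i s\<bar>"
    proof -
      have "- (e (Suc i) s * (lam * D (i - 1))) \<le> real d * \<bar>e (i - 1) s\<bar>"
        by (rule order_trans[OF order_trans[OF abs_ge_minus_self b1] Db])
      moreover have "e (Suc i) s * (lam * D i) \<le> real d * \<bar>e i s\<bar>"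
        by (rule order_trans[OF order_trans[OF abs_ge_self b1] Db])
      moreover have "e (Suc i) s * e i s \<le> \<bar>e i s\<bar>" by (rule order_trans[OF abs_ge_self b1])
      moreover have "- (e i s * drift lam d (X s) (Suc i)) \<le> \<bar>e i s\<bar> * 2"
        by (rule order_trans[OF abs_ge_minus_self b2])
      moreover have "(real d + 3) * \<bar>e i s\<bar> = real d * \<bar>e i s\<bar> + 3 * \<bar>e i s\<bar>" by (rule distrib_right)
      ultimately show ?thesis by linarith
    qed
    finally have sq: "(e (Suc i) s)\<^sup>2 \<le> T s + real d * \<bar>e (i - 1) s\<bar> + (real d + 3) * \<bar>e i s\<bar>" .
    have "\<bar>e (Suc i) s\<bar> \<le> \<delta> + (e (Suc i) s)\<^sup>2 / \<delta>"
    proof (cases "\<bar>e (Suc i) s\<bar> \<le> \<delta>")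
      case True
      then show ?thesis using \<delta> by (simp add: add_increasing2)
    next
      case False
      then have "\<bar>e (Suc i) s\<bar> * \<delta> \<le> \<bar>e (Suc i) s\<bar> * \<bar>e (Suc i) s\<bar>" by (intro mult_left_mono) auto
      then have "\<bar>e (Suc i) s\<bar> \<le> (e (Suc i) s)\<^sup>2 / \<delta>" using \<delta> by (simp add: field_simps power2_eq_square)
      then show ?thesis using \<delta> by simp
    qed
    also have "\<dots> \<le> \<delta> + (T s + real d * \<bar>e (i - 1) s\<bar> + (real d + 3) * \<bar>e i s\<bar>) / \<delta>"
      using sq \<delta> by (intro add_left_mono divide_right_mono) auto
    finally show ?thesis .
  qed
  have bS: "bdd (\<lambda>s. T s + real d * \<bar>e (i - 1) s\<bar> + (real d + 3) * \<bar>e i s\<bar>)"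
    by (intro bdd_add bdd_mult bdd_const bdd_abs be bT)
  have "mean_deviation (Suc i) \<le> E (\<lambda>s. \<delta> + (T s + real d * \<bar>e (i - 1) s\<bar> + (real d + 3) * \<bar>e i s\<bar>) / \<delta>)"
    unfolding mean_deviation by (rule E_mono[OF bdd_abs[OF be] bdd_add[OF bdd_const bdd_divide[OF bS]] point])
  also have "\<dots> = \<delta> + E (\<lambda>s. T s + real d * \<bar>e (i - 1) s\<bar> + (real d + 3) * \<bar>e i s\<bar>) / \<delta>"
    using E_add[OF bdd_const bdd_divide[OF bS]] by simp
  also have "E (\<lambda>s. T s + real d * \<bar>e (i - 1) s\<bar> + (real d + 3) * \<bar>e i s\<bar>)
      = E T + real d * mean_deviation (i - 1) + (real d + 3) * mean_deviation i"
    using bT be by (simp add: mean_deviation E_add bdd_add bdd_mult bdd_const bdd_abs)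
  finally show ?thesis unfolding T_def .
qed

lemma l1_deviation:
  assumes "\<And>I. (\<Sum>i<I. mean_deviation i) \<le> b"
  shows "(\<integral>\<^sup>+ s. l1_norm (\<lambda>i. X s i - equilibrium lam d i) \<partial>measure_pmf p) \<le> ennreal b"
proof -
  have "(\<integral>\<^sup>+ s. l1_norm (\<lambda>i. X s i - equilibrium lam d i) \<partial>measure_pmf p)
      = (\<Sum>i. \<integral>\<^sup>+ s. ennreal \<bar>X s i - equilibrium lam d i\<bar> \<partial>measure_pmf p)"
    unfolding l1_norm_def by (rule nn_integral_suminf) simp
  also have "\<dots> = (\<Sum>i. ennreal (mean_deviation i))"
    unfolding mean_deviation_def
        by (intro suminf_cong nn_integral_eq_integral bdd_integrable bdd_deviation) auto
  also have "\<dots> \<le> ennreal b"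
  proof (rule suminf_le_const)
    fix I show "(\<Sum>i<I. ennreal (mean_deviation i)) \<le> ennreal b"
      using assms mean_deviation_nonneg by (subst sum_ennreal) (auto intro!: ennreal_leI)
  qed simp
  finally show ?thesis .
qed

end

section \<open>Convergence along a sequence of graphs\<close>

text \<open>
  The filter \<open>Fl\<close> stands for \<open>n\<close> tending to infinity within the set of sizes of the given graphs.
\<close>

locale nbrw_pod_sequence =
  fixes lam :: real and d k :: nat and G :: "nat \<Rightarrow> nat pair_pre_digraph" and \<tau> :: "nat \<Rightarrow> state \<Rightarrow> nat pmf"
    and stat :: "nat \<Rightarrow> state pmf" and m :: "nat \<Rightarrow> nat" and \<eta> :: "nat \<Rightarrow> real" and Fl :: "nat filter"
  assumes lam: "0 < lam" "lam < 1" and d: "1 \<le> d"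
    and sys: "\<forall>\<^sub>F n in Fl. mixing_nbrw_pod lam d k n (G n) (\<tau> n) (stat n) (m n) (\<eta> n)"
    and \<eta>_lim: "(\<eta> \<longlongrightarrow> 0) Fl" and n_lim: "((\<lambda>n. 1 / real n) \<longlongrightarrow> 0) Fl"
begin

abbreviation X :: "nat \<Rightarrow> state \<Rightarrow> nat \<Rightarrow> real" where "X n s \<equiv> queue_proportion n (fst s)"
abbreviation E :: "nat \<Rightarrow> (state \<Rightarrow> real) \<Rightarrow> real" where "E n \<equiv> measure_pmf.expectation (stat n)"

lemma sys_pod: "\<forall>\<^sub>F n in Fl. nbrw_pod lam d k n (G n) (\<tau> n) (stat n)"
  using sys by eventually_elim (simp add: mixing_nbrw_pod_def)

definition deviation :: "nat \<Rightarrow> nat \<Rightarrow> real" where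
  "deviation i n = E n (\<lambda>s. \<bar>X n s i - equilibrium lam d i\<bar>)"

text \<open>
  The limiting form of \<open>fluid_balance\<close> for a test function that does not depend on \<open>n\<close>. In other
  words, every limit of the stationary laws is invariant under the differential equation.
\<close>

lemma limit_fluid:
  fixes F :: "(nat \<Rightarrow> real) \<Rightarrow> real" and g :: "nat \<Rightarrow> (nat \<Rightarrow> real) \<Rightarrow> real"
  assumes F: "\<And>x. (\<And>i. x i \<in> {0..1}) \<Longrightarrow> \<bar>F x\<bar> \<le> B"
    and g: "\<And>x i. (\<And>i. x i \<in> {0..1}) \<Longrightarrow> \<bar>g i x\<bar> \<le> Bg"
    and grad: "\<And>x i y. (\<And>i. x i \<in> {0..1}) \<Longrightarrow> y \<in> {0..1} \<Longrightarrow> 1 \<le> i \<Longrightarrow> i \<le> M \<Longrightarrow>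
      \<bar>F (x(i := y)) - F x - (y - x i) * g i x\<bar> \<le> C * (y - x i)\<^sup>2"
    and cyl: "\<And>x i y. M < i \<Longrightarrow> F (x(i := y)) = F x"
    and lip: "\<And>x i l y. (\<And>i. x i \<in> {0..1}) \<Longrightarrow> y \<in> {0..1} \<Longrightarrow> \<bar>g i (x(l := y)) - g i x\<bar> \<le> L * \<bar>y - x l\<bar>"
    and C: "0 \<le> C" and L: "0 \<le> L"
  shows "((\<lambda>n. E n (\<lambda>s. \<Sum>i=1..M. g i (X n s) * drift lam d (X n s) i)) \<longlongrightarrow> 0) Fl"
proof (rule Lim_null_comparison)
  let ?b = "\<lambda>n. C * (lam + 1) * (1 / real n) + 2 * lam * real M * ((Bg + L) * (4 * (real d)\<^sup>2 * (1
      + 1 / lam)) * \<eta> n)"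
  show "\<forall>\<^sub>F n in Fl. norm (E n (\<lambda>s. \<Sum>i=1..M. g i (X n s) * drift lam d (X n s) i)) \<le> ?b n"
    using sys
  proof eventually_elim
    case (elim n)
    from mixing_nbrw_pod.fluid_balance[OF elim F g grad cyl lip C L] show ?case by simp
  qed
  have "(?b \<longlongrightarrow> C * (lam + 1) * 0 + 2 * lam * real M * ((Bg + L) * (4 * (real d)\<^sup>2 * (1 + 1 / lam)) * 0)) Fl"
    by (intro tendsto_intros \<eta>_lim n_lim)
  then show "(?b \<longlongrightarrow> 0) Fl" by simp
qed

lemma limit_tail:
  assumes "0 < \<epsilon>"
  shows "\<forall>\<^sub>F M in sequentially. \<forall>\<^sub>F n in Fl. \<forall>I. (\<Sum>i=M..<I. E n (\<lambda>s. X n s i)) \<le> \<epsilon>"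
proof -
  \<comment> \<open>any ratio strictly between \<open>lam\<close> and 1 absorbs the factor \<open>1 + \<eta>\<close>\<close>
  define \<rho> where "\<rho> = (1 + lam) / 2"
  have \<rho>: "lam < \<rho>" "0 < \<rho>" "\<rho> < 1" using lam by (auto simp: \<rho>_def)
  define \<delta> where "\<delta> n = 3 * (real d)\<^sup>2 * \<eta> n" for n
  have "(\<delta> \<longlongrightarrow> 3 * (real d)\<^sup>2 * 0) Fl" unfolding \<delta>_def by (intro tendsto_intros \<eta>_lim)
  then have \<delta>0: "(\<delta> \<longlongrightarrow> 0) Fl" by simp
  have "((\<lambda>n. lam * (1 + \<eta> n)) \<longlongrightarrow> lam * (1 + 0)) Fl" by (intro tendsto_intros \<eta>_lim)
  then have e1: "\<forall>\<^sub>F n in Fl. lam * (1 + \<eta> n) < \<rho>" by (rule order_tendstoD(2)) (use \<rho> in simp)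
  have "(\<lambda>M. \<rho> ^ M * (1 / (1 - \<rho>))) \<longlonglongrightarrow> 0 * (1 / (1 - \<rho>))"
    using \<rho> by (intro tendsto_intros LIMSEQ_power_zero) auto
  then have "\<forall>\<^sub>F M in sequentially. \<rho> ^ M * (1 / (1 - \<rho>)) < \<epsilon>"
    by (rule order_tendstoD(2)) (use assms in simp)
  then show ?thesis
  proof eventually_elim
    case (elim M)
    have "((\<lambda>n. \<rho> ^ M * ((1 + \<delta> n) / (1 - \<rho>)) + \<delta> n / (1 - \<rho>)) \<longlongrightarrow> \<rho> ^ M * ((1 + 0) / (1 - \<rho>))
        + 0 / (1 - \<rho>)) Fl"
      using \<rho> by (intro tendsto_intros \<delta>0) auto
    then have "\<forall>\<^sub>F n in Fl. \<rho> ^ M * ((1 + \<delta> n) / (1 - \<rho>)) + \<delta> n / (1 - \<rho>) < \<epsilon>"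
      by (rule order_tendstoD(2)) (use elim in simp)
    with e1 sys show ?case
    proof eventually_elim
      case (elim n)
      then have "(\<Sum>i=M..<I. E n (\<lambda>s. X n s i)) \<le> \<rho> ^ M * ((1 + \<delta> n) / (1 - \<rho>)) + \<delta> n / (1 - \<rho>)" for I
        unfolding \<delta>_def using \<rho> lam by (intro mixing_nbrw_pod.tail_sum) auto
      then show ?case using elim by (meson less_imp_le order_trans)
    qed
  qed
qed

lemma deviation_0: "(deviation 0 \<longlongrightarrow> 0) Fl"
proof (rule tendsto_eventually)
  show "\<forall>\<^sub>F n in Fl. deviation 0 n = 0"
    using sys_pod
  proof eventually_elim
    case (elim n)
    show ?case using nbrw_pod.mean_deviation_0[OF elim]
        unfolding nbrw_pod.mean_deviation_def[OF elim] deviation_def .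
  qed
qed

lemma eventually_small:
  assumes "\<And>n. 0 \<le> f n" "\<And>\<epsilon>. 0 < \<epsilon> \<Longrightarrow> \<forall>\<^sub>F n in Fl. f n \<le> \<epsilon>"
  shows "(f \<longlongrightarrow> (0 :: real)) Fl"
proof (rule tendstoI)
  fix \<epsilon> :: real assume "0 < \<epsilon>"
  then have "\<forall>\<^sub>F n in Fl. f n \<le> \<epsilon> / 2" by (intro assms(2)) auto
  then show "\<forall>\<^sub>F n in Fl. dist (f n) 0 < \<epsilon>"
    by eventually_elim (use assms(1) \<open>0 < \<epsilon>\<close> in \<open>simp add: dist_real_def le_less_trans\<close>)
qed

lemma deviation_nonneg: "0 \<le> deviation i n"
  unfolding deviation_def by (intro integral_nonneg_AE) auto

text \<open>
  The order of choices matters: first the level \<open>M\<close>, by the tail bound, then the smoothing parameter \<open>\<gamma>\<close>,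
  depending on \<open>M\<close>, and only then \<open>n\<close>.
\<close>

lemma deviation_1: "(deviation 1 \<longlongrightarrow> 0) Fl"
proof (rule eventually_small[OF deviation_nonneg])
  fix \<epsilon> :: real assume \<epsilon>: "0 < \<epsilon>"
  have "(\<lambda>M. lam ^ Suc M) \<longlonglongrightarrow> 0" using lam by (intro LIMSEQ_power_zero[THEN LIMSEQ_Suc]) auto
  then have "\<forall>\<^sub>F M in sequentially. lam ^ Suc M < \<epsilon> / 4" by (rule order_tendstoD(2)) (use \<epsilon> in simp)
  moreover have "\<forall>\<^sub>F M in sequentially. \<forall>\<^sub>F n in Fl. \<forall>I. (\<Sum>i=Suc M..<I. E n (\<lambda>s. X n s i)) \<le> \<epsilon> / 4"
    using limit_tail[of "\<epsilon> / 4"] \<epsilon>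
    by (intro eventually_sequentially_Suc[THEN iffD2, of "\<lambda>M. \<forall>\<^sub>F n in Fl. \<forall>I. (\<Sum>i=M..<I. E n (\<lambda>s. X n s i)) \<le> \<epsilon> / 4"]) simp
  ultimately have "\<forall>\<^sub>F M in sequentially. lam ^ Suc M < \<epsilon> / 4
      \<and> (\<forall>\<^sub>F n in Fl. \<forall>I. (\<Sum>i=Suc M..<I. E n (\<lambda>s. X n s i)) \<le> \<epsilon> / 4)"
    by eventually_elim simp
  then obtain M where M: "lam ^ Suc M < \<epsilon> / 4"
      "\<forall>\<^sub>F n in Fl. \<forall>I. (\<Sum>i=Suc M..<I. E n (\<lambda>s. X n s i)) \<le> \<epsilon> / 4"
    by (auto simp: eventually_sequentially)
  \<comment> \<open>chosen to make the smoothing error over \<open>M\<close> coordinates at most \<open>\<epsilon> / 4\<close>\<close>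
  define \<gamma> where "\<gamma> = \<epsilon> / (4 * (real M + 1) * (lam * real d + 1))"
  have pos: "0 < lam * real d + 1" using lam by (simp add: add_nonneg_pos)
  have \<gamma>: "0 < \<gamma>" unfolding \<gamma>_def using \<epsilon> pos by simp
  have \<gamma>M: "real M * ((lam * real d + 1) * \<gamma>) \<le> \<epsilon> / 4"
  proof -
    have "(lam * real d + 1) * \<gamma> = \<epsilon> / 4 / (real M + 1)" 
    proof -
      have "c * (\<epsilon> / (a * c)) = \<epsilon> / a" if "0 < c" for a c :: real using that by simp
      from this[OF pos] show ?thesis unfolding \<gamma>_def by simp
    qed
    then have "real M * ((lam * real d + 1) * \<gamma>) = (real M / (real M + 1)) * (\<epsilon> / 4)" by simp
    also have "\<dots> \<le> 1 * (\<epsilon> / 4)" using \<epsilon> by (intro mult_right_mono) (auto simp: divide_le_eq_1)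
    finally show ?thesis by simp
  qed
  let ?z = "equilibrium lam d"
  have "((\<lambda>n. E n (\<lambda>s. \<Sum>i=1..M. smooth_sgn \<gamma> (X n s i - ?z i) * drift lam d (X n s) i)) \<longlongrightarrow> 0) Fl"
  proof (rule limit_fluid[where F = "\<lambda>x. \<Sum>i=1..M. smooth_abs \<gamma> (x i - ?z i)" and g
      = "\<lambda>i x. smooth_sgn \<gamma> (x i - ?z i)"
        and Bg = 1 and B = "real M * (1 + \<gamma>)" and C = "1 / \<gamma>" and L = "1 / \<gamma>"])
    fix x :: "nat \<Rightarrow> real" assume x: "\<And>i. x i \<in> {0..1}"
    have "\<bar>smooth_abs \<gamma> (x i - ?z i)\<bar> \<le> 1 + \<gamma>" for i
    proof -
      have "\<bar>x i - ?z i\<bar> \<le> 1" using x[of i] equilibrium_bounds[OF lam d, of i] by auto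
      moreover have "smooth_abs \<gamma> (x i - ?z i) \<le> \<bar>x i - ?z i\<bar> + \<bar>\<gamma>\<bar>"
        unfolding smooth_abs_def by (rule sqrt_sum_squares_le_sum_abs)
      ultimately show ?thesis using \<gamma> by (simp add: smooth_abs_def)
    qed
    then have "\<bar>\<Sum>i=1..M. smooth_abs \<gamma> (x i - ?z i)\<bar> \<le> (\<Sum>i=1..M. 1 + \<gamma>)"
      by (intro order_trans[OF sum_abs] sum_mono)
    then show "\<bar>\<Sum>i=1..M. smooth_abs \<gamma> (x i - ?z i)\<bar> \<le> real M * (1 + \<gamma>)" by simp
    fix i l y assume y: "y \<in> {0..1::real}"
    show "\<bar>smooth_sgn \<gamma> ((x(l := y)) i - ?z i) - smooth_sgn \<gamma> (x i - ?z i)\<bar> \<le> 1 / \<gamma> * \<bar>y - x l\<bar>"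
      using smooth_sgn_lipschitz[OF \<gamma>, of "y - ?z i" "x i - ?z i"] \<gamma> by auto
  next
    fix x :: "nat \<Rightarrow> real" and i y assume i: "1 \<le> i" "i \<le> M"
    have "(\<Sum>j=1..M. smooth_abs \<gamma> ((x(i := y)) j - ?z j)) - (\<Sum>j=1..M. smooth_abs \<gamma> (x j - ?z j))
        = (\<Sum>j=1..M. if j = i then smooth_abs \<gamma> (y - ?z i) - smooth_abs \<gamma> (x i - ?z i) else 0)"
      unfolding sum_subtractf[symmetric] by (intro sum.cong) auto
    also have "\<dots> = smooth_abs \<gamma> (y - ?z i) - smooth_abs \<gamma> (x i - ?z i)" using i by simp
    finally show "\<bar>(\<Sum>j=1..M. smooth_abs \<gamma> ((x(i := y)) j - ?z j)) - (\<Sum>j=1..M. smooth_abs \<gamma> (x j - ?z j))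
        - (y - x i) * smooth_sgn \<gamma> (x i - ?z i)\<bar> \<le> 1 / \<gamma> * (y - x i)\<^sup>2"
      using smooth_abs_taylor[OF \<gamma>, of "y - ?z i" "x i - ?z i"] by simp
  qed (use \<gamma> smooth_sgn_bound in \<open>auto intro!: sum.cong\<close>)
  then have "\<forall>\<^sub>F n in Fl. - (\<epsilon> / 4) < E n (\<lambda>s. \<Sum>i=1..M. smooth_sgn \<gamma> (X n s i - ?z i)
      * drift lam d (X n s) i)"
    by (rule order_tendstoD(1)) (use \<epsilon> in simp)
  with M(2) sys_pod show "\<forall>\<^sub>F n in Fl. deviation 1 n \<le> \<epsilon>"
  proof eventually_elim
    case (elim n)
    have "deviation 1 n \<le> deviation (Suc M) n + real M * ((lam * real d + 1) * \<gamma>)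
        - E n (\<lambda>s. \<Sum>i=1..M. smooth_sgn \<gamma> (X n s i - ?z i) * drift lam d (X n s) i)"
      using nbrw_pod.mean_deviation_first[OF elim(2) lam(2) \<gamma>]
          unfolding nbrw_pod.mean_deviation_def[OF elim(2)] deviation_def .
    moreover have "deviation (Suc M) n \<le> E n (\<lambda>s. X n s (Suc M)) + lam ^ Suc M"
      using nbrw_pod.mean_deviation_le[OF elim(2) lam(2), of "Suc M"]
          unfolding nbrw_pod.mean_deviation_def[OF elim(2)] deviation_def .
    moreover have "E n (\<lambda>s. X n s (Suc M)) \<le> \<epsilon> / 4" using spec[OF elim(1), of "Suc (Suc M)"] by simp
    ultimately show ?case using M(1) \<gamma>M elim(3) by linarith
  qed
qed

lemma deviation_all: "(deviation i \<longlongrightarrow> 0) Fl"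
proof -
  have "(deviation i \<longlongrightarrow> 0) Fl \<and> (deviation (Suc i) \<longlongrightarrow> 0) Fl"
  proof (induction i)
    case 0 show ?case using deviation_0 deviation_1 by simp
  next
    case (Suc i)
    let ?z = "equilibrium lam d" and ?i = "Suc i"
    have zr: "?z j \<in> {0..1}" for j using equilibrium_bounds[OF lam d] by auto
    have le1: "\<bar>x j - ?z j\<bar> \<le> 1" if "\<And>j. x j \<in> {0..1}" for x j using that[of j] zr[of j] by auto
    have fluid: "((\<lambda>n. E n (\<lambda>s. \<Sum>j=1..Suc ?i. cross_gradient lam d ?i j (X n s)
        * drift lam d (X n s) j)) \<longlongrightarrow> 0) Fl"
    proof (rule limit_fluid[where F = "\<lambda>x. (x ?i - ?z ?i) * (x (Suc ?i) - ?z (Suc ?i))" and Bg = 1 and B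
        = 1 and C = 0 and L = 1])
      fix x :: "nat \<Rightarrow> real" assume x: "\<And>i. x i \<in> {0..1}"
      show "\<bar>(x ?i - ?z ?i) * (x (Suc ?i) - ?z (Suc ?i))\<bar> \<le> 1"
        unfolding abs_mult using le1[of x, OF x] by (intro mult_le_one) (auto simp del: equilibrium.simps)
      fix j show "\<bar>cross_gradient lam d ?i j x\<bar> \<le> 1" unfolding cross_gradient_def using le1[of x, OF x]
          by (auto simp del: equilibrium.simps)
    qed (auto simp: cross_gradient_def algebra_simps)
    have "(deviation (Suc ?i) \<longlongrightarrow> 0) Fl"
    proof (rule eventually_small[OF deviation_nonneg])
      fix \<epsilon> :: real assume \<epsilon>: "0 < \<epsilon>"
      let ?b = "\<lambda>n. \<epsilon> / 2 + (E n (\<lambda>s. \<Sum>j=1..Suc ?i. cross_gradient lam d ?i j (X n s) * drift lam d (X n s) j)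
        + real d * deviation i n + (real d + 3) * deviation ?i n) / (\<epsilon> / 2)"
      have "(?b \<longlongrightarrow> \<epsilon> / 2 + (0 + real d * 0 + (real d + 3) * 0) / (\<epsilon> / 2)) Fl"
        using Suc \<epsilon> by (intro tendsto_intros fluid) auto
      then have "\<forall>\<^sub>F n in Fl. ?b n < \<epsilon>" by (rule order_tendstoD(2)) (use \<epsilon> in simp)
      with sys_pod show "\<forall>\<^sub>F n in Fl. deviation (Suc ?i) n \<le> \<epsilon>"
      proof eventually_elim
        case (elim n)
        have "deviation (Suc ?i) n \<le> ?b n"
          using nbrw_pod.mean_deviation_next[OF elim(1) lam(2), of "\<epsilon> / 2" ?i] \<epsilon>
          unfolding nbrw_pod.mean_deviation_def[OF elim(1)] deviation_def by simp
        then show ?case using elim(2) by linarith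
      qed
    qed
    then show ?case using Suc by simp
  qed
  then show ?thesis ..
qed

theorem l1_convergence:
  "((\<lambda>n. \<integral>\<^sup>+ s. l1_norm (\<lambda>i. X n s i - equilibrium lam d i) \<partial>measure_pmf (stat n)) \<longlongrightarrow> 0) Fl"
proof -
  let ?f = "\<lambda>n. \<integral>\<^sup>+ s. l1_norm (\<lambda>i. X n s i - equilibrium lam d i) \<partial>measure_pmf (stat n)"
  have small: "\<forall>\<^sub>F n in Fl. ?f n \<le> ennreal \<epsilon>" if \<epsilon>: "0 < \<epsilon>" for \<epsilon> :: real
  proof -
    have "(\<lambda>M. lam ^ M * (1 / (1 - lam))) \<longlonglongrightarrow> 0 * (1 / (1 - lam))"
      using lam by (intro tendsto_intros LIMSEQ_power_zero) auto
    then have "\<forall>\<^sub>F M in sequentially. lam ^ M * (1 / (1 - lam)) < \<epsilon> / 3"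
      by (rule order_tendstoD(2)) (use \<epsilon> in simp)
    moreover have "\<forall>\<^sub>F M in sequentially. \<forall>\<^sub>F n in Fl. \<forall>I. (\<Sum>i=M..<I. E n (\<lambda>s. X n s i)) \<le> \<epsilon> / 3"
      by (rule limit_tail) (use \<epsilon> in simp)
    ultimately have "\<forall>\<^sub>F M in sequentially. lam ^ M * (1 / (1 - lam)) < \<epsilon> / 3
        \<and> (\<forall>\<^sub>F n in Fl. \<forall>I. (\<Sum>i=M..<I. E n (\<lambda>s. X n s i)) \<le> \<epsilon> / 3)"
      by eventually_elim simp
    then obtain M where M: "lam ^ M * (1 / (1 - lam)) < \<epsilon> / 3"
        "\<forall>\<^sub>F n in Fl. \<forall>I. (\<Sum>i=M..<I. E n (\<lambda>s. X n s i)) \<le> \<epsilon> / 3"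
      by (auto simp: eventually_sequentially)
    have "((\<lambda>n. \<Sum>i<M. deviation i n) \<longlongrightarrow> (\<Sum>i<M. 0)) Fl" by (intro tendsto_sum deviation_all)
    then have "\<forall>\<^sub>F n in Fl. (\<Sum>i<M. deviation i n) < \<epsilon> / 3" by (rule order_tendstoD(2)) (use \<epsilon> in simp)
    with M(2) sys_pod show ?thesis
    proof eventually_elim
      case (elim n)
      have "(\<Sum>i<I. deviation i n) \<le> \<epsilon>" for I
      proof -
        have "(\<Sum>i<I. deviation i n) \<le> (\<Sum>i\<in>{..<M} \<union> {M..<I}. deviation i n)"
          by (intro sum_mono2) (auto simp: deviation_nonneg)
        also have "\<dots> = (\<Sum>i<M. deviation i n) + (\<Sum>i=M..<I. deviation i n)"
          by (intro sum.union_disjoint) auto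
        also have "(\<Sum>i=M..<I. deviation i n) \<le> (\<Sum>i=M..<I. E n (\<lambda>s. X n s i) + lam ^ i)"
          using nbrw_pod.mean_deviation_le[OF elim(2) lam(2)]
              unfolding nbrw_pod.mean_deviation_def[OF elim(2)] deviation_def
          by (intro sum_mono)
        also have "\<dots> = (\<Sum>i=M..<I. E n (\<lambda>s. X n s i)) + (\<Sum>i=M..<I. lam ^ i)" by (rule sum.distrib)
        also have "(\<Sum>i=M..<I. lam ^ i) \<le> lam ^ M * (1 / (1 - lam))"
        proof (cases "M \<le> I")
          case True
          have "(1 - lam) * (\<Sum>i=M..<I. lam ^ i) = lam ^ M - lam ^ I"
            using True by (induction I rule: dec_induct) (simp_all add: distrib_left left_diff_distrib)
          also have "\<dots> \<le> lam ^ M" using lam by simp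
          finally show ?thesis using lam by (simp add: pos_le_divide_eq mult.commute)
        qed (use lam in simp)
        finally show ?thesis using elim(3) spec[OF elim(1), of I] M(1) by linarith
      qed
      then show ?case
        using nbrw_pod.l1_deviation[OF elim(2)]
            unfolding nbrw_pod.mean_deviation_def[OF elim(2)] deviation_def by blast
    qed
  qed
  show ?thesis
  proof (rule order_tendstoI)
    fix a :: ennreal assume "0 < a"
    then obtain y where y: "0 < y" "y < a" using dense by blast
    then obtain r where r: "y = ennreal r" "0 \<le> r" by (cases y) auto
    then have "0 < r" using y(1) by simp
    from small[OF this] show "\<forall>\<^sub>F n in Fl. ?f n < a"
      by eventually_elim (use y(2) r(1) in auto)
  qed simp
qed

end

section \<open>Expanders of logarithmic girth satisfy the mixing conditions\<close>

text \<open>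
  At \<open>R = k - 1\<close> the bound \<open>R + (k - 1) / R\<close> is exactly \<open>k\<close>, so a slightly smaller \<open>R\<close> still exceeds \<open>\<theta>\<close>.
\<close>

lemma exists_contraction_root:
  assumes k: "3 \<le> k" and \<theta>: "\<theta> < real k"
  shows "\<exists>R. 1 \<le> R \<and> R < real k - 1 \<and> real k - 1 \<le> R\<^sup>2 \<and> \<theta> < R + (real k - 1) / R"
proof -
  define c where "c = real k - 1"
  have c: "2 \<le> c" using k by (simp add: c_def)
  have "((\<lambda>R. R + c / R) \<longlongrightarrow> c + c / c) (at_left c)"
    using c by (intro tendsto_intros) auto
  then have "\<forall>\<^sub>F R in at_left c. \<theta> < R + c / R"
    by (rule order_tendstoD(1)) (use c \<theta> in \<open>simp add: c_def\<close>)
  moreover have "((\<lambda>R. R\<^sup>2) \<longlongrightarrow> c\<^sup>2) (at_left c)" by (intro tendsto_intros)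
  then have "\<forall>\<^sub>F R in at_left c. c < R\<^sup>2"
    by (rule order_tendstoD(1)) (use c in \<open>simp add: power2_eq_square\<close>)
  moreover have "\<forall>\<^sub>F R in at_left c. 1 < R" "\<forall>\<^sub>F R in at_left c. R < c"
    using eventually_at_left_real[of 1 c] c by (auto elim: eventually_mono)
  ultimately have "\<forall>\<^sub>F R in at_left c. 1 \<le> R \<and> R < c \<and> c \<le> R\<^sup>2 \<and> \<theta> < R + c / R"
    by eventually_elim auto
  then have "\<exists>R. 1 \<le> R \<and> R < c \<and> c \<le> R\<^sup>2 \<and> \<theta> < R + c / R"
    by (rule eventually_happens'[rotated]) simp
  then show ?thesis by (simp add: c_def)
qed

lemma eventually_at_top_in: "eventually P (at_top_in N) \<longleftrightarrow> (\<forall>\<^sub>F n in at_top. n \<in> N \<longrightarrow> P n)"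
  by (simp add: at_top_in_def eventually_inf_principal)

lemma tendsto_at_top_in: "(f \<longlongrightarrow> l) sequentially \<Longrightarrow> (f \<longlongrightarrow> l) (at_top_in N)"
  unfolding at_top_in_def by (rule tendsto_mono[OF inf_le1])

text \<open>
  About \<open>K log n\<close> steps with \<open>K = -3 / log \<beta>\<close> bring the geometric factor \<open>\<beta>\<^sup>r\<close> of the mixing bound below \<open>n\<^sup>-\<^sup>3\<close>. The third power
  pays for the remaining factor \<open>\<surd>n\<close> and for making the error relative to \<open>1 / n\<close>.
\<close>

lemma log_scale_mixing:
  fixes \<beta> c \<alpha> :: real and n :: nat
  assumes \<beta>: "0 < \<beta>" "\<beta> < 1" and c: "1 < c" and \<alpha>: "0 < \<alpha>" and n: "1 \<le> n"
  defines "K \<equiv> - 3 / ln \<beta>"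
    and "r \<equiv> nat \<lceil>(- 3 / ln \<beta>) * ln (real n)\<rceil>"
  shows "\<beta> ^ Suc r \<le> 1 / real n ^ 3"
    and "real r \<le> K * ln (real n) + 1"
    and "(1 / c) ^ nat \<lceil>\<alpha> * log c (real n)\<rceil> \<le> real n powr (- \<alpha>)"
proof -
  have lb: "ln \<beta> < 0" using \<beta> by simp
  have K: "0 < K" using lb by (simp add: K_def divide_neg_neg)
  have rK: "K * ln n \<le> real r" unfolding r_def K_def by (simp add: real_nat_ceiling_ge)
  show "real r \<le> K * ln n + 1"
  proof -
    have "0 \<le> K * ln n" using K n by simp
    then have "real r = of_int \<lceil>K * ln n\<rceil>" unfolding r_def K_def[symmetric] by (simp add: le_ceiling_iff)
    then show ?thesis using of_int_ceiling_le_add_one[of "K * ln n"] by simp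
  qed
  have "\<beta> ^ Suc r \<le> \<beta> ^ r" using \<beta> by (intro power_decreasing) auto
  also have "\<dots> = exp (real r * ln \<beta>)" using \<beta> by (simp add: exp_of_nat_mult)
  also have "\<dots> \<le> exp (K * ln n * ln \<beta>)" using rK lb
      by (intro exp_le_cancel_iff[THEN iffD2] mult_right_mono_neg) auto
  also have "K * ln n * ln \<beta> = - (real 3 * ln n)" using lb by (simp add: K_def)
  also have "exp (- (real 3 * ln n)) = 1 / real n ^ 3" using n
      by (simp only: exp_minus exp_of_nat_mult) (simp add: inverse_eq_divide)
  finally show "\<beta> ^ Suc r \<le> 1 / real n ^ 3" .
  have "(1 / c) ^ nat \<lceil>\<alpha> * log c n\<rceil> = c powr (- real (nat \<lceil>\<alpha> * log c n\<rceil>))"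
    using c by (simp add: powr_minus powr_realpow power_one_over inverse_eq_divide)
  also have "\<dots> \<le> c powr (- (\<alpha> * log c n))"
    using c by (intro powr_mono) (simp_all add: real_nat_ceiling_ge)
  also have "\<dots> = (c powr (log c n)) powr (- \<alpha>)" by (simp add: powr_powr mult.commute)
  also have "\<dots> = n powr (- \<alpha>)" using c n by simp
  finally show "(1 / c) ^ nat \<lceil>\<alpha> * log c n\<rceil> \<le> n powr (- \<alpha>)" .
qed

text \<open>
  The three summands of \<open>\<eta>\<close> bound the mixing error, the ratio \<open>m / n\<close> and the expected number of returns,
  in this order.
\<close>

lemma eventually_mixing:
  assumes lam: "0 < lam" and d: "1 \<le> d" and k: "3 \<le> k" and N: "0 \<notin> N"
    and exp: "expander_sequence N k \<theta> G" and \<alpha>: "0 < \<alpha>"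
    and girth: "\<forall>\<^sub>F n in at_top_in N. girth (G n) > enat (nat (2 * \<lceil>\<alpha> * log (real k - 1) (real n)\<rceil> + 1))"
    and tie: "\<And>n. n \<in> N \<Longrightarrow> tie_breaking_rule n d (G n) (\<tau> n)"
    and tf: "\<And>n. n \<in> N \<Longrightarrow>
        transition_function (states n d (G n)) (nbrw_pod_generator lam d n (G n) (\<tau> n)) (P n)"
    and st: "\<forall>\<^sub>F n in at_top_in N. stationary_distribution (states n d (G n)) (P n) (stat n)"
  shows "\<exists>m \<eta>. (\<eta> \<longlongrightarrow> 0) (at_top_in N)
    \<and> (\<forall>\<^sub>F n in at_top_in N. mixing_nbrw_pod lam d k n (G n) (\<tau> n) (stat n) (m n) (\<eta> n))"
proof -
  have \<theta>: "\<theta> < real k" and regular: "\<And>n. n \<in> N \<Longrightarrow> regular_graph_on n k (G n)"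
    and ls: "Limsup (at_top_in N) (\<lambda>n. ereal (second_eigenvalue n (G n))) \<le> ereal \<theta>"
    using exp by (auto simp: expander_sequence_def)
  obtain R where R: "1 \<le> R" "R < real k - 1" "real k - 1 \<le> R\<^sup>2" "\<theta> < R + (real k - 1) / R"
    using exists_contraction_root[OF k \<theta>] by blast
  have "Limsup (at_top_in N) (\<lambda>n. ereal (second_eigenvalue n (G n))) < ereal (R + (real k - 1) / R)"
    using ls R(4) by (simp add: le_less_trans)
  from Limsup_lessD[OF this]
  have eig: "\<forall>\<^sub>F n in at_top_in N. second_eigenvalue n (G n) < R + (real k - 1) / R" by simp
  define \<beta> where "\<beta> = R / (real k - 1)"
  have \<beta>: "0 < \<beta>" "\<beta> < 1" using R k by (auto simp: \<beta>_def)
  define K where "K = - 3 / ln \<beta>"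
  have K: "0 < K" using \<beta> by (simp add: K_def divide_neg_neg)
  define r where "r n = nat \<lceil>K * ln (real n)\<rceil>" for n :: nat
  define \<eta> where "\<eta> n = 2 * sqrt (real n) * (K * ln (real n) + 3) * (1 / real n ^ 3) * real n
      + (K * ln (real n) + 2) / real n + (K * ln (real n) + 2) * real n powr (- \<alpha>)" for n :: nat
  have \<eta>0: "\<eta> \<longlonglongrightarrow> 0"
  proof -
    have "(\<lambda>n. 2 * K * (sqrt (real n) * ln (real n) * (1 / real n ^ 3) * real n)
        + 6 * (sqrt (real n) * (1 / real n ^ 3) * real n)
        + K * (ln (real n) / real n) + 2 * (1 / real n) + K * (ln (real n) * real n powr (- \<alpha>))
            + 2 * real n powr (- \<alpha>))
        \<longlonglongrightarrow> 2 * K * 0 + 6 * 0 + K * 0 + 2 * 0 + K * 0 + 2 * 0"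
    proof (intro tendsto_add tendsto_mult_left)
      show "(\<lambda>n. sqrt (real n) * ln (real n) * (1 / real n ^ 3) * real n) \<longlonglongrightarrow> 0" by real_asymp
      show "(\<lambda>n. sqrt (real n) * (1 / real n ^ 3) * real n) \<longlonglongrightarrow> 0" by real_asymp
      show "(\<lambda>n. ln (real n) / real n) \<longlonglongrightarrow> 0" by real_asymp
      show "(\<lambda>n. 1 / real n) \<longlonglongrightarrow> 0" by real_asymp
      show "(\<lambda>n. ln (real n) * real n powr (- \<alpha>)) \<longlonglongrightarrow> 0" using \<alpha> by real_asymp
      show "(\<lambda>n. real n powr (- \<alpha>)) \<longlonglongrightarrow> 0" using \<alpha> by real_asymp
    qed
    moreover have "2 * sqrt (real n) * (K * ln (real n) + 3) * (1 / real n ^ 3) * real n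
          + (K * ln (real n) + 2) / real n + (K * ln (real n) + 2) * real n powr (- \<alpha>)
        = 2 * K * (sqrt (real n) * ln (real n) * (1 / real n ^ 3) * real n)
            + 6 * (sqrt (real n) * (1 / real n ^ 3) * real n)
        + K * (ln (real n) / real n) + 2 * (1 / real n) + K * (ln (real n) * real n powr (- \<alpha>))
            + 2 * real n powr (- \<alpha>)"
      for n by (simp add: algebra_simps add_divide_distrib)
    ultimately show ?thesis unfolding \<eta>_def by simp
  qed
  then have "\<forall>\<^sub>F n in sequentially. \<eta> n < 1" by (rule order_tendstoD(2)) simp
  then have \<eta>1: "\<forall>\<^sub>F n in at_top_in N. \<eta> n < 1" unfolding eventually_at_top_in by eventually_elim simp
  have inN: "\<forall>\<^sub>F n in at_top_in N. n \<in> N" unfolding eventually_at_top_in by simp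
  have "\<forall>\<^sub>F n in at_top_in N. mixing_nbrw_pod lam d k n (G n) (\<tau> n) (stat n) (Suc (r n)) (\<eta> n)"
    using inN eig girth st \<eta>1
  proof eventually_elim
    case (elim n)
    have n: "1 \<le> n" using elim(1) N by (cases n) auto
    have k2: "2 \<le> k" using k by simp
    note scale = log_scale_mixing[OF \<beta>, of "real k - 1" \<alpha> n, folded K_def, folded r_def]
    have c: "1 < real k - 1" using k by simp
    have rn: "real (r n) \<le> K * ln n + 1" and bn: "\<beta> ^ Suc (r n) \<le> 1 / real n ^ 3"
      and cn: "(1 / (real k - 1)) ^ nat \<lceil>\<alpha> * log (real k - 1) n\<rceil> \<le> n powr (- \<alpha>)"
      using scale[OF c \<alpha> n] by auto
    have Kl: "0 \<le> K * ln n" using K n by simp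
    define t1 where "t1 = 2 * sqrt n * (K * ln n + 3) * (1 / real n ^ 3) * n"
    define t2 where "t2 = (K * ln n + 2) / n"
    define t3 where "t3 = (K * ln n + 2) * n powr (- \<alpha>)"
    have t: "0 \<le> t1" "0 \<le> t2" "0 \<le> t3" "\<eta> n = t1 + t2 + t3"
      using Kl n by (auto simp: t1_def t2_def t3_def \<eta>_def)
    interpret nbrw_pod lam d k n "G n" "\<tau> n" "stat n"
    proof
      show "set_pmf (stat n) \<subseteq> states n d (G n)" using elim by (simp add: stationary_distribution_def)
      show "bind_pmf (stat n) (jump_chain lam d n (G n) (\<tau> n)) = stat n"
        using stationary_jump_chain[OF regular[OF elim(1)] k2 tie[OF elim(1)] lam _ tf[OF elim(1)] elim(4)] n by simp
    qed (use lam d k2 n regular[OF elim(1)] tie[OF elim(1)] in auto)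
    show ?case
    proof
      show "0 \<le> \<eta> n" using t by simp
      show "\<eta> n \<le> 1" using elim by simp
      show "real (Suc (r n)) \<le> \<eta> n * real n"
      proof -
        have "real (Suc (r n)) \<le> t2 * n" using rn n by (simp add: t2_def)
        also have "\<dots> \<le> \<eta> n * n" using t by (intro mult_right_mono) auto
        finally show ?thesis .
      qed
      fix e assume e: "e \<in> parcs (G n)"
      show "(\<Sum>r'<Suc (r n). head_prob (G n) (Suc r') e (snd e)) \<le> \<eta> n"
      proof -
        let ?l = "nat \<lceil>\<alpha> * log (real k - 1) n\<rceil>"
        have "enat (2 * ?l) < girth (G n)"
        proof -
          have "2 * ?l \<le> nat (2 * \<lceil>\<alpha> * log (real k - 1) n\<rceil> + 1)" by simp
          then have "enat (2 * ?l) \<le> enat (nat (2 * \<lceil>\<alpha> * log (real k - 1) n\<rceil> + 1))" by simp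
          then show ?thesis using elim(3) by (rule le_less_trans)
        qed
        from head_prob_return_sum[OF regular[OF elim(1)] k2 this e, of "Suc (r n)"]
        have "(\<Sum>r'<Suc (r n). head_prob (G n) (Suc r') e (snd e))
            \<le> real (Suc (r n)) * (1 / (real k - 1)) ^ ?l"
          by (simp only: One_nat_def sum.atLeast1_atMost_eq)
        also have "\<dots> \<le> (K * ln n + 2) * n powr (- \<alpha>)"
          using cn rn c Kl by (intro mult_mono) auto
        also have "\<dots> \<le> \<eta> n" using t by (simp add: t3_def)
        finally show ?thesis .
      qed
      fix x assume x: "x < n"
      show "\<bar>head_prob (G n) (Suc (r n)) e x - 1 / real n\<bar> \<le> \<eta> n / real n"
      proof -
        have "\<bar>head_prob (G n) (Suc (r n)) e x - 1 / real n\<bar> \<le> 2 * sqrt n * (real (r n) + 2) * \<beta> ^ Suc (r n)"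
          unfolding \<beta>_def using elim(2) by (intro nbrw_mixing[OF regular[OF elim(1)] k2 R(1,3) _ e x]) simp
        also have "\<dots> \<le> 2 * sqrt n * (K * ln n + 3) * (1 / real n ^ 3)"
          using rn bn Kl \<beta> by (intro mult_mono mult_left_mono) auto
        also have "\<dots> = t1 / n" using n by (simp add: t1_def)
        also have "\<dots> \<le> \<eta> n / n" using t by (intro divide_right_mono) auto
        finally show ?thesis .
      qed
    qed
  qed
  with tendsto_at_top_in[OF \<eta>0] show ?thesis
    by (intro exI[of _ "\<lambda>n. Suc (r n)"] exI[of _ \<eta>] conjI)
qed

theorem theorem3:
  fixes lam \<theta> \<alpha> :: real
    and d k :: nat
    and N :: "nat set"
    and G :: "nat \<Rightarrow> nat pair_pre_digraph"
    and \<tau> :: "nat \<Rightarrow> state \<Rightarrow> nat pmf"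
    and P :: "nat \<Rightarrow> real \<Rightarrow> state \<Rightarrow> state pmf"
    and stat :: "nat \<Rightarrow> state pmf"
  assumes "0 < lam" and "lam < 1" and "d \<ge> 2" and "k \<ge> 3"
    and "infinite N" and "0 \<notin> N"
    and "expander_sequence N k \<theta> G"
    and "\<alpha> > 0"
    and "\<forall>\<^sub>F n in at_top_in N.
           girth (G n) > enat (nat (2 * \<lceil>\<alpha> * log (real k - 1) (real n)\<rceil> + 1))"
    and "\<And>n. n \<in> N \<Longrightarrow> tie_breaking_rule n d (G n) (\<tau> n)"
    and "\<And>n. n \<in> N \<Longrightarrow>
           transition_function (states n d (G n)) (nbrw_pod_generator lam d n (G n) (\<tau> n)) (P n)"
    and "\<forall>\<^sub>F n in at_top_in N. stationary_distribution (states n d (G n)) (P n) (stat n)"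
  shows "\<exists>x. (\<forall>i. x i \<in> {0..1}) \<and> l1_norm x < \<infinity> \<and> fixed_point lam d x \<and>
           (\<forall>y. (\<forall>i. y i \<in> {0..1}) \<and> l1_norm y < \<infinity> \<and> fixed_point lam d y \<longrightarrow> y = x) \<and>
           ((\<lambda>n. \<integral>\<^sup>+ s. l1_norm (\<lambda>i. queue_proportion n (fst s) i - x i) \<partial>measure_pmf (stat n))
              \<longlongrightarrow> 0) (at_top_in N)"
proof (intro exI conjI allI impI)
  have d: "1 \<le> d" using assms(3) by simp
  note z = assms(1,2) d
  show "equilibrium lam d i \<in> {0..1}" for i using equilibrium_bounds[OF z] by auto
  show "l1_norm (equilibrium lam d) < \<infinity>" by (rule equilibrium_l1_norm[OF z])
  show "fixed_point lam d (equilibrium lam d)" by (rule equilibrium_fixed_point)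
  show "y = equilibrium lam d" if "(\<forall>i. y i \<in> {0..1}) \<and> l1_norm y < \<infinity> \<and> fixed_point lam d y" for y
    using fixed_point_unique[OF d] that by blast
  obtain m \<eta> where "(\<eta> \<longlongrightarrow> 0) (at_top_in N)"
    "\<forall>\<^sub>F n in at_top_in N. mixing_nbrw_pod lam d k n (G n) (\<tau> n) (stat n) (m n) (\<eta> n)"
    using eventually_mixing[OF assms(1) d assms(4,6-12)] by blast
  then interpret nbrw_pod_sequence lam d k G \<tau> stat m \<eta> "at_top_in N"
    using z by unfold_locales (auto intro: tendsto_at_top_in lim_1_over_n)
  show "((\<lambda>n. \<integral>\<^sup>+ s. l1_norm (\<lambda>i. queue_proportion n (fst s) i - equilibrium lam d i) \<partial>measure_pmf (stat n))
      \<longlongrightarrow> 0) (at_top_in N)"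
    by (rule l1_convergence)
qed

end
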